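(* If $\alpha\in\mathbb{C}$ satisfies $|\mathrm{Re}\sqrt{\alpha}|<1$, then $\mathcal{D}(L_\alpha^{\min})=\mathcal{H}_0^2(\mathbb{R}_+)$. Moreover, $$\{\alpha\in\mathbb{C} : |\mathrm{Re}\sqrt\alpha|<1\}\ni\alpha\mapsto L_\alpha^{\min}$$ is a holomorphic family of closed operators.
   Context: $\mathbb{R}_+=]0,\infty[$; all operators act in the complex Hilbert space $L^2(\mathbb{R}_+)$, and $\mathcal{D}(T)$ is the domain of $T$. For $\alpha\in\mathbb{C}$, $L_\alpha$ is the differential expression $L_\alpha=-\frac{d^2}{dx^2}+\left(\alpha-\frac14\right)\frac1{x^2}$ (in the distributional sense on $\mathbb{R}_+$). $L_\alpha^{\max}$ is the operator given by $L_\alpha$ on $\mathcal{D}(L_\alpha^{\max})=\{f\in L^2(\mathbb{R}_+) : L_\alpha f\in L^2(\mathbb{R}_+)\}$, and $L_\alpha^{\min}$ is the closure of the restriction of $L_\alpha^{\max}$ to $C_c^\infty(\mathbb{R}_+)$. The quantity $|\mathrm{Re}\sqrt\alpha|$ does not depend on the choice of the square root. $\mathcal{H}^2(\mathbb{R}_+)=\{f\in L^2(\mathbb{R}_+) : f''\in L^2(\mathbb{R}_+)\}$ and $\mathcal{H}^2_0(\mathbb{R}_+)=\{f\in\mathcal{H}^2(\mathbb{R}_+) : f(0)=f'(0)=0\}$. Holomorphic family of closed operators: let $\Theta\subset\mathbb{C}$ be open, $\mathcal{H}$ a Banach space and $\Theta\ni z\mapsto H(z)$ a function whose values are closed operators on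 $\mathcal{H}$. It is a holomorphic family of closed operators if for each $z_0\in\Theta$ there exist a neighborhood $\Theta_0$ of $z_0$, a Banach space $\mathcal{K}$ and a holomorphic family of bounded operators $\Theta_0\ni z\mapsto A(z)\in B(\mathcal{K},\mathcal{H})$ such that $\mathrm{Ran}\,A(z)=\mathcal{D}(H(z))$ and $\Theta_0\ni z\mapsto H(z)A(z)\in B(\mathcal{K},\mathcal{H})$ is a holomorphic family of bounded operators. *)

theory Defs
  imports "HOL-Analysis.Analysis"
begin

section \<open>Complex Banach spaces\<close>

class complex_banach = banach +
  fixes scaleC :: "complex \<Rightarrow> 'a \<Rightarrow> 'a"  (infixr \<open>*\<^sub>C\<close> 75)
  assumes scaleC_add_right: "c *\<^sub>C (x + y) = c *\<^sub>C x + c *\<^sub>C y"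
    and scaleC_add_left: "(c + d) *\<^sub>C x = c *\<^sub>C x + d *\<^sub>C x"
    and scaleC_scaleC: "c *\<^sub>C d *\<^sub>C x = (c * d) *\<^sub>C x"
    and scaleR_scaleC: "r *\<^sub>R x = complex_of_real r *\<^sub>C x"
    and norm_scaleC: "norm (c *\<^sub>C x) = cmod c * norm x"

text \<open>
  Complex Banach spaces on an explicit carrier set: unlike a type, such a structure can be
  existentially quantified inside a definition.
\<close>

record 'k cbs =
  cbs_carrier :: "'k set"
  cbs_zero :: 'k
  cbs_add :: "'k \<Rightarrow> 'k \<Rightarrow> 'k"
  cbs_scale :: "complex \<Rightarrow> 'k \<Rightarrow> 'k"
  cbs_norm :: "'k \<Rightarrow> real"

definition cbs_diff :: "'k cbs \<Rightarrow> 'k \<Rightarrow> 'k \<Rightarrow> 'k" where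
  "cbs_diff K x y = cbs_add K x (cbs_scale K (-1) y)"

definition cbs_vector_space :: "'k cbs \<Rightarrow> bool" where
  "cbs_vector_space K \<longleftrightarrow>
     cbs_zero K \<in> cbs_carrier K \<and>
     (\<forall>x\<in>cbs_carrier K. \<forall>y\<in>cbs_carrier K. cbs_add K x y \<in> cbs_carrier K) \<and>
     (\<forall>c. \<forall>x\<in>cbs_carrier K. cbs_scale K c x \<in> cbs_carrier K) \<and>
     (\<forall>x\<in>cbs_carrier K. \<forall>y\<in>cbs_carrier K. \<forall>z\<in>cbs_carrier K.
        cbs_add K (cbs_add K x y) z = cbs_add K x (cbs_add K y z)) \<and>
     (\<forall>x\<in>cbs_carrier K. \<forall>y\<in>cbs_carrier K. cbs_add K x y = cbs_add K y x) \<and>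
     (\<forall>x\<in>cbs_carrier K. cbs_add K (cbs_zero K) x = x) \<and>
     (\<forall>x\<in>cbs_carrier K. cbs_diff K x x = cbs_zero K) \<and>
     (\<forall>c. \<forall>x\<in>cbs_carrier K. \<forall>y\<in>cbs_carrier K.
        cbs_scale K c (cbs_add K x y) = cbs_add K (cbs_scale K c x) (cbs_scale K c y)) \<and>
     (\<forall>c d. \<forall>x\<in>cbs_carrier K.
        cbs_scale K (c + d) x = cbs_add K (cbs_scale K c x) (cbs_scale K d x)) \<and>
     (\<forall>c d. \<forall>x\<in>cbs_carrier K. cbs_scale K c (cbs_scale K d x) = cbs_scale K (c * d) x) \<and>
     (\<forall>x\<in>cbs_carrier K. cbs_scale K 1 x = x)"

definition cbs_normed :: "'k cbs \<Rightarrow> bool" where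
  "cbs_normed K \<longleftrightarrow>
     (\<forall>x\<in>cbs_carrier K. 0 \<le> cbs_norm K x) \<and>
     (\<forall>x\<in>cbs_carrier K. cbs_norm K x = 0 \<longleftrightarrow> x = cbs_zero K) \<and>
     (\<forall>c. \<forall>x\<in>cbs_carrier K. cbs_norm K (cbs_scale K c x) = cmod c * cbs_norm K x) \<and>
     (\<forall>x\<in>cbs_carrier K. \<forall>y\<in>cbs_carrier K.
        cbs_norm K (cbs_add K x y) \<le> cbs_norm K x + cbs_norm K y)"

definition cbs_complete :: "'k cbs \<Rightarrow> bool" where
  "cbs_complete K \<longleftrightarrow>
     (\<forall>X :: nat \<Rightarrow> 'k. (\<forall>n. X n \<in> cbs_carrier K) \<longrightarrow>
        (\<forall>e>0. \<exists>N. \<forall>m\<ge>N. \<forall>n\<ge>N. cbs_norm K (cbs_diff K (X m) (X n)) < e) \<longrightarrow>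
        (\<exists>x\<in>cbs_carrier K. (\<lambda>n. cbs_norm K (cbs_diff K (X n) x)) \<longlonglongrightarrow> 0))"

definition complex_banach_space :: "'k cbs \<Rightarrow> bool" where
  "complex_banach_space K \<longleftrightarrow> cbs_vector_space K \<and> cbs_normed K \<and> cbs_complete K"

section \<open>Holomorphic families of operators\<close>

definition bounded_operator :: "'k cbs \<Rightarrow> ('k \<Rightarrow> 'h::complex_banach) \<Rightarrow> bool" where
  "bounded_operator K T \<longleftrightarrow>
     (\<forall>x\<in>cbs_carrier K. \<forall>y\<in>cbs_carrier K. T (cbs_add K x y) = T x + T y) \<and>
     (\<forall>c. \<forall>x\<in>cbs_carrier K. T (cbs_scale K c x) = c *\<^sub>C T x) \<and>
     (\<exists>C. \<forall>x\<in>cbs_carrier K. norm (T x) \<le> C * cbs_norm K x)"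

text \<open>
  Complex differentiability in the operator norm at every point of \<open>\<Theta>\<close>: the last line says that
  the operator norm of \<open>A(w) - A(z) - (w - z) D\<close> is at most \<open>e |w - z|\<close>.
\<close>

definition holomorphic_bounded_family ::
    "'k cbs \<Rightarrow> complex set \<Rightarrow> (complex \<Rightarrow> 'k \<Rightarrow> 'h::complex_banach) \<Rightarrow> bool" where
  "holomorphic_bounded_family K \<Theta> A \<longleftrightarrow>
     open \<Theta> \<and>
     (\<forall>z\<in>\<Theta>. bounded_operator K (A z)) \<and>
     (\<forall>z\<in>\<Theta>. \<exists>D. bounded_operator K D \<and>
        (\<forall>e>0. \<forall>\<^sub>F w in at z. \<forall>x\<in>cbs_carrier K.
           norm (A w x - A z x - (w - z) *\<^sub>C D x) \<le> e * cmod (w - z) * cbs_norm K x))"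

text \<open>
  An unbounded operator is its graph; its domain is the \<^const>\<open>Domain\<close> of the graph.
\<close>

definition closed_operator :: "('h::complex_banach \<times> 'h) set \<Rightarrow> bool" where
  "closed_operator T \<longleftrightarrow>
     (0, 0) \<in> T \<and>
     (\<forall>f g f' g'. (f, g) \<in> T \<longrightarrow> (f', g') \<in> T \<longrightarrow> (f + f', g + g') \<in> T) \<and>
     (\<forall>c f g. (f, g) \<in> T \<longrightarrow> (c *\<^sub>C f, c *\<^sub>C g) \<in> T) \<and>
     single_valued T \<and>
     closed T"

definition op_apply :: "('h \<times> 'h) set \<Rightarrow> 'h \<Rightarrow> 'h" where
  "op_apply T f = (THE g. (f, g) \<in> T)"

text \<open>
  The auxiliary space \<open>K\<close> ranges over all complex Banach spaces whose underlying set is a subset of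
  the type \<open>'h\<close>, with arbitrary operations and norm. Up to isomorphism this is no restriction:
  shrink \<open>\<Theta>\<^sub>0\<close> to a disc and divide \<open>K\<close> by the intersection of the kernels of all \<open>A(z)\<close>; since \<open>A\<close> is
  determined by its values on a countable dense set, the quotient embeds into a countable power of
  \<open>'h\<close>, which for a nonzero Banach space has the cardinality of \<open>'h\<close> itself.
\<close>

definition holomorphic_closed_family ::
    "complex set \<Rightarrow> (complex \<Rightarrow> ('h::complex_banach \<times> 'h) set) \<Rightarrow> bool" where
  "holomorphic_closed_family \<Theta> H \<longleftrightarrow>
     open \<Theta> \<and>
     (\<forall>z\<in>\<Theta>. closed_operator (H z)) \<and>
     (\<forall>z0\<in>\<Theta>. \<exists>\<Theta>\<^sub>0 (K :: 'h cbs) A.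
        open \<Theta>\<^sub>0 \<and> z0 \<in> \<Theta>\<^sub>0 \<and> \<Theta>\<^sub>0 \<subseteq> \<Theta> \<and>
        complex_banach_space K \<and>
        holomorphic_bounded_family K \<Theta>\<^sub>0 A \<and>
        (\<forall>z\<in>\<Theta>\<^sub>0. A z ` cbs_carrier K = Domain (H z)) \<and>
        holomorphic_bounded_family K \<Theta>\<^sub>0 (\<lambda>z x. op_apply (H z) (A z x)))"

section \<open>The space \<open>L\<^sup>2(\<real>\<^sub>+)\<close>\<close>

lemma cmod_add_sq_le: "(cmod (a + b))\<^sup>2 \<le> 2 * (cmod a)\<^sup>2 + 2 * (cmod b)\<^sup>2"
proof -
  have "(cmod (a + b))\<^sup>2 \<le> (cmod a + cmod b)\<^sup>2"
    by (simp add: norm_triangle_ineq power_mono)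
  also have "\<dots> \<le> 2 * (cmod a)\<^sup>2 + 2 * (cmod b)\<^sup>2"
    using sum_squares_bound[of "cmod a" "cmod b"] by (simp add: power2_sum)
  finally show ?thesis .
qed

lemma L2_complete:
  fixes F :: "nat \<Rightarrow> 'a \<Rightarrow> complex"
  assumes meas: "\<And>n. F n \<in> borel_measurable M"
    and int: "\<And>n. integrable M (\<lambda>x. (cmod (F n x))\<^sup>2)"
    and cau: "\<And>e. e > 0 \<Longrightarrow> \<exists>N. \<forall>m\<ge>N. \<forall>n\<ge>N. (\<integral>x. (cmod (F m x - F n x))\<^sup>2 \<partial>M) < e"
  shows "\<exists>f. f \<in> borel_measurable M \<and> integrable M (\<lambda>x. (cmod (f x))\<^sup>2) \<and>
           (\<forall>e>0. \<exists>N. \<forall>n\<ge>N. (\<integral>x. (cmod (F n x - f x))\<^sup>2 \<partial>M) \<le> e)"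
proof -
  note [measurable] = meas
  have intd: "integrable M (\<lambda>x. (cmod (F m x - F n x))\<^sup>2)" for m n
    by (rule Bochner_Integration.integrable_bound[where f = "\<lambda>x. 2 * (cmod (F m x))\<^sup>2 + 2 * (cmod (F n x))\<^sup>2"])
       (use int cmod_add_sq_le[of "F m _" "- F n _"] in auto)
  define d where "d m n = (\<integral>\<^sup>+x. ennreal ((cmod (F m x - F n x))\<^sup>2) \<partial>M)" for m n
  have d_eq: "d m n = ennreal (\<integral>x. (cmod (F m x - F n x))\<^sup>2 \<partial>M)" for m n
    unfolding d_def by (rule nn_integral_eq_integral[OF intd]) simp
  have cau': "\<exists>N. \<forall>m\<ge>N. \<forall>n\<ge>N. d m n \<le> ennreal e" if "e > 0" for e
    using cau[OF that] by (metis d_eq ennreal_leI less_imp_le)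
  then have "\<forall>k. \<exists>N. \<forall>m\<ge>N. \<forall>n\<ge>N. d m n \<le> ennreal ((1/8)^k)" by simp
  then obtain N where N: "\<And>k m n. m \<ge> N k \<Longrightarrow> n \<ge> N k \<Longrightarrow> d m n \<le> ennreal ((1/8)^k)" by metis
  define r where "r k = (\<Sum>i\<le>k. N i) + k" for k
  have r_ge: "r k \<ge> N k" "r (Suc k) \<ge> N k" "r k \<ge> k" for k
  proof -
    have "N k \<le> sum N {..k}" by (rule member_le_sum) auto
    then show "r k \<ge> N k" "r (Suc k) \<ge> N k" "r k \<ge> k" by (auto simp: r_def)
  qed
  define D where "D k x = cmod (F (r (Suc k)) x - F (r k) x)" for k x
  have [measurable]: "D k \<in> borel_measurable M" for k unfolding D_def by measurable
  have D_int: "(\<integral>\<^sup>+x. ennreal (2^k * (D k x)\<^sup>2) \<partial>M) \<le> ennreal ((1/4)^k)" for k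
  proof -
    have "(\<integral>\<^sup>+x. ennreal (2^k * (D k x)\<^sup>2) \<partial>M) = ennreal (2^k) * d (r (Suc k)) (r k)"
      unfolding d_def D_def by (subst nn_integral_cmult[symmetric]) (auto simp: ennreal_mult)
    also have "\<dots> \<le> ennreal (2^k) * ennreal ((1/8)^k)"
      by (intro mult_left_mono N r_ge) auto
    also have "\<dots> = ennreal ((1/4)^k)"
      by (simp add: ennreal_mult[symmetric] power_mult_distrib[symmetric])
    finally show ?thesis .
  qed
  have "(\<integral>\<^sup>+x. (\<Sum>k. ennreal (2^k * (D k x)\<^sup>2)) \<partial>M) = (\<Sum>k. \<integral>\<^sup>+x. ennreal (2^k * (D k x)\<^sup>2) \<partial>M)"
    by (rule nn_integral_suminf) auto
  also have "\<dots> \<le> (\<Sum>k. ennreal ((1/4)^k))" by (intro suminf_le D_int) auto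
  also have "\<dots> = ennreal (\<Sum>k. (1/4)^k)" by (intro suminf_ennreal2) auto
  also have "\<dots> < \<infinity>" by simp
  finally have "AE x in M. (\<Sum>k. ennreal (2^k * (D k x)\<^sup>2)) \<noteq> \<infinity>"
    by (intro nn_integral_noteq_infinite) auto
  then have conv: "AE x in M. convergent (\<lambda>k. F (r k) x)"
  proof eventually_elim
    case (elim x)
    have "summable (\<lambda>k. 2^k * (D k x)\<^sup>2)"
      using elim by (intro summable_suminf_not_top) auto
    then have "Bseq (\<lambda>k. 2^k * (D k x)\<^sup>2)"
      using summable_LIMSEQ_zero convergent_imp_Bseq convergentI by blast
    then obtain C where C: "C > 0" "\<And>k. 2^k * (D k x)\<^sup>2 \<le> C"
      by (force simp: Bseq_def)
    have D_le: "D k x \<le> sqrt C * (sqrt (1/2))^k" for k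
    proof -
      have "(D k x)\<^sup>2 \<le> C * (1/2)^k" using C(2)[of k] by (simp add: field_simps power_one_over)
      also have "\<dots> = (sqrt C)\<^sup>2 * ((sqrt (1/2))\<^sup>2)^k" using C(1) by simp
      also have "\<dots> = (sqrt C * (sqrt (1/2))^k)\<^sup>2"
        by (simp only: power_mult_distrib power_mult[symmetric] mult.commute)
      finally show ?thesis by (rule power2_le_imp_le) (use C in auto)
    qed
    have "summable (\<lambda>k. F (r (Suc k)) x - F (r k) x)"
    proof (rule summable_comparison_test)
      show "\<exists>N. \<forall>n\<ge>N. norm (F (r (Suc n)) x - F (r n) x) \<le> sqrt C * (sqrt (1/2))^n"
        using D_le unfolding D_def by auto
      show "summable (\<lambda>n. sqrt C * (sqrt (1/2))^n)"
        by (intro summable_mult summable_geometric) (simp add: real_sqrt_divide)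
    qed
    then have "convergent (\<lambda>n. \<Sum>k<n. F (r (Suc k)) x - F (r k) x)"
      by (simp add: summable_iff_convergent)
    then have "convergent (\<lambda>n. F (r n) x - F (r 0) x)"
      using sum_lessThan_telescope[of "\<lambda>k. F (r k) x"] by simp
    then show ?case using convergent_diff_const_right_iff by blast
  qed
  define f where "f x = lim (\<lambda>k. F (r k) x)" for x
  have fm[measurable]: "f \<in> borel_measurable M" unfolding f_def by measurable
  have lim: "AE x in M. (\<lambda>k. F (r k) x) \<longlonglongrightarrow> f x"
    using conv by eventually_elim (simp add: f_def convergent_LIMSEQ_iff)
  have bound: "(\<integral>\<^sup>+x. ennreal ((cmod (F n x - f x))\<^sup>2) \<partial>M) \<le> ennreal e"
    if "e > 0" and K: "\<And>m k. m \<ge> K \<Longrightarrow> k \<ge> K \<Longrightarrow> d m k \<le> ennreal e" and "n \<ge> K" for e K n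
  proof -
    have "(\<integral>\<^sup>+x. ennreal ((cmod (F n x - f x))\<^sup>2) \<partial>M)
        = (\<integral>\<^sup>+x. liminf (\<lambda>k. ennreal ((cmod (F n x - F (r k) x))\<^sup>2)) \<partial>M)"
      using lim
      by (intro nn_integral_cong_AE, eventually_elim)
         (rule lim_imp_Liminf[symmetric], auto intro!: tendsto_intros)
    also have "\<dots> \<le> liminf (\<lambda>k. d n (r k))"
      unfolding d_def by (rule nn_integral_liminf) auto
    also have "\<dots> \<le> ennreal e"
    proof (rule Liminf_le)
      show "\<forall>\<^sub>F k in sequentially. d n (r k) \<le> ennreal e"
        by (rule eventually_sequentiallyI[of K]) (use r_ge(3) le_trans K \<open>n \<ge> K\<close> in blast)
    qed auto
    finally show ?thesis .
  qed
  have intf: "integrable M (\<lambda>x. (cmod (F n x - f x))\<^sup>2)"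
    if "e > 0" and K: "\<And>m k. m \<ge> K \<Longrightarrow> k \<ge> K \<Longrightarrow> d m k \<le> ennreal e" and "n \<ge> K" for e K n
    using bound[OF that] by (intro integrableI_bounded) (auto simp: top_unique order_le_less_trans)
  obtain K where K: "\<And>m k. m \<ge> K \<Longrightarrow> k \<ge> K \<Longrightarrow> d m k \<le> ennreal 1" using cau'[of 1] by auto
  have "integrable M (\<lambda>x. (cmod (F K x - f x))\<^sup>2)"
    by (rule intf[OF _ K]) auto
  then have "integrable M (\<lambda>x. 2 * (cmod (F K x))\<^sup>2 + 2 * (cmod (F K x - f x))\<^sup>2)"
    using int by auto
  moreover have le: "(cmod (f x))\<^sup>2 \<le> 2 * (cmod (F K x))\<^sup>2 + 2 * (cmod (F K x - f x))\<^sup>2" for x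
    using cmod_add_sq_le[of "F K x" "f x - F K x"] by (simp add: norm_minus_commute)
  ultimately have "integrable M (\<lambda>x. (cmod (f x))\<^sup>2)"
    using fm by (elim Bochner_Integration.integrable_bound) (auto intro!: AE_I2 simp: le)
  moreover have "\<exists>N. \<forall>n\<ge>N. (\<integral>x. (cmod (F n x - f x))\<^sup>2 \<partial>M) \<le> e" if e: "e > 0" for e
  proof -
    obtain K where K: "\<And>m k. m \<ge> K \<Longrightarrow> k \<ge> K \<Longrightarrow> d m k \<le> ennreal e" using cau'[OF e] by auto
    have "(\<integral>x. (cmod (F n x - f x))\<^sup>2 \<partial>M) \<le> e" if "n \<ge> K" for n
    proof -
      have "ennreal (\<integral>x. (cmod (F n x - f x))\<^sup>2 \<partial>M) \<le> ennreal e"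
        using bound[OF e K that] nn_integral_eq_integral[OF intf[OF e K that]] by auto
      then show ?thesis using e by (simp add: ennreal_le_iff)
    qed
    then show ?thesis by blast
  qed
  ultimately show ?thesis using fm by blast
qed

abbreviation Rplus :: "real measure" where
  "Rplus \<equiv> lebesgue_on {0<..}"

definition square_integrable :: "(real \<Rightarrow> complex) \<Rightarrow> bool" where
  "square_integrable f \<longleftrightarrow>
     f \<in> borel_measurable Rplus \<and> integrable Rplus (\<lambda>x. (cmod (f x))\<^sup>2)"

definition l2_eq :: "(real \<Rightarrow> complex) \<Rightarrow> (real \<Rightarrow> complex) \<Rightarrow> bool" where
  "l2_eq f g \<longleftrightarrow> square_integrable f \<and> square_integrable g \<and> (AE x in Rplus. f x = g x)"

lemma square_integrable_measurable:
  "square_integrable f \<Longrightarrow> f \<in> borel_measurable Rplus"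
  by (simp add: square_integrable_def)

lemma square_integrable_add:
  assumes "square_integrable f" "square_integrable g"
  shows "square_integrable (\<lambda>x. f x + g x)"
proof -
  have [measurable]: "f \<in> borel_measurable Rplus" "g \<in> borel_measurable Rplus"
    using assms by (auto simp: square_integrable_def)
  have "integrable Rplus (\<lambda>x. (cmod (f x + g x))\<^sup>2)"
    by (rule Bochner_Integration.integrable_bound
          [where f = "\<lambda>x. 2 * (cmod (f x))\<^sup>2 + 2 * (cmod (g x))\<^sup>2"])
       (use assms cmod_add_sq_le in \<open>auto simp: square_integrable_def\<close>)
  then show ?thesis by (simp add: square_integrable_def)
qed

lemma square_integrable_mult:
  "square_integrable f \<Longrightarrow> square_integrable (\<lambda>x. c * f x)"
  by (auto simp: square_integrable_def norm_mult power_mult_distrib)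

lemma square_integrable_zero: "square_integrable (\<lambda>x. 0)"
  by (simp add: square_integrable_def)

lemma square_integrable_uminus:
  "square_integrable f \<Longrightarrow> square_integrable (\<lambda>x. - f x)"
  using square_integrable_mult[of f "-1"] by simp

lemma square_integrable_diff:
  "square_integrable f \<Longrightarrow> square_integrable g \<Longrightarrow> square_integrable (\<lambda>x. f x - g x)"
  using square_integrable_add[of f "\<lambda>x. - g x"] square_integrable_uminus[of g] by simp

lemma square_integrable_inner:
  assumes "square_integrable f" "square_integrable g"
  shows "integrable Rplus (\<lambda>x. inner (f x) (g x))"
proof -
  have [measurable]: "f \<in> borel_measurable Rplus" "g \<in> borel_measurable Rplus"
    using assms by (auto simp: square_integrable_def)
  have le: "\<bar>inner a b\<bar> \<le> (cmod a)\<^sup>2 + (cmod b)\<^sup>2" for a b :: complex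
  proof -
    have "\<bar>inner a b\<bar> \<le> cmod a * cmod b" by (rule Cauchy_Schwarz_ineq2)
    also have "\<dots> \<le> (cmod a)\<^sup>2 + (cmod b)\<^sup>2"
      using sum_squares_bound[of "cmod a" "cmod b"] mult_nonneg_nonneg[of "cmod a" "cmod b"]
      by (simp del: mult_nonneg_nonneg)
    finally show ?thesis .
  qed
  have "integrable Rplus (\<lambda>x. (cmod (f x))\<^sup>2 + (cmod (g x))\<^sup>2)"
    using assms by (intro Bochner_Integration.integrable_add) (simp_all only: square_integrable_def)
  then show ?thesis
  proof (rule Bochner_Integration.integrable_bound)
    show "AE x in Rplus. norm (inner (f x) (g x)) \<le> norm ((cmod (f x))\<^sup>2 + (cmod (g x))\<^sup>2)"
      by (rule AE_I2) (simp add: le)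
  qed measurable
qed

quotient_type l2 = "real \<Rightarrow> complex" / partial: l2_eq
proof (rule part_equivpI)
  show "\<exists>f. l2_eq f f"
    using square_integrable_zero by (auto simp: l2_eq_def)
  show "symp l2_eq"
    by (auto simp: symp_def l2_eq_def)
  show "transp l2_eq"
    by (auto simp: transp_def l2_eq_def)
qed

instantiation l2 :: real_inner
begin

lift_definition zero_l2 :: l2 is "\<lambda>x. 0"
  by (simp add: l2_eq_def square_integrable_zero)

lift_definition plus_l2 :: "l2 \<Rightarrow> l2 \<Rightarrow> l2" is "\<lambda>f g x. f x + g x"
  by (auto simp: l2_eq_def square_integrable_add)

lift_definition uminus_l2 :: "l2 \<Rightarrow> l2" is "\<lambda>f x. - f x"
  by (auto simp: l2_eq_def square_integrable_uminus)

lift_definition minus_l2 :: "l2 \<Rightarrow> l2 \<Rightarrow> l2" is "\<lambda>f g x. f x - g x"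
  by (auto simp: l2_eq_def square_integrable_diff)

lift_definition scaleR_l2 :: "real \<Rightarrow> l2 \<Rightarrow> l2" is "\<lambda>r f x. complex_of_real r * f x"
  by (auto simp: l2_eq_def square_integrable_mult)

lift_definition inner_l2 :: "l2 \<Rightarrow> l2 \<Rightarrow> real" is
  "\<lambda>f g. \<integral>x. inner (f x) (g x) \<partial>Rplus"
  by (intro integral_cong_AE)
     (auto simp: l2_eq_def square_integrable_def)

lift_definition norm_l2 :: "l2 \<Rightarrow> real" is
  "\<lambda>f. sqrt (\<integral>x. (cmod (f x))\<^sup>2 \<partial>Rplus)"
  by (intro arg_cong[where f = sqrt] integral_cong_AE)
     (auto simp: l2_eq_def square_integrable_def)

definition dist_l2 :: "l2 \<Rightarrow> l2 \<Rightarrow> real" where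
  "dist_l2 f g = norm (f - g)"

definition sgn_l2 :: "l2 \<Rightarrow> l2" where
  "sgn_l2 f = inverse (norm f) *\<^sub>R f"

definition uniformity_l2 :: "(l2 \<times> l2) filter" where
  "uniformity_l2 = (INF e\<in>{0<..}. principal {(f, g). dist f g < e})"

definition open_l2 :: "l2 set \<Rightarrow> bool" where
  "open_l2 U \<longleftrightarrow> (\<forall>f\<in>U. \<forall>\<^sub>F (f', g) in uniformity. f' = f \<longrightarrow> g \<in> U)"

instance
proof
  fix f g h :: l2 and r s :: real
  show "f + g + h = f + (g + h)"
    by transfer (auto simp: l2_eq_def add.assoc intro!: square_integrable_add)
  show "f + g = g + f"
    by transfer (auto simp: l2_eq_def add.commute intro!: square_integrable_add)
  show "0 + f = f"
    by transfer (auto simp: l2_eq_def)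
  show "- f + f = 0"
    by transfer (auto simp: l2_eq_def square_integrable_zero)
  show "f - g = f + - g"
    by transfer (auto simp: l2_eq_def square_integrable_diff)
  show "r *\<^sub>R (f + g) = r *\<^sub>R f + r *\<^sub>R g"
    by transfer (auto simp: l2_eq_def distrib_left
        intro!: square_integrable_add square_integrable_mult)
  show "(r + s) *\<^sub>R f = r *\<^sub>R f + s *\<^sub>R f"
    by transfer (auto simp: l2_eq_def distrib_right
        intro!: square_integrable_add square_integrable_mult)
  show "r *\<^sub>R s *\<^sub>R f = (r * s) *\<^sub>R f"
    by transfer (auto simp: l2_eq_def mult.assoc intro!: square_integrable_mult)
  show "1 *\<^sub>R f = f"
    by transfer (auto simp: l2_eq_def)
  show "dist f g = norm (f - g)"
    by (rule dist_l2_def)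
  show "sgn f = inverse (norm f) *\<^sub>R f"
    by (rule sgn_l2_def)
  show "uniformity = (INF e\<in>{0<..}. principal {(f :: l2, g). dist f g < e})"
    by (rule uniformity_l2_def)
  show "open U \<longleftrightarrow> (\<forall>f\<in>U. \<forall>\<^sub>F (f', g) in uniformity. f' = f \<longrightarrow> g \<in> U)" for U :: "l2 set"
    by (rule open_l2_def)
  show "inner f g = inner g f"
    by transfer (simp add: inner_commute)
  show "inner (f + g) h = inner f h + inner g h"
    by transfer (auto simp: l2_eq_def inner_add_left square_integrable_inner)
  show "inner (r *\<^sub>R f) g = r * inner f g"
  proof transfer
    fix r :: real and f g :: "real \<Rightarrow> complex"
    have "inner (complex_of_real r * f x) (g x) = r * inner (f x) (g x)" for x
      by (simp flip: scaleR_conv_of_real)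
    then show "(\<integral>x. inner (complex_of_real r * f x) (g x) \<partial>Rplus)
             = r * (\<integral>x. inner (f x) (g x) \<partial>Rplus)" by simp
  qed
  show "0 \<le> inner f f"
    by transfer simp
  show "inner f f = 0 \<longleftrightarrow> f = 0"
  proof transfer
    fix f :: "real \<Rightarrow> complex" assume f: "l2_eq f f"
    have "(\<integral>x. inner (f x) (f x) \<partial>Rplus) = 0 \<longleftrightarrow> (AE x in Rplus. inner (f x) (f x) = 0)"
      using f by (intro integral_nonneg_eq_0_iff_AE square_integrable_inner) (auto simp: l2_eq_def)
    then show "(\<integral>x. inner (f x) (f x) \<partial>Rplus) = 0 \<longleftrightarrow> l2_eq f (\<lambda>x. 0)"
      using f by (simp add: l2_eq_def square_integrable_zero)
  qed
  show "norm f = sqrt (inner f f)"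
    by transfer (simp add: power2_norm_eq_inner)
qed

end

lemma l2_rep_square_integrable: "square_integrable (rep_l2 f)"
  using Quotient_rep_reflp[OF Quotient_l2] by (auto simp: l2_eq_def)

lemma l2_norm_diff_sq:
  "(norm (f - g))\<^sup>2 = (\<integral>x. (cmod (rep_l2 f x - rep_l2 g x))\<^sup>2 \<partial>Rplus)"
proof -
  have f: "l2_eq (rep_l2 f) (rep_l2 f)" and g: "l2_eq (rep_l2 g) (rep_l2 g)"
    by (auto simp: l2_eq_def l2_rep_square_integrable)
  have "f - g = abs_l2 (\<lambda>x. rep_l2 f x - rep_l2 g x)"
    using minus_l2.abs_eq[OF f g] by (simp add: Quotient_abs_rep[OF Quotient_l2])
  then have "norm (f - g) = sqrt (\<integral>x. (cmod (rep_l2 f x - rep_l2 g x))\<^sup>2 \<partial>Rplus)"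
    by (simp add: norm_l2.abs_eq l2_eq_def square_integrable_diff l2_rep_square_integrable)
  then show ?thesis by simp
qed

instantiation l2 :: complex_banach
begin

lift_definition scaleC_l2 :: "complex \<Rightarrow> l2 \<Rightarrow> l2" is "\<lambda>c f x. c * f x"
  by (auto simp: l2_eq_def square_integrable_mult)

instance
proof
  fix f g :: l2 and c d :: complex and r :: real
  show "c *\<^sub>C (f + g) = c *\<^sub>C f + c *\<^sub>C g"
    by transfer (auto simp: l2_eq_def distrib_left
        intro!: square_integrable_add square_integrable_mult)
  show "(c + d) *\<^sub>C f = c *\<^sub>C f + d *\<^sub>C f"
    by transfer (auto simp: l2_eq_def distrib_right
        intro!: square_integrable_add square_integrable_mult)
  show "c *\<^sub>C d *\<^sub>C f = (c * d) *\<^sub>C f"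
    by transfer (auto simp: l2_eq_def mult.assoc intro!: square_integrable_mult)
  show "r *\<^sub>R f = complex_of_real r *\<^sub>C f"
    by transfer (auto simp: l2_eq_def square_integrable_mult)
  show "norm (c *\<^sub>C f) = cmod c * norm f"
    by transfer (simp add: norm_mult power_mult_distrib real_sqrt_mult)
next
  fix X :: "nat \<Rightarrow> l2" assume "Cauchy X"
  then have cau: "\<exists>N. \<forall>m\<ge>N. \<forall>n\<ge>N. norm (X m - X n) < e" if "e > 0" for e
    using that by (simp add: Cauchy_def dist_norm)
  have "\<exists>f. f \<in> borel_measurable Rplus \<and> integrable Rplus (\<lambda>x. (cmod (f x))\<^sup>2) \<and>
          (\<forall>e>0. \<exists>N. \<forall>n\<ge>N. (\<integral>x. (cmod (rep_l2 (X n) x - f x))\<^sup>2 \<partial>Rplus) \<le> e)"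
  proof (rule L2_complete)
    show "rep_l2 (X n) \<in> borel_measurable Rplus"
      "integrable Rplus (\<lambda>x. (cmod (rep_l2 (X n) x))\<^sup>2)" for n
      using l2_rep_square_integrable by (auto simp: square_integrable_def)
    show "\<exists>N. \<forall>m\<ge>N. \<forall>n\<ge>N. (\<integral>x. (cmod (rep_l2 (X m) x - rep_l2 (X n) x))\<^sup>2 \<partial>Rplus) < e"
      if "e > 0" for e
    proof -
      obtain N where N: "\<And>m n. m \<ge> N \<Longrightarrow> n \<ge> N \<Longrightarrow> norm (X m - X n) < sqrt e"
        using cau[of "sqrt e"] \<open>e > 0\<close> by (metis real_sqrt_gt_zero)
      have "(norm (X m - X n))\<^sup>2 < e" if "m \<ge> N" "n \<ge> N" for m n
        using power_strict_mono[OF N[OF that], of 2] \<open>e > 0\<close> by simp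
      then show ?thesis by (auto simp: l2_norm_diff_sq)
    qed
  qed
  then obtain u where u: "square_integrable u"
    and lim: "\<And>e. e > 0 \<Longrightarrow> \<exists>N. \<forall>n\<ge>N. (\<integral>x. (cmod (rep_l2 (X n) x - u x))\<^sup>2 \<partial>Rplus) \<le> e"
    by (auto simp: square_integrable_def)
  have uu: "l2_eq u u" and rr: "l2_eq (rep_l2 f) (rep_l2 f)" for f
    using u l2_rep_square_integrable by (auto simp: l2_eq_def)
  have eq: "(norm (f - abs_l2 u))\<^sup>2 = (\<integral>x. (cmod (rep_l2 f x - u x))\<^sup>2 \<partial>Rplus)" for f
  proof -
    have "f - abs_l2 u = abs_l2 (\<lambda>x. rep_l2 f x - u x)"
      using minus_l2.abs_eq[OF rr uu] by (simp add: Quotient_abs_rep[OF Quotient_l2])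
    then have "norm (f - abs_l2 u) = sqrt (\<integral>x. (cmod (rep_l2 f x - u x))\<^sup>2 \<partial>Rplus)"
      using u by (simp add: norm_l2.abs_eq l2_eq_def square_integrable_diff l2_rep_square_integrable)
    then show ?thesis by simp
  qed
  have "X \<longlonglongrightarrow> abs_l2 u"
  proof (rule LIMSEQ_I)
    fix e :: real assume e: "e > 0"
    then obtain N where N: "\<And>n. n \<ge> N \<Longrightarrow> (norm (X n - abs_l2 u))\<^sup>2 \<le> (e/2)\<^sup>2"
      using lim[of "(e/2)\<^sup>2"] by (auto simp: eq)
    have "norm (X n - abs_l2 u) < e" if "n \<ge> N" for n
      using power2_le_imp_le[OF N[OF that]] e by simp
    then show "\<exists>N. \<forall>n\<ge>N. norm (X n - abs_l2 u) < e" by blast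
  qed
  then show "convergent X" by (rule convergentI)
qed

end

section \<open>Distributions on \<open>\<real>\<^sub>+\<close>\<close>

definition smooth :: "(real \<Rightarrow> complex) \<Rightarrow> bool" where
  "smooth u \<longleftrightarrow> (\<forall>n x. ((\<lambda>v y. vector_derivative v (at y)) ^^ n) u differentiable (at x))"

text \<open>\<open>C\<^sub>c\<^sup>\<infinity>(\<real>\<^sub>+)\<close>, its elements being extended by zero to the whole line.\<close>

definition test_functions :: "(real \<Rightarrow> complex) set" where
  "test_functions = {\<phi>. smooth \<phi> \<and> (\<exists>K. compact K \<and> K \<subseteq> {0<..} \<and> (\<forall>x. x \<notin> K \<longrightarrow> \<phi> x = 0))}"

type_synonym distribution = "(real \<Rightarrow> complex) \<Rightarrow> complex"

definition distr_of :: "l2 \<Rightarrow> distribution" where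
  "distr_of f \<phi> = (\<integral>x. rep_l2 f x * \<phi> x \<partial>Rplus)"

text \<open>
  Distributions are only compared on test functions. Every \<open>f\<close> in \<open>L\<^sup>2(\<real>\<^sub>+)\<close> is locally integrable,
  so \<^term>\<open>distr_of f\<close> is a distribution on \<open>\<real>\<^sub>+\<close>; and since test functions vanish near \<open>0\<close>, the
  space of test functions is stable under multiplication by \<open>1/x\<^sup>2\<close>.
\<close>

definition distr_eq :: "distribution \<Rightarrow> distribution \<Rightarrow> bool" where
  "distr_eq S T \<longleftrightarrow> (\<forall>\<phi>\<in>test_functions. S \<phi> = T \<phi>)"

definition distr_deriv :: "distribution \<Rightarrow> distribution" where
  "distr_deriv T \<phi> = - T (\<lambda>x. vector_derivative \<phi> (at x))"

definition distr_mult :: "(real \<Rightarrow> complex) \<Rightarrow> distribution \<Rightarrow> distribution" where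
  "distr_mult a T \<phi> = T (\<lambda>x. a x * \<phi> x)"

section \<open>Bessel operators\<close>

definition bessel :: "complex \<Rightarrow> distribution \<Rightarrow> distribution" where
  "bessel \<alpha> T \<phi> =
     - distr_deriv (distr_deriv T) \<phi>
     + distr_mult (\<lambda>x. (\<alpha> - 1/4) * (1 / (complex_of_real x)\<^sup>2)) T \<phi>"

text \<open>
  Graph of \<open>L\<^sub>\<alpha>\<^sup>m\<^sup>a\<^sup>x\<close>: a pair \<open>(f, g)\<close> belongs to it iff the distribution \<open>L\<^sub>\<alpha> f\<close> is the \<open>L\<^sup>2\<close> function \<open>g\<close>.
\<close>

definition L_max :: "complex \<Rightarrow> (l2 \<times> l2) set" where
  "L_max \<alpha> = {(f, g). distr_eq (bessel \<alpha> (distr_of f)) (distr_of g)}"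

definition represents :: "(real \<Rightarrow> complex) \<Rightarrow> l2 \<Rightarrow> bool" where
  "represents u f \<longleftrightarrow> (AE x in Rplus. rep_l2 f x = u x)"

text \<open>The closure of an operator is the closure of its graph in the product space.\<close>

definition L_min :: "complex \<Rightarrow> (l2 \<times> l2) set" where
  "L_min \<alpha> = closure {(f, g) \<in> L_max \<alpha>. \<exists>\<phi>\<in>test_functions. represents \<phi> f}"

section \<open>Sobolev spaces\<close>

definition H2 :: "l2 set" where
  "H2 = {f. \<exists>g. distr_eq (distr_deriv (distr_deriv (distr_of f))) (distr_of g)}"

text \<open>
  The boundary values \<open>f(0)\<close> and \<open>f'(0)\<close> are those of the representative of \<open>f\<close> that is continuously
  differentiable on \<open>[0, \<infinity>)\<close>, which exists and is unique for \<open>f\<close> in \<^const>\<open>H2\<close>.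
\<close>

definition H2_0 :: "l2 set" where
  "H2_0 = {f \<in> H2. \<exists>u u'. represents u f \<and>
     (\<forall>x\<ge>0. (u has_vector_derivative u' x) (at x within {0..})) \<and>
     continuous_on {0..} u' \<and> u 0 = 0 \<and> u' 0 = 0}"

end

theory Submission
  imports Defs
begin

text \<open>
  Write \<open>\<alpha> = m\<^sup>2\<close> with \<open>|Re m| < 1\<close>. Multiplied by \<open>x\<^sup>2\<close>, the operator \<open>L\<^sub>\<alpha>\<close> factors into two first order Euler
  operators acting on \<open>x\<^sup>-\<^sup>2 \<phi>\<close>, and a Hardy inequality for each factor gives
  \<open>(1 - (Re m)\<^sup>2) \<parallel>x\<^sup>-\<^sup>2 \<phi>\<parallel> \<le> \<parallel>L\<^sub>\<alpha> \<phi>\<parallel>\<close> on test functions. Hence convergence in the graph norm of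
  \<open>L\<^sub>\<alpha>\<close> is convergence of \<open>(\<phi>, \<phi>'', x\<^sup>-\<^sup>2 \<phi>)\<close>, a condition that does not involve \<open>\<alpha>\<close>: all the operators
  \<open>L\<^sub>\<alpha>\<^sup>m\<^sup>i\<^sup>n\<close> share one domain, on which \<open>L\<^sub>\<alpha>\<^sup>m\<^sup>i\<^sup>n f = -f'' + (\<alpha> - 1/4) x\<^sup>-\<^sup>2 f\<close> is affine in \<open>\<alpha>\<close>.
  The domain is identified with \<open>H\<^sup>2\<^sub>0\<close> at \<open>\<alpha> = 1/4\<close>: the part of \<open>f\<close> orthogonal, in the graph norm, to the
  test functions satisfies \<open>v'' = w\<close>, \<open>w'' = -v\<close> with \<open>v(0) = v'(0) = 0\<close> and \<open>v, w \<in> L\<^sup>2\<close>, which forces \<open>v = 0\<close>.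
\<close>

section \<open>The pairing of \<open>L\<^sup>2\<close> functions\<close>

text \<open>The constant 1 - (Re m)^2 is the product of the Hardy constants 1 - Re m and 1 + Re m of
  the two Euler factors; it is positive exactly for |Re m| < 1, which is where the restriction on
  \<alpha> enters. The estimate controls x^-2 phi on its own, hence phi'' by difference, and this
  separation is what frees the closure from \<alpha>. The obstacle in identifying the domain is that
  an element of \<open>H2_0\<close> is not visibly a limit of test functions: cutting off near 0 and
  at infinity and mollifying would require estimates for every cutoff. Orthogonal projection trades
  this density statement for a uniqueness statement about an ODE system on the half-line, in which
  only v has prescribed values at 0 and decay is known only in the L2 sense. Regularity comes from
  one construction, the double antiderivative from 0: elements of \<open>H2_0\<close> and graph
  limits of test functions are both represented by the double antiderivative of f'', whose value and
  derivative at 0 vanish. Passing between weak and classical derivatives thus reduces to pairing L2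
  functions with explicit kernels.\<close>

lemma represents_measurable:
  assumes "represents u f"
  shows "u \<in> borel_measurable Rplus"
proof -
  have "rep_l2 f \<in> borel_measurable Rplus"
    using l2_rep_square_integrable square_integrable_def by blast
  \<comment> \<open>Extension by zero carries the question to the complete measure
    \<open>lebesgue\<close>, where a function equal almost everywhere to a measurable one is
    measurable.\<close>
  then have 1: "(\<lambda>x. if x \<in> {0<..} then rep_l2 f x else 0) \<in> borel_measurable lebesgue"
    by (rule borel_measurable_if_I) auto
  have 2: "AE x in lebesgue. (if x \<in> {0<..} then rep_l2 f x else 0) = (if x \<in> {0<..} then u x else 0)"
    using assms unfolding represents_def by (subst (asm) AE_restrict_space_iff) auto
  show ?thesis
    using borel_measurable_AE[OF 1 2] by (rule borel_measurable_if_D)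
qed

lemma represents_square_integrable:
  assumes "represents u f"
  shows "square_integrable u"
proof -
  have [measurable]: "u \<in> borel_measurable Rplus" "rep_l2 f \<in> borel_measurable Rplus"
    using represents_measurable[OF assms] l2_rep_square_integrable square_integrable_def by blast+
  have "integrable Rplus (\<lambda>x. (cmod (rep_l2 f x))\<^sup>2)"
    using l2_rep_square_integrable square_integrable_def by blast
  moreover have "AE x in Rplus. (cmod (rep_l2 f x))\<^sup>2 = (cmod (u x))\<^sup>2"
    using assms unfolding represents_def by auto
  ultimately have "integrable Rplus (\<lambda>x. (cmod (u x))\<^sup>2)"
    by (subst integrable_cong_AE[where g = "\<lambda>x. (cmod (rep_l2 f x))\<^sup>2"]) auto
  then show ?thesis by (simp add: square_integrable_def)
qed

lemma represents_rep: "represents (rep_l2 f) f"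
  by (simp add: represents_def)

lemma represents_abs:
  assumes "square_integrable u"
  shows "represents u (abs_l2 u)"
proof -
  have "l2_eq u u" using assms by (simp add: l2_eq_def)
  from Quotient_rep_abs[OF Quotient_l2, OF this] show ?thesis
    by (simp add: represents_def l2_eq_def)
qed

lemma represents_AE_iff:
  assumes "represents u f"
  shows "represents v f \<longleftrightarrow> (AE x in Rplus. u x = v x)"
  using assms unfolding represents_def by (auto elim: AE_mp)

lemma represents_unique:
  assumes "represents u f" "represents u g"
  shows "f = g"
proof -
  have "l2_eq (rep_l2 f) (rep_l2 g)"
    using assms unfolding l2_eq_def represents_def by (auto simp: l2_rep_square_integrable)
  then show ?thesis using Quotient_rel_rep[OF Quotient_l2] by blast
qed

lemma represents_iff_abs:
  "represents u f \<longleftrightarrow> square_integrable u \<and> f = abs_l2 u"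
  using represents_unique represents_abs represents_square_integrable by metis

lemma represents_add:
  assumes "represents u f" "represents v g"
  shows "represents (\<lambda>x. u x + v x) (f + g)"
proof -
  have *: "square_integrable u" "f = abs_l2 u" "square_integrable v" "g = abs_l2 v"
    using assms by (auto simp: represents_iff_abs)
  then have "f + g = abs_l2 (\<lambda>x. u x + v x)"
    by (simp add: plus_l2.abs_eq l2_eq_def)
  then show ?thesis using * by (simp add: represents_iff_abs square_integrable_add)
qed

lemma represents_scaleC:
  assumes "represents u f"
  shows "represents (\<lambda>x. c * u x) (c *\<^sub>C f)"
proof -
  have *: "square_integrable u" "f = abs_l2 u"
    using assms by (auto simp: represents_iff_abs)
  then have "c *\<^sub>C f = abs_l2 (\<lambda>x. c * u x)"
    by (simp add: scaleC_l2.abs_eq l2_eq_def)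
  then show ?thesis using * by (simp add: represents_iff_abs square_integrable_mult)
qed

section \<open>Complex scalar multiplication\<close>

lemma scaleC_minus_one: "(-1) *\<^sub>C x = - (x::'a::complex_banach)"
  using scaleR_scaleC[of "-1" x] by simp

lemma scaleC_one: "1 *\<^sub>C x = (x::'a::complex_banach)"
  using scaleR_scaleC[of "1" x] by simp

lemma scaleC_zero_left: "0 *\<^sub>C x = (0::'a::complex_banach)"
  using scaleR_scaleC[of "0" x] by simp

lemma scaleC_zero_right: "c *\<^sub>C 0 = (0::'a::complex_banach)"
  using scaleC_add_right[of c 0 "0::'a"] by simp

lemma scaleC_minus_right: "c *\<^sub>C (- x) = - (c *\<^sub>C (x::'a::complex_banach))"
  using scaleC_add_right[of c x "-x"] by (simp add: scaleC_zero_right add_eq_0_iff)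

lemma scaleC_minus_left: "(- c) *\<^sub>C x = - (c *\<^sub>C (x::'a::complex_banach))"
  using scaleC_add_left[of c "-c" x] by (simp add: scaleC_zero_left add_eq_0_iff)

lemma scaleC_diff_right: "c *\<^sub>C (x - y) = c *\<^sub>C x - c *\<^sub>C (y::'a::complex_banach)"
  using scaleC_add_right[of c x "-y"] by (simp add: scaleC_minus_right)

lemma scaleC_diff_left: "(c - d) *\<^sub>C x = c *\<^sub>C x - d *\<^sub>C (x::'a::complex_banach)"
  using scaleC_add_left[of c "-d" x] by (simp add: scaleC_minus_left)

lemma bounded_linear_scaleC: "bounded_linear (\<lambda>x::'a::complex_banach. c *\<^sub>C x)"
proof (rule bounded_linear_intro[where K = "cmod c"])
  show "c *\<^sub>C (r *\<^sub>R x) = r *\<^sub>R c *\<^sub>C (x::'a)" for r x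
    by (simp add: scaleR_scaleC scaleC_scaleC mult.commute)
qed (auto simp: scaleC_add_right norm_scaleC mult.commute)

lemma represents_uminus:
  assumes "represents u f"
  shows "represents (\<lambda>x. - u x) (- f)"
  using represents_scaleC[OF assms, of "-1"] by (simp add: scaleC_minus_one)

lemma represents_diff:
  assumes "represents u f" "represents v g"
  shows "represents (\<lambda>x. u x - v x) (f - g)"
  using represents_add[OF assms(1) represents_uminus[OF assms(2)]] by simp

lemma norm_represents_sq:
  assumes "represents u f"
  shows "(norm f)\<^sup>2 = (\<integral>x. (cmod (u x))\<^sup>2 \<partial>Rplus)"
  using assms by (simp add: represents_iff_abs norm_l2.abs_eq l2_eq_def)

lemma inner_represents:
  assumes "represents u f" "represents v g"
  shows "inner f g = (\<integral>x. inner (u x) (v x) \<partial>Rplus)"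
  using assms by (simp add: represents_iff_abs inner_l2.abs_eq l2_eq_def)

lemma square_integrable_product:
  assumes "square_integrable u" "square_integrable v"
  shows "integrable Rplus (\<lambda>x. u x * v x)"
proof -
  have [measurable]: "u \<in> borel_measurable Rplus" "v \<in> borel_measurable Rplus"
    using assms by (auto simp: square_integrable_def)
  have "integrable Rplus (\<lambda>x. (cmod (u x))\<^sup>2 + (cmod (v x))\<^sup>2)"
    using assms by (auto simp: square_integrable_def)
  then show ?thesis
  proof (rule Bochner_Integration.integrable_bound)
    have "cmod a * cmod b \<le> (cmod a)\<^sup>2 + (cmod b)\<^sup>2" for a b
      using sum_squares_bound[of "cmod a" "cmod b"] mult_nonneg_nonneg[of "cmod a" "cmod b"]
      by (simp del: mult_nonneg_nonneg)
    then show "AE x in Rplus. norm (u x * v x) \<le> norm ((cmod (u x))\<^sup>2 + (cmod (v x))\<^sup>2)"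
      by (auto simp: norm_mult)
  qed measurable
qed

lemma square_integrable_cnj:
  "square_integrable u \<Longrightarrow> square_integrable (\<lambda>x. cnj (u x))"
  unfolding square_integrable_def
  using measurable_compose[OF _ borel_measurable_continuous_onI[OF continuous_on_cnj[OF continuous_on_id]]]
  by auto

lemma distr_of_represents:
  assumes "represents u f" "square_integrable \<phi>"
  shows "distr_of f \<phi> = (\<integral>x. u x * \<phi> x \<partial>Rplus)"
proof -
  have [measurable]: "u \<in> borel_measurable Rplus" "\<phi> \<in> borel_measurable Rplus" "rep_l2 f \<in> borel_measurable Rplus"
    using represents_measurable[OF assms(1)] assms(2) l2_rep_square_integrable square_integrable_def by blast+
  show ?thesis unfolding distr_of_def
    using assms(1) unfolding represents_def by (intro integral_cong_AE) auto
qed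

lemma distr_of_mult: "distr_of f (\<lambda>x. c * \<phi> x) = c * distr_of f \<phi>"
proof -
  have "(\<lambda>x. rep_l2 f x * (c * \<phi> x)) = (\<lambda>x. c * (rep_l2 f x * \<phi> x))" by auto
  then show ?thesis unfolding distr_of_def by (metis integral_mult_right_zero)
qed

lemma distr_of_diff:
  assumes "square_integrable \<phi>" "square_integrable \<psi>"
  shows "distr_of f (\<lambda>x. \<phi> x - \<psi> x) = distr_of f \<phi> - distr_of f \<psi>"
  unfolding distr_of_def using assms
  by (simp add: right_diff_distrib Bochner_Integration.integral_diff square_integrable_product l2_rep_square_integrable)

text \<open>The space carries only a real inner product, Re (a cnj b) pointwise, while the pairing
  is complex bilinear. Conjugating the test function yields the real part, and the extra factor i
  the imaginary part; continuity of the pairing follows from this form.\<close>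

lemma distr_of_eq_inner:
  assumes "square_integrable \<phi>"
  shows "distr_of f \<phi> = complex_of_real (inner f (abs_l2 (\<lambda>x. cnj (\<phi> x))))
     + \<i> * complex_of_real (inner f (abs_l2 (\<lambda>x. \<i> * cnj (\<phi> x))))"
proof (rule complex_eqI)
  have s: "square_integrable (\<lambda>x. cnj (\<phi> x))" "square_integrable (\<lambda>x. \<i> * cnj (\<phi> x))"
    using assms by (auto intro: square_integrable_cnj square_integrable_mult)
  have i: "integrable Rplus (\<lambda>x. rep_l2 f x * \<phi> x)"
    by (intro square_integrable_product l2_rep_square_integrable assms)
  show "Re (distr_of f \<phi>) = Re (complex_of_real (inner f (abs_l2 (\<lambda>x. cnj (\<phi> x))))
     + \<i> * complex_of_real (inner f (abs_l2 (\<lambda>x. \<i> * cnj (\<phi> x)))))"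
    unfolding distr_of_def inner_represents[OF represents_rep represents_abs[OF s(1)]]
    using i by (simp add: inner_complex_def integral_Re[symmetric] cong: Bochner_Integration.integral_cong)
  show "Im (distr_of f \<phi>) = Im (complex_of_real (inner f (abs_l2 (\<lambda>x. cnj (\<phi> x))))
     + \<i> * complex_of_real (inner f (abs_l2 (\<lambda>x. \<i> * cnj (\<phi> x)))))"
    unfolding distr_of_def inner_represents[OF represents_rep represents_abs[OF s(2)]]
    using i by (simp add: inner_complex_def integral_Im[symmetric] algebra_simps cong: Bochner_Integration.integral_cong)
qed

lemma bounded_linear_distr_of:
  assumes "square_integrable \<phi>"
  shows "bounded_linear (\<lambda>f. distr_of f \<phi>)"
  unfolding distr_of_eq_inner[OF assms]
  by (intro bounded_linear_add bounded_linear_const_mult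
      bounded_linear_compose[OF bounded_linear_of_real] bounded_linear_inner_left)

lemma distr_of_scaleC:
  assumes "square_integrable \<phi>"
  shows "distr_of (c *\<^sub>C f) \<phi> = c * distr_of f \<phi>"
  using distr_of_represents[OF represents_scaleC[OF represents_rep] assms, of c f]
  by (simp add: distr_of_def mult.assoc)

text \<open>Cauchy-Schwarz is applied separately to the real and the imaginary part, whence the
  factor 2.\<close>

lemma norm_distr_of_le:
  assumes "square_integrable \<phi>"
  shows "cmod (distr_of f \<phi>) \<le> 2 * norm f * norm (abs_l2 \<phi>)"
proof -
  have s: "square_integrable (\<lambda>x. cnj (\<phi> x))" "square_integrable (\<lambda>x. \<i> * cnj (\<phi> x))"
    using assms by (auto intro: square_integrable_cnj square_integrable_mult)
  have n: "norm (abs_l2 (\<lambda>x. cnj (\<phi> x))) = norm (abs_l2 \<phi>)"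
     "norm (abs_l2 (\<lambda>x. \<i> * cnj (\<phi> x))) = norm (abs_l2 \<phi>)"
    using s assms by (simp_all add: norm_l2.abs_eq l2_eq_def norm_mult)
  have "cmod (distr_of f \<phi>) \<le> \<bar>inner f (abs_l2 (\<lambda>x. cnj (\<phi> x)))\<bar> + \<bar>inner f (abs_l2 (\<lambda>x. \<i> * cnj (\<phi> x)))\<bar>"
    unfolding distr_of_eq_inner[OF assms]
    by (rule order_trans[OF norm_triangle_ineq]) (simp add: norm_mult)
  also have "\<dots> \<le> norm f * norm (abs_l2 \<phi>) + norm f * norm (abs_l2 \<phi>)"
    using Cauchy_Schwarz_ineq2[of f "abs_l2 (\<lambda>x. cnj (\<phi> x))"]
      Cauchy_Schwarz_ineq2[of f "abs_l2 (\<lambda>x. \<i> * cnj (\<phi> x))"] n by simp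
  finally show ?thesis by simp
qed

text \<open>Converts the Lebesgue integral over \<open>Rplus\<close> into the gauge integral over a
  set carrying the function, for which the fundamental theorem of calculus is available.\<close>

lemma integrable_Rplus_support:
  fixes u :: "real \<Rightarrow> 'b::euclidean_space"
  assumes "u absolutely_integrable_on S" "S \<in> sets lebesgue" "S \<subseteq> {0<..}" "\<And>x. x > 0 \<Longrightarrow> x \<notin> S \<Longrightarrow> u x = 0"
  shows "integrable Rplus u" "integral\<^sup>L Rplus u = integral S u"
proof -
  have eq: "(\<lambda>x. indicator {0<..} x *\<^sub>R u x) = (\<lambda>x. indicator S x *\<^sub>R u x)"
    using assms(3,4) by (auto simp: indicator_def fun_eq_iff)
  show "integrable Rplus u"
    using assms(1) by (simp add: integrable_restrict_space set_integrable_def eq)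
  show "integral\<^sup>L Rplus u = integral S u"
    using set_lebesgue_integral_eq_integral(2)[OF assms(1)]
    by (simp add: integral_restrict_space set_lebesgue_integral_def eq)
qed

lemma measurable_Rplus_support:
  fixes u :: "real \<Rightarrow> 'b::euclidean_space"
  assumes "continuous_on {A..B} u" "\<And>x. x \<notin> {A..B} \<Longrightarrow> u x = 0" "A > 0"
  shows "u \<in> borel_measurable Rplus" "integrable Rplus u" "integral\<^sup>L Rplus u = integral {A..B} u"
proof -
  have "u absolutely_integrable_on {A..B}"
    using assms by (intro absolutely_integrable_continuous_real)
  moreover have "{A..B} \<subseteq> {0<..}" using assms(3) by auto
  ultimately show "integrable Rplus u" "integral\<^sup>L Rplus u = integral {A..B} u"
    using integrable_Rplus_support[of "{A..B}" u] assms(2) by auto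
  then show "u \<in> borel_measurable Rplus" by auto
qed

lemma square_integrable_support:
  assumes "continuous_on {A..B} u" "\<And>x. x \<notin> {A..B} \<Longrightarrow> u x = 0" "A > 0"
  shows "square_integrable u"
    "(\<integral>x. (cmod (u x))\<^sup>2 \<partial>Rplus) = integral {A..B} (\<lambda>x. (cmod (u x))\<^sup>2)"
proof -
  have c: "continuous_on {A..B} (\<lambda>x. (cmod (u x))\<^sup>2)"
    using assms(1) by (intro continuous_intros)
  note * = measurable_Rplus_support[OF c _ assms(3)]
  show "square_integrable u" unfolding square_integrable_def
    using measurable_Rplus_support(1)[OF assms] *(2) assms(2) by auto
  show "(\<integral>x. (cmod (u x))\<^sup>2 \<partial>Rplus) = integral {A..B} (\<lambda>x. (cmod (u x))\<^sup>2)"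
    using *(3) assms(2) by auto
qed

section \<open>Test functions\<close>

abbreviation vderiv :: "(real \<Rightarrow> complex) \<Rightarrow> real \<Rightarrow> complex" where
  "vderiv u \<equiv> \<lambda>x. vector_derivative u (at x)"

lemma smooth_has_vderiv:
  assumes "smooth u"
  shows "(u has_vector_derivative vderiv u x) (at x)"
proof -
  have "((\<lambda>v y. vector_derivative v (at y)) ^^ 0) u differentiable (at x)"
    using assms unfolding smooth_def by blast
  then show ?thesis using vector_derivative_works by auto
qed

lemma smooth_vderiv:
  assumes "smooth u"
  shows "smooth (vderiv u)"
  unfolding smooth_def
proof (intro allI)
  fix n x
  have "((\<lambda>v y. vector_derivative v (at y)) ^^ Suc n) u differentiable (at x)"
    using assms unfolding smooth_def by blast
  then show "((\<lambda>v y. vector_derivative v (at y)) ^^ n) (vderiv u) differentiable (at x)"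
    by (simp add: funpow_Suc_right del: funpow.simps)
qed

text \<open>A coinduction principle: a set of functions closed under differentiation consists of smooth ones.\<close>

lemma smoothI:
  assumes "u \<in> S"
    and step: "\<And>u. u \<in> S \<Longrightarrow> \<exists>u'\<in>S. \<forall>x. (u has_vector_derivative u' x) (at x)"
  shows "smooth u"
proof -
  have *: "((\<lambda>v y. vector_derivative v (at y)) ^^ n) u \<in> S" for n
  proof (induction n)
    case (Suc n)
    from step[OF this] obtain u' where u': "u' \<in> S"
      "\<forall>x. (((\<lambda>v y. vector_derivative v (at y)) ^^ n) u has_vector_derivative u' x) (at x)" by blast
    then have "vderiv (((\<lambda>v y. vector_derivative v (at y)) ^^ n) u) = u'"
      by (auto intro: vector_derivative_at)
    then show ?case using u' by simp
  qed (use assms in simp)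
  show ?thesis unfolding smooth_def
  proof (intro allI)
    fix n x
    show "((\<lambda>v y. vector_derivative v (at y)) ^^ n) u differentiable (at x)"
      using step[OF *[of n]] by (meson differentiableI_vector)
  qed
qed

lemma smooth_antiderivative:
  assumes "smooth v" "\<And>x. (u has_vector_derivative v x) (at x)"
  shows "smooth u"
proof (rule smoothI[where S = "insert u (Collect smooth)"])
  fix w assume "w \<in> insert u (Collect smooth)"
  then consider "w = u" | "smooth w" by blast
  then show "\<exists>u'\<in>insert u (Collect smooth). \<forall>x. (w has_vector_derivative u' x) (at x)"
  proof cases
    case 1
    then show ?thesis using assms by (intro bexI[of _ v]) auto
  next
    case 2
    then show ?thesis
      by (intro bexI[of _ "vderiv w"] allI smooth_has_vderiv) (auto intro: smooth_vderiv)
  qed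
qed simp

text \<open>Products alone are not stable under differentiation, but their finite sums are, by the
  Leibniz rule; this set is the invariant fed to \<open>smoothI\<close>.\<close>

inductive_set smooth_products :: "(real \<Rightarrow> complex) set" where
  mult: "smooth u \<Longrightarrow> smooth v \<Longrightarrow> (\<lambda>x. u x * v x) \<in> smooth_products"
| add: "u \<in> smooth_products \<Longrightarrow> v \<in> smooth_products \<Longrightarrow> (\<lambda>x. u x + v x) \<in> smooth_products"

lemma smooth_products_smooth:
  assumes "w \<in> smooth_products"
  shows "smooth w"
proof (rule smoothI[OF assms])
  fix w assume "w \<in> smooth_products"
  then show "\<exists>w'\<in>smooth_products. \<forall>x. (w has_vector_derivative w' x) (at x)"
  proof induction
    case (mult u v)
    have "((\<lambda>x. u x * v x) has_vector_derivative u x * vderiv v x + vderiv u x * v x) (at x)" for x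
      by (intro has_vector_derivative_mult smooth_has_vderiv mult)
    moreover have "(\<lambda>x. u x * vderiv v x + vderiv u x * v x) \<in> smooth_products"
      by (intro smooth_products.intros smooth_vderiv mult)
    ultimately show ?case by (intro bexI[of _ "\<lambda>x. u x * vderiv v x + vderiv u x * v x"]) auto
  next
    case (add u v)
    then obtain u' v' where "u' \<in> smooth_products" "v' \<in> smooth_products"
      "\<forall>x. (u has_vector_derivative u' x) (at x)" "\<forall>x. (v has_vector_derivative v' x) (at x)" by blast
    then show ?case
      by (intro bexI[of _ "\<lambda>x. u' x + v' x"] smooth_products.intros allI has_vector_derivative_add) auto
  qed
qed

lemma smooth_mult: "smooth u \<Longrightarrow> smooth v \<Longrightarrow> smooth (\<lambda>x. u x * v x)"
  by (rule smooth_products_smooth[OF smooth_products.mult])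

lemma smooth_const: "smooth (\<lambda>x. c)"
proof (rule smoothI[where S = "range (\<lambda>c x. c)"])
  fix u :: "real \<Rightarrow> complex" assume "u \<in> range (\<lambda>c x. c)"
  then have "(u has_vector_derivative 0) (at x)" for x by auto
  then show "\<exists>u'\<in>range (\<lambda>c x. c). \<forall>x. (u has_vector_derivative u' x) (at x)"
    by (intro bexI[of _ "\<lambda>x. 0"]) auto
qed simp

text \<open>Each summand enters \<open>smooth_products\<close> as its product with the constant
  1.\<close>

lemma smooth_add:
  assumes "smooth u" "smooth v"
  shows "smooth (\<lambda>x. u x + v x)"
  using smooth_products_smooth[OF smooth_products.add[OF smooth_products.mult[OF assms(1) smooth_const[of 1]]
      smooth_products.mult[OF assms(2) smooth_const[of 1]]]] by simp

lemma smooth_cmult: "smooth u \<Longrightarrow> smooth (\<lambda>x. c * u x)"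
  by (rule smooth_mult[OF smooth_const])

lemma smooth_affine:
  fixes k d :: real
  assumes "smooth u"
  shows "smooth (\<lambda>x. u (k * x + d))"
\<comment> \<open>The free factor \<open>c\<close> absorbs the powers of \<open>k\<close> produced
  by the chain rule.\<close>
proof (rule smoothI[where S = "{\<lambda>x. c * u (k * x + d) |c u. smooth u}"])
  show "(\<lambda>x. u (k * x + d)) \<in> {\<lambda>x. c * u (k * x + d) |c u. smooth u}"
    using assms by (auto intro!: exI[of _ "1::complex"] exI[of _ u])
  fix w assume "w \<in> {\<lambda>x. c * u (k * x + d) |c u. smooth u}"
  then obtain c u where w: "w = (\<lambda>x. c * u (k * x + d))" "smooth u" by blast
  have "(w has_vector_derivative (c * k) * vderiv u (k * x + d)) (at x)" for x
  proof -
    have "((\<lambda>x. k * x + d) has_vector_derivative k) (at x)"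
      by (auto intro!: derivative_eq_intros simp: has_real_derivative_iff_has_vector_derivative[symmetric])
    from vector_diff_chain_at[OF this smooth_has_vderiv[OF w(2)]]
    have "((\<lambda>x. u (k * x + d)) has_vector_derivative k *\<^sub>R vderiv u (k * x + d)) (at x)"
      by (simp add: o_def)
    from has_vector_derivative_mult_right[OF this, of c] show ?thesis
      unfolding w(1) by (simp add: scaleR_conv_of_real mult.assoc)
  qed
  then show "\<exists>w'\<in>{\<lambda>x. c * u (k * x + d) |c u. smooth u}. \<forall>x. (w has_vector_derivative w' x) (at x)"
    by (intro bexI[of _ "\<lambda>x. (c * k) * vderiv u (k * x + d)"] allI CollectI exI[of _ "c * k"] exI[of _ "vderiv u"] conjI refl smooth_vderiv w)
qed

lemma smooth_cnj:
  assumes "smooth u"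
  shows "smooth (\<lambda>x. cnj (u x))"
proof (rule smoothI[where S = "{\<lambda>x. cnj (u x) |u. smooth u}"])
  fix w assume "w \<in> {\<lambda>x. cnj (u x) |u. smooth u}"
  then obtain u where w: "w = (\<lambda>x. cnj (u x))" "smooth u" by blast
  have "(w has_vector_derivative cnj (vderiv u x)) (at x)" for x
    unfolding w(1) by (rule has_vector_derivative_cnj[OF smooth_has_vderiv[OF w(2)]])
  then show "\<exists>w'\<in>{\<lambda>x. cnj (u x) |u. smooth u}. \<forall>x. (w has_vector_derivative w' x) (at x)"
    by (intro bexI[of _ "\<lambda>x. cnj (vderiv u x)"] allI CollectI exI[of _ "vderiv u"] conjI refl smooth_vderiv w)
qed (use assms in blast)

section \<open>Flat functions and bumps\<close>

definition flat_step :: "real \<Rightarrow> real" where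
  "flat_step x = (if x > 0 then exp (- 1 / x) else 0)"

lemma flat_step_bounds: "0 \<le> flat_step x" "flat_step x \<le> 1"
  by (auto simp: flat_step_def divide_nonpos_pos)

text \<open>All derivatives of \<open>flat_step\<close> are of this form.\<close>

definition flat_poly :: "real poly \<Rightarrow> real \<Rightarrow> complex" where
  "flat_poly p x = (if x > 0 then complex_of_real (poly p (1 / x) * exp (- 1 / x)) else 0)"

lemma tendsto_poly_exp_neg: "((\<lambda>y. poly p y * exp (- y)) \<longlongrightarrow> 0) (at_top :: real filter)"
proof -
  have "((\<lambda>y. \<Sum>i\<le>degree p. coeff p i * (y ^ i / exp y)) \<longlongrightarrow> (\<Sum>i\<le>degree p. coeff p i * 0)) (at_top :: real filter)"
    by (intro tendsto_sum tendsto_mult tendsto_const tendsto_power_div_exp_0)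
  then show ?thesis by (simp add: poly_altdef sum_distrib_right exp_minus divide_inverse mult.assoc)
qed

text \<open>With y = 1/x the derivative in x is -y^2 times the derivative in y, and it sends p(y)
  exp(-y) to y^2 (p - p')(y) exp(-y). At 0 the decay of the exponential makes the difference
  quotient tend to 0.\<close>

lemma flat_poly_deriv:
  "(flat_poly p has_vector_derivative flat_poly ([:0, 0, 1:] * (p - pderiv p)) x) (at x)"
proof -
  consider "x > 0" | "x < 0" | "x = 0" by linarith
  then show ?thesis
  proof cases
    case 1
    have "((\<lambda>x. poly p (1 / x) * exp (- 1 / x)) has_real_derivative
       poly (pderiv p) (1 / x) * (- 1 / x\<^sup>2) * exp (- 1 / x) + poly p (1/x) * (exp (- 1 / x) * (1 / x\<^sup>2))) (at x)"
      using 1 by (auto intro!: derivative_eq_intros DERIV_chain2[OF poly_DERIV] simp: field_simps power2_eq_square)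
    also have "poly (pderiv p) (1 / x) * (- 1 / x\<^sup>2) * exp (- 1 / x) + poly p (1/x) * (exp (- 1 / x) * (1 / x\<^sup>2))
       = poly ([:0, 0, 1:] * (p - pderiv p)) (1 / x) * exp (- 1 / x)"
      using 1 by (simp add: field_simps power2_eq_square)
    finally have "((\<lambda>x. complex_of_real (poly p (1 / x) * exp (- 1 / x))) has_vector_derivative
       complex_of_real (poly ([:0, 0, 1:] * (p - pderiv p)) (1 / x) * exp (- 1 / x))) (at x)"
      by (rule has_vector_derivative_of_real)
    then show ?thesis
      by (rule has_vector_derivative_transform_within_open[where S = "{0<..}", THEN has_vector_derivative_eq_rhs])
         (use 1 in \<open>auto simp: flat_poly_def\<close>)
  next
    case 2
    have "((\<lambda>x. 0) has_vector_derivative (0::complex)) (at x)" by simp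
    then show ?thesis
      by (rule has_vector_derivative_transform_within_open[where S = "{..<0}", THEN has_vector_derivative_eq_rhs])
         (use 2 in \<open>auto simp: flat_poly_def\<close>)
  next
    case 3
    \<comment> \<open>Dividing by x multiplies by y = 1/x, that is, replaces \<open>p\<close> by
      \<open>pCons 0 p\<close>.\<close>
    have lim: "((\<lambda>y. poly (pCons 0 p) (1 / y) * exp (- 1 / y)) \<longlongrightarrow> 0) (at_right (0::real))"
      using filterlim_compose[OF tendsto_poly_exp_neg filterlim_inverse_at_top_right, of "pCons 0 p"]
      by (simp add: inverse_eq_divide)
    have "((\<lambda>y. flat_poly p y / of_real y) \<longlongrightarrow> 0) (at 0)"
    proof (subst at_eq_sup_left_right, rule filterlim_sup)
      show "((\<lambda>y. flat_poly p y / of_real y) \<longlongrightarrow> 0) (at_left 0)"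
        by (rule tendsto_eventually) (auto simp: eventually_at_left_field flat_poly_def intro!: exI[of _ "-1"])
      have "((\<lambda>y. complex_of_real (poly (pCons 0 p) (1 / y) * exp (- 1 / y))) \<longlongrightarrow> of_real 0) (at_right (0::real))"
        by (intro tendsto_of_real lim)
      moreover have "\<forall>\<^sub>F y in at_right 0. complex_of_real (poly (pCons 0 p) (1 / y) * exp (- 1 / y)) = flat_poly p y / of_real y"
        by (auto simp: eventually_at_right_field flat_poly_def intro!: exI[of _ 1])
      ultimately show "((\<lambda>y. flat_poly p y / of_real y) \<longlongrightarrow> 0) (at_right 0)"
        by (subst (asm) tendsto_cong) (auto)
    qed
    then have "(flat_poly p has_vector_derivative 0) (at 0)"
      unfolding has_vector_derivative_def has_derivative_iff_norm
      using tendsto_norm_zero by (fastforce simp: flat_poly_def norm_divide)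
    then show ?thesis using 3 by (simp add: flat_poly_def)
  qed
qed

lemma smooth_flat_step: "smooth (\<lambda>x. complex_of_real (flat_step x))"
proof (rule smoothI[where S = "range flat_poly"])
  have "(\<lambda>x. complex_of_real (flat_step x)) = flat_poly 1"
    by (auto simp: flat_step_def flat_poly_def)
  then show "(\<lambda>x. complex_of_real (flat_step x)) \<in> range flat_poly" by blast
qed (use flat_poly_deriv in blast)

text \<open>Since \<open>flat_step\<close> tends to 1 at infinity, stretching by \<open>n\<close>
  makes the bumps converge pointwise to the indicator of the open interval while staying bounded by
  1, as dominated convergence requires.\<close>

definition bump :: "real \<Rightarrow> real \<Rightarrow> nat \<Rightarrow> real \<Rightarrow> complex" where
  "bump a b n x = complex_of_real (flat_step (real n * (x - a)) * flat_step (real n * (b - x)))"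

lemma bump_test:
  assumes "0 < a"
  shows "bump a b n \<in> test_functions"
proof -
  have "smooth (\<lambda>x. complex_of_real (flat_step (real n * x + (- real n * a))) * complex_of_real (flat_step ((- real n) * x + real n * b)))"
    by (rule smooth_mult[OF smooth_affine[OF smooth_flat_step] smooth_affine[OF smooth_flat_step]])
  also have "(\<lambda>x. complex_of_real (flat_step (real n * x + (- real n * a))) * complex_of_real (flat_step ((- real n) * x + real n * b))) = bump a b n"
    by (auto simp: bump_def algebra_simps)
  finally have "smooth (bump a b n)" .
  moreover have "bump a b n x = 0" if "x \<notin> {a..b}" for x
    using that by (auto simp: bump_def flat_step_def zero_less_mult_iff)
  ultimately show ?thesis
    unfolding test_functions_def using assms by (auto intro!: exI[of _ "{a..b}"])
qed

lemma bump_le_1: "cmod (bump a b n x) \<le> 1"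
  using flat_step_bounds by (simp add: bump_def norm_mult mult_le_one)

lemma bump_outside: "x \<notin> {a<..<b} \<Longrightarrow> bump a b n x = 0"
  by (auto simp: bump_def flat_step_def zero_less_mult_iff)

lemma bump_tendsto: "(\<lambda>n. bump a b n x) \<longlonglongrightarrow> indicator {a<..<b} x"
proof (cases "x \<in> {a<..<b}")
  case True
  have *: "(\<lambda>n. flat_step (real n * y)) \<longlonglongrightarrow> 1" if "y > 0" for y
  proof -
    have "(\<lambda>n. exp (- (inverse (real n) / y))) \<longlonglongrightarrow> exp (- (0 / y))"
      using that by (intro tendsto_intros lim_inverse_n) auto
    moreover have "\<forall>\<^sub>F n in sequentially. exp (- (inverse (real n) / y)) = flat_step (real n * y)"
      using that by (intro eventually_sequentiallyI[of 1]) (auto simp: flat_step_def field_simps)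
    ultimately show ?thesis by (simp add: tendsto_cong)
  qed
  have "(\<lambda>n. bump a b n x) \<longlonglongrightarrow> complex_of_real (1 * 1)"
    unfolding bump_def using True by (intro tendsto_intros *) auto
  then show ?thesis using True by simp
next
  case False
  then show ?thesis by (simp add: bump_outside)
qed

text \<open>The hull of the support is enlarged slightly, still away from 0, so that the function
  vanishes at both endpoints too; this removes boundary terms when integrating by parts.\<close>

lemma test_functions_support:
  assumes "\<phi> \<in> test_functions"
  obtains A B where "0 < A" "A < B" "\<And>x. x \<notin> {A<..<B} \<Longrightarrow> \<phi> x = 0"
proof -
  obtain K where K: "compact K" "K \<subseteq> {0<..}" "\<And>x. x \<notin> K \<Longrightarrow> \<phi> x = 0"
    using assms by (auto simp: test_functions_def)
  show thesis
  proof (cases "K = {}")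
    case True
    then show thesis using that[of 1 2] K by auto
  next
    case False
    obtain m where m: "m \<in> K" "\<And>x. x \<in> K \<Longrightarrow> m \<le> x"
      using compact_attains_inf[OF K(1) False] by blast
    obtain M where M: "M \<in> K" "\<And>x. x \<in> K \<Longrightarrow> x \<le> M"
      using compact_attains_sup[OF K(1) False] by blast
    have "m > 0" using m K by auto
    have "m \<le> M" using m M by auto
    show thesis
    proof (rule that[of "m / 2" "M + 1"])
      show "\<phi> x = 0" if "x \<notin> {m/2<..<M+1}" for x using K(3) m(2)[of x] M(2)[of x] \<open>m > 0\<close> that by force
    qed (use \<open>m > 0\<close> \<open>m \<le> M\<close> in auto)
  qed
qed

lemma test_functionsI:
  assumes "smooth \<phi>" "0 < A" "\<And>x. x \<notin> {A..B} \<Longrightarrow> \<phi> x = 0"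
  shows "\<phi> \<in> test_functions"
  using assms unfolding test_functions_def by (auto intro!: exI[of _ "{A..B}"])

lemma test_functions_smooth: "\<phi> \<in> test_functions \<Longrightarrow> smooth \<phi>"
  by (simp add: test_functions_def)

lemma vderiv_eq_0:
  assumes "open S" "x \<in> S" "\<And>y. y \<in> S \<Longrightarrow> u y = 0"
  shows "vderiv u x = 0"
proof (rule vector_derivative_at)
  have "((\<lambda>x. 0) has_vector_derivative (0::complex)) (at x)" by simp
  then show "(u has_vector_derivative 0) (at x)"
    by (rule has_vector_derivative_transform_within_open[where S = S]) (use assms in auto)
qed

lemma test_vderiv:
  assumes "\<phi> \<in> test_functions"
  shows "vderiv \<phi> \<in> test_functions"
proof -
  obtain A B where AB: "0 < A" "A < B" "\<And>x. x \<notin> {A<..<B} \<Longrightarrow> \<phi> x = 0"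
    by (rule test_functions_support[OF assms]) (rule that)
  show ?thesis
  proof (rule test_functionsI[OF smooth_vderiv[OF test_functions_smooth[OF assms]] AB(1)])
    fix x assume "x \<notin> {A..B}"
    then show "vderiv \<phi> x = 0"
      by (intro vderiv_eq_0[where S = "- {A..B}"]) (use AB in auto)
  qed
qed

lemma test_add:
  assumes "\<phi> \<in> test_functions" "\<psi> \<in> test_functions"
  shows "(\<lambda>x. \<phi> x + \<psi> x) \<in> test_functions"
proof -
  obtain A B where AB: "0 < A" "A < B" "\<And>x. x \<notin> {A<..<B} \<Longrightarrow> \<phi> x = 0"
    by (rule test_functions_support[OF assms(1)]) (rule that)
  obtain A' B' where AB': "0 < A'" "A' < B'" "\<And>x. x \<notin> {A'<..<B'} \<Longrightarrow> \<psi> x = 0"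
    by (rule test_functions_support[OF assms(2)]) (rule that)
  show ?thesis
  proof (rule test_functionsI[where A = "min A A'" and B = "max B B'"])
    show "smooth (\<lambda>x. \<phi> x + \<psi> x)" using assms by (intro smooth_add test_functions_smooth)
    fix x assume "x \<notin> {min A A'..max B B'}"
    then have "x \<notin> {A<..<B}" "x \<notin> {A'<..<B'}" by auto
    then show "\<phi> x + \<psi> x = 0" using AB AB' by simp
  qed (use AB AB' in auto)
qed

lemma test_cmult:
  assumes "\<phi> \<in> test_functions"
  shows "(\<lambda>x. c * \<phi> x) \<in> test_functions"
  using assms unfolding test_functions_def by (force intro: smooth_cmult)

lemma test_cnj:
  assumes "\<phi> \<in> test_functions"
  shows "(\<lambda>x. cnj (\<phi> x)) \<in> test_functions"
  using assms unfolding test_functions_def by (force intro: smooth_cnj)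

lemma test_has_vderiv:
  "\<phi> \<in> test_functions \<Longrightarrow> (\<phi> has_vector_derivative vderiv \<phi> x) (at x)"
  by (simp add: smooth_has_vderiv test_functions_smooth)

lemma test_continuous: "\<phi> \<in> test_functions \<Longrightarrow> continuous_on S \<phi>"
  by (intro continuous_at_imp_continuous_on ballI has_vector_derivative_continuous[OF test_has_vderiv])

section \<open>Density and the du Bois-Reymond lemma\<close>

text \<open>A minimizing sequence for the distance is Cauchy by the parallelogram law, and
  minimality of its limit in every direction of \<open>S\<close> is orthogonality.\<close>

lemma closed_subspace_projection:
  fixes S :: "'a::{real_inner, complete_space} set"
  assumes S: "subspace S" "closed S"
  shows "\<exists>p\<in>S. \<forall>s\<in>S. inner (x - p) s = 0"
proof -
  define d where "d = (INF s\<in>S. (norm (x - s))\<^sup>2)"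
  have S0: "0 \<in> S" using S(1) by (simp add: subspace_0)
  have bdd: "bdd_below ((\<lambda>s. (norm (x - s))\<^sup>2) ` S)" by (rule bdd_belowI[of _ 0]) auto
  have dle: "d \<le> (norm (x - s))\<^sup>2" if "s \<in> S" for s
    unfolding d_def by (rule cINF_lower[OF bdd that])
  have "\<exists>s\<in>S. (norm (x - s))\<^sup>2 < d + inverse (real (Suc n))" for n
    using cINF_less_iff[OF _ bdd, of "d + inverse (real (Suc n))"] S0 unfolding d_def by auto
  then obtain s where s: "\<And>n. s n \<in> S" "\<And>n. (norm (x - s n))\<^sup>2 < d + inverse (real (Suc n))"
    by metis
  have par: "(norm (s m - s n))\<^sup>2 \<le> 2 * inverse (real (Suc m)) + 2 * inverse (real (Suc n))" for m n
  proof -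
    have "(1/2) *\<^sub>R (s m + s n) \<in> S" using S(1) s(1) by (intro subspace_scale subspace_add)
    from dle[OF this] have "4 * d \<le> (norm (2 *\<^sub>R (x - (1/2) *\<^sub>R (s m + s n))))\<^sup>2"
      by (simp add: power_mult_distrib)
    also have "2 *\<^sub>R (x - (1/2) *\<^sub>R (s m + s n)) = (x - s m) + (x - s n)"
      by (simp add: scaleR_2 algebra_simps)
    also have "(norm ((x - s m) + (x - s n)))\<^sup>2 = 2 * (norm (x - s m))\<^sup>2 + 2 * (norm (x - s n))\<^sup>2 - (norm (s m - s n))\<^sup>2"
      by (simp add: power2_norm_eq_inner inner_commute inner_diff_left inner_diff_right inner_add_left inner_add_right)
    finally show ?thesis using s(2)[of m] s(2)[of n] by linarith
  qed
  have "Cauchy s"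
  proof (rule CauchyI)
    fix e :: real assume e: "e > 0"
    obtain N where N: "inverse (real (Suc N)) < e\<^sup>2 / 4"
      using reals_Archimedean[of "e\<^sup>2/4"] e by auto
    have "norm (s m - s n) < e" if "m \<ge> N" "n \<ge> N" for m n
    proof -
      have "inverse (real (Suc m)) \<le> inverse (real (Suc N))" "inverse (real (Suc n)) \<le> inverse (real (Suc N))"
        using that by (auto intro!: le_imp_inverse_le)
      then have "(norm (s m - s n))\<^sup>2 < e\<^sup>2" using par[of m n] N by linarith
      then show ?thesis using e by (simp add: power2_less_imp_less)
    qed
    then show "\<exists>M. \<forall>m\<ge>M. \<forall>n\<ge>M. norm (s m - s n) < e" by blast
  qed
  then obtain p where p: "s \<longlonglongrightarrow> p" using Cauchy_convergent_iff convergent_def by blast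
  have pS: "p \<in> S" using closed_sequentially[OF S(2)] s(1) p by blast
  have "(\<lambda>n. (norm (x - s n))\<^sup>2) \<longlonglongrightarrow> (norm (x - p))\<^sup>2" using p by (intro tendsto_intros)
  moreover have "(\<lambda>n. d + inverse (real (Suc n))) \<longlonglongrightarrow> d + 0"
    by (intro tendsto_intros LIMSEQ_inverse_real_of_nat)
  ultimately have "(norm (x - p))\<^sup>2 \<le> d + 0"
    by (rule LIMSEQ_le) (use s(2) less_imp_le in blast)
  then have min: "(norm (x - p))\<^sup>2 \<le> (norm (x - q))\<^sup>2" if "q \<in> S" for q using dle[OF that] by linarith
  have "inner (x - p) q = 0" if q: "q \<in> S" for q
  proof (cases "q = 0")
    case False
    \<comment> \<open>The step minimizing the distance along the direction \<open>q\<close>; it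
      would beat the minimum unless the inner product vanishes.\<close>
    define t where "t = inner (x - p) q / inner q q"
    have "p + t *\<^sub>R q \<in> S" using pS q S(1) by (intro subspace_add subspace_scale)
    from min[OF this] have "inner (x - p) (x - p) \<le> inner ((x - p) - t *\<^sub>R q) ((x - p) - t *\<^sub>R q)"
      by (simp add: power2_norm_eq_inner diff_diff_eq)
    also have "\<dots> = inner (x - p) (x - p) - 2 * t * inner (x - p) q + t * t * inner q q"
      by (simp add: inner_diff_left inner_diff_right inner_commute algebra_simps)
    also have "t * inner q q = inner (x - p) q" using False by (simp add: t_def)
    then have "t * t * inner q q = t * inner (x - p) q" by simp
    finally have "t * inner (x - p) q \<le> 0" by simp
    then have "(inner (x - p) q)\<^sup>2 / inner q q \<le> 0" by (simp add: t_def power2_eq_square)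
    moreover have "inner q q > 0" using False by simp
    ultimately have "(inner (x - p) q)\<^sup>2 \<le> 0" by (simp add: divide_le_0_iff)
    then show ?thesis by simp
  qed simp
  then show ?thesis using pS by blast
qed

text \<open>Local on the open half-line: nothing is required near 0, where test functions
  vanish.\<close>

definition locally_integrable :: "(real \<Rightarrow> complex) \<Rightarrow> bool" where
  "locally_integrable u \<longleftrightarrow> (\<forall>a b. 0 < a \<longrightarrow> u absolutely_integrable_on {a..b})"

lemma locally_integrable_continuous: "continuous_on {0<..} u \<Longrightarrow> locally_integrable u"
  unfolding locally_integrable_def
  by (auto intro!: absolutely_integrable_continuous_real elim!: continuous_on_subset)

lemma locally_integrable_add:
  "locally_integrable u \<Longrightarrow> locally_integrable v \<Longrightarrow> locally_integrable (\<lambda>x. u x + v x)"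
  unfolding locally_integrable_def by (auto intro!: set_integral_add(1))

lemma locally_integrable_diff:
  "locally_integrable u \<Longrightarrow> locally_integrable v \<Longrightarrow> locally_integrable (\<lambda>x. u x - v x)"
  unfolding locally_integrable_def by (auto intro!: set_integral_diff(1))

lemma indicator_complex_square_integrable:
  "square_integrable (\<lambda>x. indicator {a..b} x :: complex)"
proof -
  have "emeasure Rplus ({a..b} \<inter> {0<..}) \<le> emeasure lebesgue {a..b}"
    by (simp add: emeasure_restrict_space) (rule emeasure_mono, auto)
  also have "\<dots> < \<infinity>" by (simp add: emeasure_lborel_Icc_eq)
  finally have "integrable Rplus (\<lambda>x. indicator ({a..b} \<inter> {0<..}) x :: real)"
    by (intro integrable_real_indicator) (auto simp: sets_restrict_space_iff)
  then have "integrable Rplus (\<lambda>x. indicator {a..b} x :: real)"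
    by (rule Bochner_Integration.integrable_cong[THEN iffD1, rotated 2]) (auto simp: indicator_def)
  moreover have "(\<lambda>x. (cmod (indicator {a..b} x))\<^sup>2) = (\<lambda>x. indicator {a..b} x :: real)"
    by (auto simp: indicator_def)
  moreover have "(indicator {a..b} :: real \<Rightarrow> complex) \<in> borel_measurable Rplus"
    by (intro measurable_restrict_space1 borel_measurable_indicator) auto
  ultimately show ?thesis by (simp add: square_integrable_def)
qed

lemma locally_integrable_square_integrable:
  assumes "square_integrable u"
  shows "locally_integrable u"
  unfolding locally_integrable_def
proof (intro allI impI)
  fix a b :: real assume a: "0 < a"
  have "integrable Rplus (\<lambda>x. indicator {a..b} x * u x)"
    by (rule square_integrable_product[OF indicator_complex_square_integrable assms])
  moreover have "(\<lambda>x. indicator {0<..} x *\<^sub>R (indicator {a..b} x * u x)) = (\<lambda>x. indicator {a..b} x *\<^sub>R u x)"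
    using a by (auto simp: indicator_def fun_eq_iff)
  ultimately show "u absolutely_integrable_on {a..b}"
    by (simp add: integrable_restrict_space set_integrable_def)
qed

lemma test_integrable:
  assumes "locally_integrable u" "\<phi> \<in> test_functions"
  shows "integrable Rplus (\<lambda>x. u x * \<phi> x)"
proof -
  obtain A B where AB: "0 < A" "A < B" "\<And>x. x \<notin> {A<..<B} \<Longrightarrow> \<phi> x = 0"
    by (rule test_functions_support[OF assms(2)]) (rule that)
  have c: "continuous_on {A..B} \<phi>" by (rule test_continuous[OF assms(2)])
  have "(\<lambda>x. \<phi> x * u x) absolutely_integrable_on {A..B}"
  proof (rule absolutely_integrable_bounded_measurable_product[where h = "(*)"])
    show "bounded (\<phi> ` {A..B})"
      using compact_continuous_image[OF c] compact_imp_bounded by blast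
    show "\<phi> \<in> borel_measurable (lebesgue_on {A..B})"
      using c by (intro continuous_imp_measurable_on_sets_lebesgue) auto
    show "u absolutely_integrable_on {A..B}"
      using assms(1) AB(1) by (auto simp: locally_integrable_def)
    show "bilinear ((*) :: complex \<Rightarrow> complex \<Rightarrow> complex)"
      using bilinear_conv_bounded_bilinear bounded_bilinear_mult by blast
  qed auto
  then have "(\<lambda>x. u x * \<phi> x) absolutely_integrable_on {A..B}" by (simp add: mult.commute)
  then show ?thesis
  proof (rule integrable_Rplus_support(1))
    show "u x * \<phi> x = 0" if "x \<notin> {A..B}" for x using that AB(3)[of x] by auto
  qed (use AB in auto)
qed

lemma test_square_integrable_mult:
  assumes "continuous_on {0<..} u" "\<phi> \<in> test_functions"
  shows "square_integrable (\<lambda>x. u x * \<phi> x)"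
proof -
  obtain A B where AB: "0 < A" "A < B" "\<And>x. x \<notin> {A<..<B} \<Longrightarrow> \<phi> x = 0"
    by (rule test_functions_support[OF assms(2)]) (rule that)
  show ?thesis
  proof (rule square_integrable_support(1)[where A = A and B = B])
    show "continuous_on {A..B} (\<lambda>x. u x * \<phi> x)"
      using AB assms by (intro continuous_intros test_continuous continuous_on_subset[OF assms(1)]) auto
  qed (use AB in auto)
qed

lemma test_square_integrable: "\<phi> \<in> test_functions \<Longrightarrow> square_integrable \<phi>"
  using test_square_integrable_mult[of "\<lambda>x. 1" \<phi>] by simp

text \<open>Bumps converge to indicators, so the integrals of \<open>u\<close> over all compact
  intervals vanish; Lebesgue differentiation then gives \<open>u = 0\<close> almost everywhere to
  the right of each \<open>c > 0\<close>.\<close>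

lemma locally_integrable_eq_0:
  assumes u: "locally_integrable u"
    and 0: "\<And>\<phi>. \<phi> \<in> test_functions \<Longrightarrow> (\<integral>x. u x * \<phi> x \<partial>Rplus) = 0"
  shows "AE x in Rplus. u x = 0"
proof -
  have int0: "integral {a..b} u = 0" if ab: "0 < a" for a b
  proof -
    have ai: "u absolutely_integrable_on {a<..<b}"
      by (rule set_integrable_subset[of _ "{a..b}"]) (use u ab in \<open>auto simp: locally_integrable_def\<close>)
    define w where "w x = indicator {a<..<b} x *\<^sub>R u x" for x
    have wi: "w absolutely_integrable_on {a<..<b}"
      using ai unfolding w_def set_integrable_def by (simp add: indicator_inter_arith[symmetric])
    have w: "integrable Rplus w" "integral\<^sup>L Rplus w = integral {a<..<b} w"
      using integrable_Rplus_support[OF wi] ab by (auto simp: w_def subset_iff)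
    have "(\<lambda>n. \<integral>x. u x * bump a b n x \<partial>Rplus) \<longlonglongrightarrow> integral\<^sup>L Rplus w"
    proof (rule integral_dominated_convergence[where w = "\<lambda>x. cmod (w x)"])
      show "(\<lambda>x. u x * bump a b n x) \<in> borel_measurable Rplus" for n
        using test_integrable[OF u bump_test[OF ab]] by auto
      show "w \<in> borel_measurable Rplus" using w(1) by auto
      show "integrable Rplus (\<lambda>x. cmod (w x))" using w(1) by auto
      show "AE x in Rplus. cmod (u x * bump a b n x) \<le> cmod (w x)" for n
        by (rule AE_I2) (auto simp: w_def indicator_def bump_outside norm_mult intro!: mult_left_le bump_le_1)
      have "(\<lambda>n. u x * bump a b n x) \<longlonglongrightarrow> u x * indicator {a<..<b} x" for x
        by (intro tendsto_intros bump_tendsto)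
      moreover have "u x * indicator {a<..<b} x = w x" for x by (auto simp: w_def indicator_def)
      ultimately show "AE x in Rplus. (\<lambda>n. u x * bump a b n x) \<longlonglongrightarrow> w x" by auto
    qed
    then have "integral {a<..<b} w = 0"
      using 0[OF bump_test[OF ab]] w(2) by (simp add: LIMSEQ_const_iff)
    moreover have "integral {a<..<b} w = integral {a<..<b} u"
      by (rule integral_cong) (auto simp: w_def)
    moreover have "integral {a<..<b} u = integral {a..b} u"
      by (simp add: integral_open_interval_real)
    ultimately show ?thesis by simp
  qed
  have "AE x in Rplus. c < x \<longrightarrow> u x = 0" if c: "c > 0" for c
  proof -
    \<comment> \<open>The differentiation theorem asks for integrability on every bounded interval
      of the line; cutting at \<open>c > 0\<close> achieves this without any control of
      \<open>u\<close> near 0.\<close>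
    define g where "g x = (if x \<in> {c..} then u x else 0)" for x
    have "g integrable_on cbox a b" for a b
    proof -
      have "u integrable_on {c..b}"
        using u c by (auto simp: locally_integrable_def intro: set_lebesgue_integral_eq_integral(1))
      then have "g integrable_on {c..b}" by (rule integrable_eq) (auto simp: g_def)
      then have "(\<lambda>x. if x \<in> {c..b} then g x else 0) integrable_on cbox a b"
        by (metis box_real(2) integrable_on_superset integrable_restrict_UNIV integrable_on_subcbox subset_UNIV)
      then show ?thesis
        by (rule integrable_eq) (auto simp: g_def)
    qed
    then obtain N where N: "negligible N"
      "\<And>x e. x \<notin> N \<Longrightarrow> 0 < e \<Longrightarrow> \<exists>d>0. \<forall>h. 0 < h \<and> h < d \<longrightarrow>
                         norm(integral (cbox x (x + h *\<^sub>R One)) g /\<^sub>R h ^ DIM(real) - g x) < e"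
      using integrable_ccontinuous_explicit[of g] by blast
    have "u x = 0" if x: "x \<notin> N" "c < x" for x
    proof (rule ccontr)
      assume "u x \<noteq> 0"
      then obtain d where d: "d > 0" "\<And>h. 0 < h \<Longrightarrow> h < d \<Longrightarrow>
           norm(integral (cbox x (x + h *\<^sub>R One)) g /\<^sub>R h ^ DIM(real) - g x) < cmod (u x)"
        using N(2)[OF x(1), of "cmod (u x)"] by auto
      have "integral (cbox x (x + (d/2) *\<^sub>R One)) g = integral {x..x + d/2} u"
        using x by (auto simp: g_def intro!: integral_cong)
      also have "\<dots> = 0" using int0[of x "x + d/2"] x c by simp
      finally show False using d(2)[of "d/2"] d(1) x by (simp add: g_def)
    qed
    then have "AE x in lebesgue. x \<in> {0<..} \<longrightarrow> c < x \<longrightarrow> u x = 0"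
      using N(1) unfolding negligible_iff_null_sets by (auto intro!: AE_I'[of N])
    then show ?thesis by (subst AE_restrict_space_iff) auto
  qed
  from this[of "inverse (real (Suc _))"]
  have "AE x in Rplus. \<forall>n. inverse (real (Suc n)) < x \<longrightarrow> u x = 0"
    unfolding AE_all_countable by simp
  then show ?thesis
  proof (rule lebesgue_on_mono)
    fix x :: real assume "\<forall>n. inverse (real (Suc n)) < x \<longrightarrow> u x = 0" "x \<in> {0<..}"
    then show "u x = 0" using reals_Archimedean[of x] by auto
  qed
qed

lemma l2_eq_0I:
  assumes "\<And>\<phi>. \<phi> \<in> test_functions \<Longrightarrow> distr_of f \<phi> = 0"
  shows "f = 0"
proof -
  have "AE x in Rplus. rep_l2 f x = 0"
    by (rule locally_integrable_eq_0)
       (use assms in \<open>auto simp: distr_of_def intro!: locally_integrable_square_integrable l2_rep_square_integrable\<close>)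
  then have "represents (\<lambda>x. 0) f" by (simp add: represents_def)
  moreover have "represents (\<lambda>x. 0) 0"
    using represents_abs[OF square_integrable_zero] by (simp add: zero_l2_def)
  ultimately show ?thesis by (rule represents_unique)
qed

text \<open>Real orthogonality suffices because test functions are stable under conjugation and
  multiplication by i.\<close>

lemma test_orthogonal_imp_distr_of:
  assumes "\<And>\<phi>. \<phi> \<in> test_functions \<Longrightarrow> inner f (abs_l2 \<phi>) = 0" "\<phi> \<in> test_functions"
  shows "distr_of f \<phi> = 0"
  using assms by (simp add: distr_of_eq_inner test_square_integrable test_cnj test_cmult)

lemma abs_l2_add:
  "square_integrable u \<Longrightarrow> square_integrable v \<Longrightarrow> abs_l2 (\<lambda>x. u x + v x) = abs_l2 u + abs_l2 v"
  by (metis represents_abs represents_add represents_iff_abs)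

lemma abs_l2_scaleC:
  "square_integrable u \<Longrightarrow> abs_l2 (\<lambda>x. c * u x) = c *\<^sub>C abs_l2 u"
  by (metis represents_abs represents_scaleC represents_iff_abs)

lemma zero_test: "(\<lambda>x. 0) \<in> test_functions"
  by (rule test_functionsI[of _ 1 1]) (auto intro: smooth_const)

lemma abs_l2_zero: "abs_l2 (\<lambda>x. 0) = 0"
  by (simp add: zero_l2_def)

lemma subspace_closure:
  fixes S :: "'a::real_normed_vector set"
  assumes "subspace S"
  shows "subspace (closure S)"
  unfolding subspace_def
proof (intro conjI ballI allI)
  show "0 \<in> closure S" using assms closure_subset subspace_0 by blast
  fix x assume "x \<in> closure S"
  then obtain X where X: "\<And>n. X n \<in> S" "X \<longlonglongrightarrow> x" by (auto simp: closure_sequential)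
  have "(\<lambda>n. c *\<^sub>R X n) \<longlonglongrightarrow> c *\<^sub>R x" for c by (intro tendsto_intros X)
  then show "c *\<^sub>R x \<in> closure S" for c
    using X(1) assms by (auto simp: closure_sequential subspace_scale intro!: exI[of _ "\<lambda>n. c *\<^sub>R X n"])
  fix y assume "y \<in> closure S"
  then obtain Y where Y: "\<And>n. Y n \<in> S" "Y \<longlonglongrightarrow> y" by (auto simp: closure_sequential)
  have "(\<lambda>n. X n + Y n) \<longlonglongrightarrow> x + y" by (intro tendsto_intros X Y)
  then show "x + y \<in> closure S"
    using X(1) Y(1) assms by (auto simp: closure_sequential subspace_add intro!: exI[of _ "\<lambda>n. X n + Y n"])
qed

text \<open>The residual of the projection onto the closure is orthogonal to all test functions,
  hence zero by the du Bois-Reymond lemma.\<close>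

lemma test_functions_dense: "closure (abs_l2 ` test_functions) = UNIV"
proof -
  have "subspace (abs_l2 ` test_functions)"
    unfolding subspace_def
  proof (intro conjI ballI allI)
    show "0 \<in> abs_l2 ` test_functions" using zero_test abs_l2_zero by (metis image_eqI)
    fix x assume "x \<in> abs_l2 ` test_functions"
    then obtain \<phi> where \<phi>: "x = abs_l2 \<phi>" "\<phi> \<in> test_functions" by blast
    show "c *\<^sub>R x \<in> abs_l2 ` test_functions" for c
      using \<phi> abs_l2_scaleC[OF test_square_integrable[OF \<phi>(2)], of "complex_of_real c"] test_cmult[OF \<phi>(2), of "complex_of_real c"]
      by (metis scaleR_scaleC image_eqI)
    fix y assume "y \<in> abs_l2 ` test_functions"
    then obtain \<psi> where \<psi>: "y = abs_l2 \<psi>" "\<psi> \<in> test_functions" by blast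
    have "x + y = abs_l2 (\<lambda>x. \<phi> x + \<psi> x)" using \<phi> \<psi> by (simp add: abs_l2_add test_square_integrable)
    then show "x + y \<in> abs_l2 ` test_functions" using test_add[OF \<phi>(2) \<psi>(2)] by blast
  qed
  then have S: "subspace (closure (abs_l2 ` test_functions))" by (rule subspace_closure)
  have "f \<in> closure (abs_l2 ` test_functions)" for f
  proof -
    obtain p where p: "p \<in> closure (abs_l2 ` test_functions)"
      "\<forall>s\<in>closure (abs_l2 ` test_functions). inner (f - p) s = 0"
      using closed_subspace_projection[OF S closed_closure] by blast
    have "distr_of (f - p) \<phi> = 0" if "\<phi> \<in> test_functions" for \<phi>
      by (rule test_orthogonal_imp_distr_of[OF _ that]) (use p(2) closure_subset in blast)
    then have "f - p = 0" by (rule l2_eq_0I)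
    then show ?thesis using p(1) by simp
  qed
  then show ?thesis by blast
qed

text \<open>\<open>u\<close> may be singular at 0: the test function confines everything to a
  compact interval of the open half-line and kills the boundary terms.\<close>

lemma test_by_parts:
  assumes u: "\<And>x. x > 0 \<Longrightarrow> (u has_vector_derivative u' x) (at x)" "continuous_on {0<..} u'"
    and \<phi>: "\<phi> \<in> test_functions"
  shows "(\<integral>x. u x * vderiv \<phi> x \<partial>Rplus) = - (\<integral>x. u' x * \<phi> x \<partial>Rplus)"
proof -
  obtain A B where AB: "0 < A" "A < B" "\<And>x. x \<notin> {A<..<B} \<Longrightarrow> \<phi> x = 0"
    by (rule test_functions_support[OF \<phi>]) (rule that)
  have "continuous_on {0<..} u"
    using u(1) by (intro continuous_at_imp_continuous_on ballI has_vector_derivative_continuous) auto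
  then have i: "integrable Rplus (\<lambda>x. u x * vderiv \<phi> x)" "integrable Rplus (\<lambda>x. u' x * \<phi> x)"
    using u \<phi> by (auto intro!: test_integrable test_vderiv locally_integrable_continuous)
  have d: "((\<lambda>x. u x * \<phi> x) has_vector_derivative u x * vderiv \<phi> x + u' x * \<phi> x) (at x)" if "x > 0" for x
    by (intro has_vector_derivative_mult test_has_vderiv u \<phi> that)
  have "((\<lambda>x. u x * vderiv \<phi> x + u' x * \<phi> x) has_integral u B * \<phi> B - u A * \<phi> A) {A..B}"
    using AB by (intro fundamental_theorem_of_calculus has_vector_derivative_at_within[OF d]) auto
  then have 1: "integral {A..B} (\<lambda>x. u x * vderiv \<phi> x + u' x * \<phi> x) = 0"
    using AB by (auto dest: integral_unique)
  have "(\<integral>x. u x * vderiv \<phi> x + u' x * \<phi> x \<partial>Rplus) = integral {A..B} (\<lambda>x. u x * vderiv \<phi> x + u' x * \<phi> x)"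
  proof (rule integrable_Rplus_support(2))
    have "\<phi> x = 0 \<and> vderiv \<phi> x = 0" if "x \<notin> {A..B}" for x
      using that AB vderiv_eq_0[of "-{A..B}" x \<phi>] by fastforce
    then show "u x * vderiv \<phi> x + u' x * \<phi> x = 0" if "x \<notin> {A..B}" for x
      using that by simp
    have "continuous_on {A..B} (\<lambda>x. u x * vderiv \<phi> x + u' x * \<phi> x)"
      using AB \<open>continuous_on {0<..} u\<close> u(2) \<phi>
      by (intro continuous_on_add continuous_on_mult test_continuous[OF test_vderiv] test_continuous[OF \<phi>])
         (auto elim!: continuous_on_subset)
    then show "(\<lambda>x. u x * vderiv \<phi> x + u' x * \<phi> x) absolutely_integrable_on {A..B}"
      by (rule absolutely_integrable_continuous_real)
  qed (use AB in auto)
  with 1 i show ?thesis by (simp add: add_eq_0_iff2)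
qed

section \<open>Antiderivatives from 0 as pairings with kernels\<close>

lemma square_integrable_kernel:
  assumes k: "k \<in> borel_measurable borel" and C: "\<And>t. t > 0 \<Longrightarrow> cmod (k t) \<le> C"
    and 0: "\<And>t. t > 0 \<Longrightarrow> t \<notin> {a..b} \<Longrightarrow> k t = 0" and ab: "a \<le> b"
  shows "square_integrable k" "norm (abs_l2 k) \<le> C * sqrt (b - a)"
proof -
  have km: "k \<in> borel_measurable Rplus"
    using k by (intro measurable_restrict_space1 measurable_completion) simp
  have C0: "C \<ge> 0" using C[of 1] norm_ge_zero[of "k 1"] by linarith
  have i: "integrable Rplus (\<lambda>t. C\<^sup>2 * indicator {a..b} t)"
    "(\<integral>t. (indicator {a..b} t :: real) \<partial>Rplus) \<le> b - a"
  proof -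
    have eq: "(\<lambda>t. (cmod (indicator {a..b} t))\<^sup>2) = (\<lambda>t. indicator {a..b} t :: real)"
      by (auto simp: indicator_def)
    have "integrable Rplus (\<lambda>t. indicator {a..b} t :: real)"
      using indicator_complex_square_integrable[of a b] by (simp add: square_integrable_def eq)
    then show "integrable Rplus (\<lambda>t. C\<^sup>2 * indicator {a..b} t)" by simp
    have "(\<integral>t. (indicator {a..b} t :: real) \<partial>Rplus) = measure Rplus ({a..b} \<inter> {0<..})" by simp
    also have "\<dots> = measure lebesgue ({a..b} \<inter> {0<..})" by (rule measure_restrict_space) auto
    also have "\<dots> \<le> measure lebesgue {a..b}"
      by (rule measure_mono_fmeasurable) auto
    finally show "(\<integral>t. (indicator {a..b} t :: real) \<partial>Rplus) \<le> b - a" using ab by simp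
  qed
  have le: "(cmod (k t))\<^sup>2 \<le> C\<^sup>2 * indicator {a..b} t" if "t > 0" for t
    using 0[OF that] power_mono[OF C[OF that], of 2] by (auto simp: indicator_def)
  have ae: "AE t in Rplus. norm ((cmod (k t))\<^sup>2) \<le> norm (C\<^sup>2 * indicator {a..b} t)"
    by (rule AE_I2) (use le in \<open>auto simp: indicator_def\<close>)
  have ki: "integrable Rplus (\<lambda>t. (cmod (k t))\<^sup>2)"
    by (rule Bochner_Integration.integrable_bound[OF i(1) _ ae]) (use km in measurable)
  then show s: "square_integrable k" using km by (simp add: square_integrable_def)
  have "(norm (abs_l2 k))\<^sup>2 = (\<integral>t. (cmod (k t))\<^sup>2 \<partial>Rplus)"
    by (rule norm_represents_sq[OF represents_abs[OF s]])
  also have "\<dots> \<le> (\<integral>t. C\<^sup>2 * indicator {a..b} t \<partial>Rplus)"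
    by (rule integral_mono[OF ki i(1)]) (use le in auto)
  also have "\<dots> \<le> C\<^sup>2 * (b - a)" using i(2) by (simp add: mult_left_mono)
  also have "\<dots> = (C * sqrt (b - a))\<^sup>2" using ab by (simp add: power_mult_distrib)
  finally show "norm (abs_l2 k) \<le> C * sqrt (b - a)"
    by (rule power2_le_imp_le) (use C0 ab in auto)
qed

text \<open>\<open>Vint h x = \<integral>\<^sub>0\<^sup>x h\<close> and \<open>Uint h x = \<integral>\<^sub>0\<^sup>x (x - t) h(t) dt\<close>; as pairings with \<open>L\<^sup>2\<close> kernels they are
  visibly continuous in \<open>h\<close>, and bounds on the kernels yield their regularity in \<open>x\<close>.\<close>

definition V_kernel :: "real \<Rightarrow> real \<Rightarrow> complex" where
  "V_kernel x t = (if t \<le> x then 1 else 0)"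

definition U_kernel :: "real \<Rightarrow> real \<Rightarrow> complex" where
  "U_kernel x t = complex_of_real (max 0 (x - t))"

definition Vint :: "l2 \<Rightarrow> real \<Rightarrow> complex" where
  "Vint h x = distr_of h (V_kernel x)"

definition Uint :: "l2 \<Rightarrow> real \<Rightarrow> complex" where
  "Uint h x = distr_of h (U_kernel x)"

lemma V_kernel_measurable [measurable]: "V_kernel x \<in> borel_measurable borel"
  unfolding V_kernel_def by measurable

lemma U_kernel_measurable [measurable]: "U_kernel x \<in> borel_measurable borel"
  unfolding U_kernel_def by measurable

lemma V_kernel_square_integrable: "square_integrable (V_kernel x)"
  by (rule square_integrable_kernel(1)[where C = 1 and a = 0 and b = "\<bar>x\<bar>"]) (auto simp: V_kernel_def)

lemma U_kernel_square_integrable: "square_integrable (U_kernel x)"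
  by (rule square_integrable_kernel(1)[where C = "\<bar>x\<bar>" and a = 0 and b = "\<bar>x\<bar>"]) (auto simp: U_kernel_def max_def)

lemma bounded_linear_Uint: "bounded_linear (\<lambda>h. Uint h x)"
  unfolding Uint_def by (rule bounded_linear_distr_of[OF U_kernel_square_integrable])

text \<open>The two kernels differ by the indicator of the interval from \<open>x\<close> to
  \<open>y\<close>, whose L2 norm is at most the square root of its length.\<close>

lemma Vint_diff_le:
  assumes "x \<le> y"
  shows "cmod (Vint h y - Vint h x) \<le> 2 * norm h * sqrt (y - x)"
proof -
  have s: "square_integrable (\<lambda>t. V_kernel y t - V_kernel x t)"
    "norm (abs_l2 (\<lambda>t. V_kernel y t - V_kernel x t)) \<le> 1 * sqrt (y - x)"
    by (rule square_integrable_kernel[where C = 1 and a = x and b = y];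
        use assms in \<open>auto simp: V_kernel_def\<close>)+
  have "cmod (Vint h y - Vint h x) \<le> 2 * norm h * norm (abs_l2 (\<lambda>t. V_kernel y t - V_kernel x t))"
    using norm_distr_of_le[OF s(1)]
    by (simp add: Vint_def distr_of_diff[OF V_kernel_square_integrable V_kernel_square_integrable])
  also have "\<dots> \<le> 2 * norm h * sqrt (y - x)" using s(2) by (intro mult_left_mono) auto
  finally show ?thesis .
qed

text \<open>A first-order Taylor remainder: its kernel is supported between \<open>x\<close> and
  \<open>y\<close> and bounded by their distance, so that its norm is at most the distance to the
  power 3/2.\<close>

lemma Uint_diff_le:
  "cmod (Uint h y - Uint h x - complex_of_real (y - x) * Vint h x) \<le> 2 * norm h * (\<bar>y - x\<bar> * sqrt \<bar>y - x\<bar>)"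
proof -
  let ?k = "\<lambda>t. U_kernel y t - U_kernel x t - complex_of_real (y - x) * V_kernel x t"
  have k: "?k t = complex_of_real (max 0 (y - t) - max 0 (x - t) - (if t \<le> x then y - x else 0))" for t
    by (simp add: U_kernel_def V_kernel_def)
  have s: "square_integrable ?k" "norm (abs_l2 ?k) \<le> \<bar>y - x\<bar> * sqrt (max x y - min x y)"
  proof -
    have m: "?k \<in> borel_measurable borel" by measurable
    have C: "cmod (?k t) \<le> \<bar>y - x\<bar>" for t unfolding k norm_of_real by auto
    have 0: "?k t = 0" if "t > 0" "t \<notin> {min x y..max x y}" for t using that unfolding k by auto
    show "square_integrable ?k" "norm (abs_l2 ?k) \<le> \<bar>y - x\<bar> * sqrt (max x y - min x y)"
      using square_integrable_kernel[OF m C 0] by auto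
  qed
  have "Uint h y - Uint h x - complex_of_real (y - x) * Vint h x = distr_of h ?k"
    unfolding Uint_def Vint_def
    by (simp add: distr_of_diff distr_of_mult square_integrable_diff square_integrable_mult
       U_kernel_square_integrable V_kernel_square_integrable del: of_real_diff)
  then have "cmod (Uint h y - Uint h x - complex_of_real (y - x) * Vint h x) \<le> 2 * norm h * norm (abs_l2 ?k)"
    using norm_distr_of_le[OF s(1)] by simp
  also have "\<dots> \<le> 2 * norm h * (\<bar>y - x\<bar> * sqrt (max x y - min x y))" using s(2) by (intro mult_left_mono) auto
  also have "max x y - min x y = \<bar>y - x\<bar>" by auto
  finally show ?thesis .
qed

lemma Vint_nonpos: "x \<le> 0 \<Longrightarrow> Vint h x = 0"
  unfolding Vint_def distr_of_def by (rule integral_eq_zero_AE) (auto simp: V_kernel_def intro!: AE_I2)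

lemma Uint_nonpos: "x \<le> 0 \<Longrightarrow> Uint h x = 0"
  unfolding Uint_def distr_of_def by (rule integral_eq_zero_AE) (auto simp: U_kernel_def intro!: AE_I2)

lemma Vint_continuous: "isCont (Vint h) x"
proof -
  have le: "cmod (Vint h y - Vint h x) \<le> 2 * norm h * sqrt \<bar>y - x\<bar>" for y
    using Vint_diff_le[of x y h] Vint_diff_le[of y x h] by (cases "x \<le> y") (auto simp: norm_minus_commute)
  have "((\<lambda>y. 2 * norm h * sqrt \<bar>y - x\<bar>) \<longlongrightarrow> 2 * norm h * sqrt \<bar>x - x\<bar>) (at x)"
    by (intro tendsto_intros)
  then have "((\<lambda>y. Vint h y - Vint h x) \<longlongrightarrow> 0) (at x)"
    by (intro Lim_null_comparison[OF always_eventually[OF allI[OF le]]]) simp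
  then show ?thesis unfolding isCont_def using Lim_null by blast
qed

text \<open>The Taylor remainder is of order 3/2. The derivative is two-sided at every real point,
  including 0, because both functions vanish on the nonpositive axis.\<close>

lemma Uint_deriv: "(Uint h has_vector_derivative Vint h x) (at x)"
  unfolding has_vector_derivative_def has_derivative_iff_norm
proof (intro conjI bounded_linear_scaleR_left)
  have "((\<lambda>y. 2 * norm h * sqrt \<bar>y - x\<bar>) \<longlongrightarrow> 2 * norm h * sqrt \<bar>x - x\<bar>) (at x)"
    by (intro tendsto_intros)
  then have lim: "((\<lambda>y. 2 * norm h * sqrt \<bar>y - x\<bar>) \<longlongrightarrow> 0) (at x)" by simp
  have le: "norm (norm (Uint h y - Uint h x - (y - x) *\<^sub>R Vint h x) / norm (y - x)) \<le> 2 * norm h * sqrt \<bar>y - x\<bar>" for y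
    using Uint_diff_le[of h y x] by (cases "y = x") (auto simp: scaleR_conv_of_real field_simps)
  show "((\<lambda>y. norm (Uint h y - Uint h x - (y - x) *\<^sub>R Vint h x) / norm (y - x)) \<longlongrightarrow> 0) (at x)"
    by (rule Lim_null_comparison[OF always_eventually[OF allI[OF le]] lim])
qed

lemma Uint_continuous: "isCont (Uint h) x"
  using Uint_deriv has_vector_derivative_continuous by blast

text \<open>The Taylor estimate at 0, where value and derivative vanish; uniform in \<open>h\<close>
  up to its norm, it lets integrals of \<open>Uint h\<close> against test functions depend
  continuously on \<open>h\<close>.\<close>

lemma Uint_bound:
  assumes "x \<ge> 0"
  shows "cmod (Uint h x) \<le> 2 * norm h * (x * sqrt x)"
  using Uint_diff_le[of h x 0] assms by (simp add: Uint_nonpos Vint_nonpos)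

lemma locally_integrable_Uint: "locally_integrable (Uint h)"
  by (intro locally_integrable_continuous continuous_at_imp_continuous_on ballI Uint_continuous)

lemma Vint_deriv:
  assumes u: "represents u h" "continuous_on {0<..} u" and x: "x > 0"
  shows "(Vint h has_vector_derivative u x) (at x)"
proof -
  \<comment> \<open>\<open>u\<close> is continuous only on the open half-line, so the antiderivative
    is restarted at a point \<open>a\<close> strictly between 0 and \<open>x\<close>.\<close>
  define a b where "a = x / 2" and "b = x + 1"
  have ab: "0 < a" "a < x" "x < b" using x by (auto simp: a_def b_def)
  have V: "Vint h y = Vint h a + integral {a..y} u" if y: "y \<in> {a..b}" for y
  proof -
    have "Vint h y - Vint h a = (\<integral>t. u t * (V_kernel y t - V_kernel a t) \<partial>Rplus)"
      unfolding Vint_def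
      using distr_of_represents[OF u(1) square_integrable_diff[OF V_kernel_square_integrable V_kernel_square_integrable]]
      by (simp add: distr_of_diff[OF V_kernel_square_integrable V_kernel_square_integrable])
    \<comment> \<open>The half-open interval is exactly where the two step kernels differ.\<close>
    also have "\<dots> = integral {a<..y} (\<lambda>t. u t * (V_kernel y t - V_kernel a t))"
    proof (rule integrable_Rplus_support(2))
      have "u absolutely_integrable_on {a..y}"
        using u(2) ab by (intro absolutely_integrable_continuous_real) (auto elim!: continuous_on_subset)
      then have "u absolutely_integrable_on {a<..y}" by (rule set_integrable_subset) auto
      then show "(\<lambda>t. u t * (V_kernel y t - V_kernel a t)) absolutely_integrable_on {a<..y}"
        by (rule set_integrable_cong[THEN iffD1, rotated 3]) (auto simp: V_kernel_def)
    qed (use ab y in \<open>auto simp: V_kernel_def\<close>)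
    also have "\<dots> = integral {a<..y} u"
      by (rule integral_cong) (auto simp: V_kernel_def)
    also have "\<dots> = integral {a..y} u"
    proof (rule integral_spike_set)
      show "negligible {x \<in> {a<..y} - {a..y}. u x \<noteq> 0}"
        by (rule negligible_subset[of "{}"]) auto
      show "negligible {x \<in> {a..y} - {a<..y}. u x \<noteq> 0}"
        by (rule negligible_subset[of "{a}"]) auto
    qed
    finally show ?thesis by (simp add: diff_eq_eq add.commute)
  qed
  have "((\<lambda>y. integral {a..y} u) has_vector_derivative u x) (at x within {a..b})"
    using ab u(2) by (intro integral_has_vector_derivative) (auto elim!: continuous_on_subset)
  then have "((\<lambda>y. integral {a..y} u) has_vector_derivative u x) (at x)"
    using ab by (simp add: at_within_Icc_at)
  from has_vector_derivative_add[OF has_vector_derivative_const[of "Vint h a"] this]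
  have "((\<lambda>y. Vint h a + integral {a..y} u) has_vector_derivative u x) (at x)" by simp
  then show ?thesis
  proof (rule has_vector_derivative_transform_within_open[where S = "{a<..<b}"])
    show "Vint h a + integral {a..y} u = Vint h y" if "y \<in> {a<..<b}" for y
      by (rule V[symmetric]) (use that in auto)
  qed (use ab in auto)
qed

section \<open>Agreement with classical and weak derivatives\<close>

lemma test_antiderivative:
  assumes \<psi>: "\<psi> \<in> test_functions"
  shows "(Vint (abs_l2 \<psi>) has_vector_derivative \<psi> x) (at x)"
proof (cases "x > 0")
  case True
  then show ?thesis
    by (intro Vint_deriv represents_abs test_square_integrable test_continuous \<psi>)
next
  case False
  obtain A B where AB: "0 < A" "A < B" "\<And>x. x \<notin> {A<..<B} \<Longrightarrow> \<psi> x = 0"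
    by (rule test_functions_support[OF \<psi>]) (rule that)
  have V0: "Vint (abs_l2 \<psi>) y = 0" if "y < A" for y
  proof -
    have "Vint (abs_l2 \<psi>) y = (\<integral>t. \<psi> t * V_kernel y t \<partial>Rplus)"
      unfolding Vint_def
      by (rule distr_of_represents[OF represents_abs[OF test_square_integrable[OF \<psi>]] V_kernel_square_integrable])
    also have "\<dots> = 0"
      by (rule integral_eq_zero_AE) (use that AB in \<open>auto simp: V_kernel_def\<close>)
    finally show ?thesis .
  qed
  have "((\<lambda>_. 0) has_vector_derivative (0::complex)) (at x)" by simp
  then have "(Vint (abs_l2 \<psi>) has_vector_derivative 0) (at x)"
    by (rule has_vector_derivative_transform_within_open[where S = "{..<A}"]) (use False AB V0 in auto)
  then show ?thesis using AB False by simp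
qed

lemma has_vector_derivative_same_eq:
  fixes f g :: "real \<Rightarrow> complex"
  assumes f: "\<And>x. (f has_vector_derivative f' x) (at x)"
    and g: "\<And>x. (g has_vector_derivative f' x) (at x)" and 0: "f 0 = g 0"
  shows "f = g"
proof
  fix x
  have d: "((\<lambda>y. f y - g y) has_vector_derivative 0) (at x within UNIV)" for x
    using has_vector_derivative_diff[OF f g] by simp
  obtain c where "\<And>x. x \<in> UNIV \<Longrightarrow> f x - g x = c"
    by (rule has_vector_derivative_zero_constant[OF convex_UNIV d]) (rule that)
  from this[of 0] this[of x] show "f x = g x" using 0 by simp
qed

text \<open>A test function vanishes near 0, so integrating its second derivative twice from 0
  recovers it without integration constants.\<close>

lemma Uint_vderiv2:
  assumes \<phi>: "\<phi> \<in> test_functions"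
  shows "Uint (abs_l2 (vderiv (vderiv \<phi>))) = \<phi>"
proof -
  obtain A B where AB: "0 < A" "A < B" "\<And>x. x \<notin> {A<..<B} \<Longrightarrow> \<phi> x = 0"
    by (rule test_functions_support[OF \<phi>]) (rule that)
  have "vderiv \<phi> 0 = 0" by (rule vderiv_eq_0[of "{..<A}"]) (use AB in auto)
  then have V: "Vint (abs_l2 (vderiv (vderiv \<phi>))) = vderiv \<phi>"
    by (intro has_vector_derivative_same_eq[where f' = "vderiv (vderiv \<phi>)"] test_has_vderiv
        test_antiderivative test_vderiv \<phi>) (simp add: Vint_nonpos)
  show ?thesis
  proof (rule has_vector_derivative_same_eq[where f' = "vderiv \<phi>"])
    show "(Uint (abs_l2 (vderiv (vderiv \<phi>))) has_vector_derivative vderiv \<phi> x) (at x)" for x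
      using Uint_deriv[of "abs_l2 (vderiv (vderiv \<phi>))" x] unfolding V .
    show "Uint (abs_l2 (vderiv (vderiv \<phi>))) 0 = \<phi> 0" using AB by (simp add: Uint_nonpos)
  qed (rule test_has_vderiv[OF \<phi>])
qed

lemma bounded_linear_Uint_integral:
  assumes \<psi>: "\<psi> \<in> test_functions"
  shows "bounded_linear (\<lambda>h. \<integral>x. Uint h x * \<psi> x \<partial>Rplus)"
proof -
  have i: "integrable Rplus (\<lambda>x. Uint h x * \<psi> x)" for h
    by (rule test_integrable[OF locally_integrable_Uint \<psi>])
  have U: "Uint (f + g) x = Uint f x + Uint g x" "Uint (r *\<^sub>R f) x = r *\<^sub>R Uint f x" for f g r x
    using linear_add[OF bounded_linear.linear[OF bounded_linear_Uint[of x]]]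
      linear_scale[OF bounded_linear.linear[OF bounded_linear_Uint[of x]]] by auto
  have "continuous_on {0<..} (\<lambda>x::real. complex_of_real (x * sqrt x))"
    by (intro continuous_intros)
  then have "integrable Rplus (\<lambda>x. complex_of_real (x * sqrt x) * \<psi> x)"
    by (intro test_integrable locally_integrable_continuous \<psi>)
  then have w: "integrable Rplus (\<lambda>x. cmod (complex_of_real (x * sqrt x) * \<psi> x))" by (rule integrable_norm)
  show ?thesis
  proof (rule bounded_linear_intro)
    show "(\<integral>x. Uint (f + g) x * \<psi> x \<partial>Rplus) = (\<integral>x. Uint f x * \<psi> x \<partial>Rplus) + (\<integral>x. Uint g x * \<psi> x \<partial>Rplus)" for f g
      by (simp add: U distrib_right i)
    show "(\<integral>x. Uint (r *\<^sub>R f) x * \<psi> x \<partial>Rplus) = r *\<^sub>R (\<integral>x. Uint f x * \<psi> x \<partial>Rplus)" for r f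
      by (simp add: U)
    fix h
    have "cmod (\<integral>x. Uint h x * \<psi> x \<partial>Rplus) \<le> (\<integral>x. cmod (Uint h x * \<psi> x) \<partial>Rplus)"
      by (rule integral_norm_bound)
    also have "\<dots> \<le> (\<integral>x. (2 * norm h) * cmod (complex_of_real (x * sqrt x) * \<psi> x) \<partial>Rplus)"
    proof (rule integral_mono)
      show "cmod (Uint h x * \<psi> x) \<le> (2 * norm h) * cmod (complex_of_real (x * sqrt x) * \<psi> x)"
        if "x \<in> space Rplus" for x
        using mult_right_mono[OF Uint_bound[of x h] norm_ge_zero[of "\<psi> x"]] that
        by (simp add: norm_mult mult.assoc del: of_real_mult)
    qed (use w integrable_norm[OF i] in auto)
    also have "\<dots> = norm h * (2 * (\<integral>x. cmod (complex_of_real (x * sqrt x) * \<psi> x) \<partial>Rplus))" by simp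
    finally show "norm (\<integral>x. Uint h x * \<psi> x \<partial>Rplus) \<le> norm h * (2 * (\<integral>x. cmod (complex_of_real (x * sqrt x) * \<psi> x) \<partial>Rplus))" .
  qed
qed

lemma bounded_linear_eq_on_test:
  assumes "bounded_linear F" "bounded_linear G"
    and "\<And>\<phi>. \<phi> \<in> test_functions \<Longrightarrow> F (abs_l2 \<phi>) = (G (abs_l2 \<phi>) :: complex)"
  shows "F h = G h"
proof -
  have "closed {h. F h = G h}"
    by (intro closed_Collect_eq bounded_linear.continuous_on[OF assms(1)]
        bounded_linear.continuous_on[OF assms(2)] continuous_on_id)
  moreover have "abs_l2 ` test_functions \<subseteq> {h. F h = G h}" using assms(3) by auto
  ultimately have "closure (abs_l2 ` test_functions) \<subseteq> {h. F h = G h}" by (rule closure_minimal[rotated])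
  then show ?thesis using test_functions_dense by auto
qed

text \<open>For a test function in place of \<open>h\<close> this is two integrations by parts; both
  sides are continuous in \<open>h\<close>, so density extends it to all of L2.\<close>

lemma Uint_weak_deriv:
  assumes \<psi>: "\<psi> \<in> test_functions"
  shows "(\<integral>x. Uint h x * vderiv (vderiv \<psi>) x \<partial>Rplus) = distr_of h \<psi>"
proof (rule bounded_linear_eq_on_test)
  show "bounded_linear (\<lambda>h. \<integral>x. Uint h x * vderiv (vderiv \<psi>) x \<partial>Rplus)"
    by (intro bounded_linear_Uint_integral test_vderiv \<psi>)
  show "bounded_linear (\<lambda>h. distr_of h \<psi>)"
    by (intro bounded_linear_distr_of test_square_integrable \<psi>)
  fix \<phi> assume \<phi>: "\<phi> \<in> test_functions"
  have c: "continuous_on {0<..} (Vint (abs_l2 \<phi>))"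
    by (intro continuous_at_imp_continuous_on ballI Vint_continuous)
  have "(\<integral>x. Uint (abs_l2 \<phi>) x * vderiv (vderiv \<psi>) x \<partial>Rplus) = - (\<integral>x. Vint (abs_l2 \<phi>) x * vderiv \<psi> x \<partial>Rplus)"
    by (intro test_by_parts Uint_deriv test_vderiv \<psi> c)
  also have "(\<integral>x. Vint (abs_l2 \<phi>) x * vderiv \<psi> x \<partial>Rplus) = - (\<integral>x. \<phi> x * \<psi> x \<partial>Rplus)"
    by (intro test_by_parts test_antiderivative \<psi> \<phi> test_continuous)
  finally show "(\<integral>x. Uint (abs_l2 \<phi>) x * vderiv (vderiv \<psi>) x \<partial>Rplus) = distr_of (abs_l2 \<phi>) \<psi>"
    by (simp add: distr_of_represents[OF represents_abs[OF test_square_integrable[OF \<phi>]] test_square_integrable[OF \<psi>]])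
qed

text \<open>The double antiderivative \<open>\<integral>\<^sub>0\<^sup>x (x - t) \<psi>(t) dt\<close> vanishes for large \<open>x\<close> because both moments of \<open>\<psi>\<close> do.\<close>

lemma vanishing_moments_vderiv2:
  assumes \<psi>: "\<psi> \<in> test_functions"
    and m: "(\<integral>x. \<psi> x \<partial>Rplus) = 0" "(\<integral>x. complex_of_real x * \<psi> x \<partial>Rplus) = 0"
  shows "\<exists>\<eta>\<in>test_functions. vderiv (vderiv \<eta>) = \<psi>"
proof -
  let ?h = "abs_l2 \<psi>"
  obtain A B where AB: "0 < A" "A < B" "\<And>x. x \<notin> {A<..<B} \<Longrightarrow> \<psi> x = 0"
    by (rule test_functions_support[OF \<psi>]) (rule that)
  have "continuous_on {0<..} (\<lambda>x. complex_of_real x)" "continuous_on {0<..} (\<lambda>x::real. 1::complex)"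
    by (intro continuous_intros)+
  then have i: "integrable Rplus (\<lambda>x. complex_of_real x * \<psi> x)" "integrable Rplus (\<lambda>x. 1 * \<psi> x)"
    using test_integrable[OF locally_integrable_continuous \<psi>] by blast+
  have U: "Uint ?h x = (\<integral>t. \<psi> t * U_kernel x t \<partial>Rplus)" for x
    unfolding Uint_def
    by (rule distr_of_represents[OF represents_abs[OF test_square_integrable[OF \<psi>]] U_kernel_square_integrable])
  have "Uint ?h x = 0" if "x \<notin> {A..B}" for x
  proof (cases "x < A")
    case True
    have "\<psi> t * U_kernel x t = 0" for t
      using AB(3)[of t] True by (cases "t \<in> {A<..<B}") (auto simp: U_kernel_def)
    then have "(\<lambda>t. \<psi> t * U_kernel x t) = (\<lambda>t. 0)" by blast
    then show ?thesis unfolding U by simp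
  next
    case False
    have "\<psi> t * U_kernel x t = x * (1 * \<psi> t) - complex_of_real t * \<psi> t" for t
      using AB(3)[of t] that False by (cases "t < B") (auto simp: U_kernel_def algebra_simps)
    then have "Uint ?h x = (\<integral>t. x * (1 * \<psi> t) - complex_of_real t * \<psi> t \<partial>Rplus)"
      unfolding U by presburger
    also have "\<dots> = x * (\<integral>t. 1 * \<psi> t \<partial>Rplus) - (\<integral>t. complex_of_real t * \<psi> t \<partial>Rplus)"
      using i by (subst Bochner_Integration.integral_diff) (auto simp del: mult_1)
    also have "\<dots> = 0" using m by simp
    finally show ?thesis .
  qed
  moreover have "smooth (Vint ?h)"
    by (rule smooth_antiderivative[OF test_functions_smooth[OF \<psi>] test_antiderivative[OF \<psi>]])
  then have "smooth (Uint ?h)" by (rule smooth_antiderivative[OF _ Uint_deriv])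
  ultimately have "Uint ?h \<in> test_functions" using AB(1) by (intro test_functionsI) auto
  moreover have "vderiv (Uint ?h) = Vint ?h" by (auto intro: vector_derivative_at Uint_deriv)
  moreover have "vderiv (Vint ?h) = \<psi>" by (auto intro: vector_derivative_at test_antiderivative[OF \<psi>])
  ultimately show ?thesis by metis
qed

text \<open>Modulo two fixed test functions with prescribed moments, every test function is a second derivative,
  so \<open>z\<close> acts on test functions through their first two moments.\<close>

lemma weak_deriv2_zero_affine:
  assumes z: "locally_integrable z"
    and 0: "\<And>\<psi>. \<psi> \<in> test_functions \<Longrightarrow> (\<integral>x. z x * vderiv (vderiv \<psi>) x \<partial>Rplus) = 0"
  shows "\<exists>c d. AE x in Rplus. z x = c + d * complex_of_real x"
proof -
  define m0 where "m0 \<psi> = (\<integral>x. \<psi> x \<partial>Rplus)" for \<psi> :: "real \<Rightarrow> complex"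
  define m1 where "m1 \<psi> = (\<integral>x. complex_of_real x * \<psi> x \<partial>Rplus)" for \<psi> :: "real \<Rightarrow> complex"
  define Z where "Z \<psi> = (\<integral>x. z x * \<psi> x \<partial>Rplus)" for \<psi> :: "real \<Rightarrow> complex"
  have c: "continuous_on {0<..} (\<lambda>x. complex_of_real x)" "continuous_on {0<..} (\<lambda>x::real. 1::complex)"
    by (intro continuous_intros)+
  have i1: "integrable Rplus (\<lambda>x. complex_of_real x * \<psi> x)" if "\<psi> \<in> test_functions" for \<psi>
    by (intro test_integrable locally_integrable_continuous that c)
  have i0: "integrable Rplus \<psi>" if "\<psi> \<in> test_functions" for \<psi>
    using test_integrable[OF locally_integrable_continuous[OF c(2)] that] by simp
  have iZ: "integrable Rplus (\<lambda>x. z x * \<psi> x)" if "\<psi> \<in> test_functions" for \<psi>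
    by (intro test_integrable z that)
  note i = i0 i1 iZ
  have add: "m0 (\<lambda>x. \<phi> x + \<psi> x) = m0 \<phi> + m0 \<psi>" "m1 (\<lambda>x. \<phi> x + \<psi> x) = m1 \<phi> + m1 \<psi>"
    "Z (\<lambda>x. \<phi> x + \<psi> x) = Z \<phi> + Z \<psi>" if "\<phi> \<in> test_functions" "\<psi> \<in> test_functions" for \<phi> \<psi>
    using i[OF that(1)] i[OF that(2)] by (auto simp: m0_def m1_def Z_def distrib_left)
  have scale: "m0 (\<lambda>x. k * \<psi> x) = k * m0 \<psi>" "m1 (\<lambda>x. k * \<psi> x) = k * m1 \<psi>" "Z (\<lambda>x. k * \<psi> x) = k * Z \<psi>"
    for k \<psi> by (auto simp: m0_def m1_def Z_def mult.left_commute)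
  \<comment> \<open>Otherwise the constant 1 would be annihilated by every test function and vanish
    almost everywhere.\<close>
  have "\<exists>b\<in>test_functions. m0 b \<noteq> 0"
  proof (rule ccontr)
    assume "\<not> ?thesis"
    then have "AE x in Rplus. (1::complex) = 0"
      by (intro locally_integrable_eq_0 locally_integrable_continuous c) (auto simp: m0_def)
    then have "AE x in lebesgue. \<not> 0 < (x::real)" by (subst (asm) AE_restrict_space_iff) auto
    then have "{x \<in> space lebesgue. \<not> \<not> 0 < (x::real)} \<in> null_sets lebesgue"
      by (subst AE_iff_null[symmetric]) auto
    then have "negligible {x. 0 < (x::real)}" by (simp add: negligible_iff_null_sets)
    then have "negligible (cbox 1 (2::real))" by (rule negligible_subset) auto
    then show False using negligible_interval(1)[of 1 "2::real"] by simp
  qed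
  then obtain b where b: "b \<in> test_functions" "m0 b \<noteq> 0" by blast
  \<comment> \<open>The derivative of \<open>b\<close> has zeroth moment 0 and first moment
    \<open>- m0 b\<close>; after normalization \<open>e0\<close> and \<open>e1\<close> are dual to
    the two moments.\<close>
  define e1 where "e1 = (\<lambda>x. (- 1 / m0 b) * vderiv b x)"
  define e0 where "e0 = (\<lambda>x. (1 / m0 b) * b x + (- (m1 b / m0 b)) * e1 x)"
  have e: "e1 \<in> test_functions" "e0 \<in> test_functions"
    unfolding e1_def e0_def by (intro test_add test_cmult test_vderiv b)+
  have "m0 (vderiv b) = 0"
    using test_by_parts[of "\<lambda>x. 1" "\<lambda>x. 0", OF _ _ b(1)] by (simp add: m0_def)
  moreover have "(complex_of_real has_vector_derivative 1) (at x)" for x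
    by (rule has_vector_derivative_eq_rhs[OF has_vector_derivative_of_real[OF DERIV_ident]]) simp
  then have "m1 (vderiv b) = - m0 b"
    using test_by_parts[of complex_of_real "\<lambda>x. 1", OF _ _ b(1)] by (simp add: m0_def m1_def)
  ultimately have m1: "m0 e1 = 0" "m1 e1 = 1"
    using b(2) by (simp_all only: e1_def scale) simp_all
  have "m0 e0 = (1 / m0 b) * m0 b + (- (m1 b / m0 b)) * m0 e1" "m1 e0 = (1 / m0 b) * m1 b + (- (m1 b / m0 b)) * m1 e1"
    unfolding e0_def add[OF test_cmult[OF b(1)] test_cmult[OF e(1)]] scale by simp_all
  then have m: "m0 e1 = 0" "m1 e1 = 1" "m0 e0 = 1" "m1 e0 = 0"
    using b(2) m1 by simp_all
  define u where "u x = z x - (Z e0 + Z e1 * complex_of_real x)" for x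
  have ul: "locally_integrable u" unfolding u_def
    by (intro locally_integrable_diff z locally_integrable_continuous continuous_intros)
  have "AE x in Rplus. u x = 0"
  proof (rule locally_integrable_eq_0[OF ul])
    fix \<psi> assume \<psi>: "\<psi> \<in> test_functions"
    define \<psi>' where "\<psi>' = (\<lambda>x. \<psi> x + ((- m0 \<psi>) * e0 x + (- m1 \<psi>) * e1 x))"
    have t: "\<psi>' \<in> test_functions" unfolding \<psi>'_def by (intro test_add test_cmult \<psi> e)
    note lin = add[OF \<psi> test_add[OF test_cmult[OF e(2)] test_cmult[OF e(1)]]]
      add[OF test_cmult[OF e(2)] test_cmult[OF e(1)]] scale
    have "m0 \<psi>' = 0" "m1 \<psi>' = 0" unfolding \<psi>'_def lin m by simp_all
    then obtain \<eta> where "\<eta> \<in> test_functions" "vderiv (vderiv \<eta>) = \<psi>'"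
      using vanishing_moments_vderiv2[OF t] by (auto simp: m0_def m1_def)
    then have "Z \<psi>' = 0" using 0 by (auto simp: Z_def)
    then have "Z \<psi> = m0 \<psi> * Z e0 + m1 \<psi> * Z e1"
      unfolding \<psi>'_def lin by (simp add: algebra_simps)
    moreover have "(\<integral>x. u x * \<psi> x \<partial>Rplus) = (\<integral>x. z x * \<psi> x - (Z e0 * \<psi> x + Z e1 * (complex_of_real x * \<psi> x)) \<partial>Rplus)"
      by (simp add: u_def algebra_simps)
    moreover have "\<dots> = Z \<psi> - (Z e0 * m0 \<psi> + Z e1 * m1 \<psi>)"
      unfolding m0_def m1_def Z_def using i[OF \<psi>] by simp
    ultimately show "(\<integral>x. u x * \<psi> x \<partial>Rplus) = 0" by (simp add: mult.commute)
  qed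
  then have "AE x in Rplus. z x = Z e0 + Z e1 * complex_of_real x" by (simp add: u_def)
  then show ?thesis by blast
qed

section \<open>The Hardy inequality\<close>

text \<open>With \<open>c = Re s - 1/2\<close> and \<open>r = x p' + s p\<close>, expand \<open>0 \<le> |r - c p|\<^sup>2\<close> and use
  \<open>Re (r cnj p) - c |p|\<^sup>2 = (x |p|\<^sup>2 / 2)'\<close>.\<close>

lemma hardy_euler_operator:
  fixes p p' :: "real \<Rightarrow> complex" and s :: complex
  assumes AB: "A \<le> B" and d: "\<And>x. x \<in> {A..B} \<Longrightarrow> (p has_vector_derivative p' x) (at x)"
    and c': "continuous_on {A..B} p'" and 0: "p A = 0" "p B = 0"
  shows "(Re s - 1/2)\<^sup>2 * integral {A..B} (\<lambda>x. (cmod (p x))\<^sup>2)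
       \<le> integral {A..B} (\<lambda>x. (cmod (complex_of_real x * p' x + s * p x))\<^sup>2)"
proof -
  define c where "c = Re s - 1/2"
  define r where "r x = complex_of_real x * p' x + s * p x" for x
  have cp: "continuous_on {A..B} p"
    using d by (intro continuous_at_imp_continuous_on ballI has_vector_derivative_continuous) auto
  have cr: "continuous_on {A..B} r" unfolding r_def by (intro continuous_intros cp c')
  have in_r: "inner (p x) (r x) = x * inner (p x) (p' x) + Re s * inner (p x) (p x)" for x
    by (simp add: r_def inner_complex_def algebra_simps)
  have "((\<lambda>x. (x / 2) * inner (p x) (p x)) has_vector_derivative inner (p x) (r x) - c * inner (p x) (p x)) (at x within {A..B})"
    if x: "x \<in> {A..B}" for x
  proof -
    have "((\<lambda>x. inner (p x) (p x)) has_vector_derivative inner (p x) (p' x) + inner (p' x) (p x)) (at x)"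
      by (rule bounded_bilinear.has_vector_derivative[OF bounded_bilinear_inner d[OF x] d[OF x]])
    then have *: "((\<lambda>x. inner (p x) (p x)) has_real_derivative inner (p x) (p' x) + inner (p' x) (p x)) (at x)"
      by (simp add: has_real_derivative_iff_has_vector_derivative)
    have "((\<lambda>x. (x / 2) * inner (p x) (p x)) has_real_derivative inner (p x) (r x) - c * inner (p x) (p x)) (at x)"
      by (rule derivative_eq_intros * refl | simp)+ (simp add: in_r c_def inner_commute algebra_simps)
    then show ?thesis
      by (simp add: has_real_derivative_iff_has_vector_derivative has_vector_derivative_at_within)
  qed
  then have "((\<lambda>x. inner (p x) (r x) - c * inner (p x) (p x)) has_integral
     (B / 2) * inner (p B) (p B) - (A / 2) * inner (p A) (p A)) {A..B}"
    by (rule fundamental_theorem_of_calculus[OF AB])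
  then have z: "((\<lambda>x. inner (p x) (r x) - c * inner (p x) (p x)) has_integral 0) {A..B}" using 0 by simp
  have i: "(\<lambda>x. c\<^sup>2 * (cmod (p x))\<^sup>2) integrable_on {A..B}" "(\<lambda>x. (cmod (r x))\<^sup>2) integrable_on {A..B}"
    by (intro integrable_continuous_real continuous_intros cp cr)+
  have "((\<lambda>x. c\<^sup>2 * (cmod (p x))\<^sup>2 + 2 * c * (inner (p x) (r x) - c * inner (p x) (p x)))
      has_integral integral {A..B} (\<lambda>x. c\<^sup>2 * (cmod (p x))\<^sup>2) + 2 * c * 0) {A..B}"
    by (intro has_integral_add has_integral_mult_right z integrable_integral i)
  moreover have "((\<lambda>x. (cmod (r x))\<^sup>2) has_integral integral {A..B} (\<lambda>x. (cmod (r x))\<^sup>2)) {A..B}"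
    by (intro integrable_integral i)
  moreover have "c\<^sup>2 * (cmod (p x))\<^sup>2 + 2 * c * (inner (p x) (r x) - c * inner (p x) (p x)) \<le> (cmod (r x))\<^sup>2" for x
  proof -
    have "0 \<le> inner (r x - c *\<^sub>R p x) (r x - c *\<^sub>R p x)" by simp
    also have "\<dots> = inner (r x) (r x) - 2 * c * inner (p x) (r x) + c\<^sup>2 * inner (p x) (p x)"
      by (simp add: inner_diff_left inner_diff_right inner_commute power2_eq_square algebra_simps)
    finally show ?thesis by (simp only: power2_norm_eq_inner) (simp add: power2_eq_square algebra_simps)
  qed
  ultimately have "integral {A..B} (\<lambda>x. c\<^sup>2 * (cmod (p x))\<^sup>2) + 2 * c * 0 \<le> integral {A..B} (\<lambda>x. (cmod (r x))\<^sup>2)"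
    by (rule has_integral_le)
  then show ?thesis by (simp add: c_def r_def)
qed

definition over_sq :: "(real \<Rightarrow> complex) \<Rightarrow> real \<Rightarrow> complex" where
  "over_sq \<phi> x = 1 / (complex_of_real x)\<^sup>2 * \<phi> x"

lemma over_sq_square_integrable: "\<phi> \<in> test_functions \<Longrightarrow> square_integrable (over_sq \<phi>)"
  unfolding over_sq_def by (rule test_square_integrable_mult) (auto intro!: continuous_intros)

lemma has_vector_derivative_inverse_real:
  assumes "x \<noteq> 0"
  shows "((\<lambda>x. 1 / complex_of_real x) has_vector_derivative - (1 / (complex_of_real x)\<^sup>2)) (at x)"
proof -
  have "((\<lambda>x. 1 / x) has_real_derivative - (1 / x\<^sup>2)) (at x)"
    using assms by (auto intro!: derivative_eq_intros simp: power2_eq_square)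
  from has_vector_derivative_of_real[OF this, where 'a = complex] show ?thesis by simp
qed

text \<open>For \<open>p = \<phi> / x\<^sup>2\<close> one has \<open>- L \<phi> = (x \<partial> + 3/2 + m) (x \<partial> + 3/2 - m) p\<close>.\<close>

lemma bessel_lower_bound:
  assumes \<phi>: "\<phi> \<in> test_functions" and m: "\<bar>Re m\<bar> < 1"
  shows "(1 - (Re m)\<^sup>2) * norm (abs_l2 (over_sq \<phi>))
    \<le> norm (- abs_l2 (vderiv (vderiv \<phi>)) + (m\<^sup>2 - 1/4) *\<^sub>C abs_l2 (over_sq \<phi>))"
proof -
  obtain A B where AB: "0 < A" "A < B" "\<And>x. x \<notin> {A<..<B} \<Longrightarrow> \<phi> x = 0"
    by (rule test_functions_support[OF \<phi>]) (rule that)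
  \<comment> \<open>Abbreviating 1/x by \<open>i\<close>, with derivative
    \<open>- (i x * i x)\<close>, turns the differentiations below into polynomial algebra.\<close>
  define i where "i x = 1 / complex_of_real x" for x
  define \<phi>1 where "\<phi>1 = vderiv \<phi>"
  define \<phi>2 where "\<phi>2 = vderiv \<phi>1"
  have out: "\<phi> x = 0 \<and> \<phi>1 x = 0 \<and> \<phi>2 x = 0" if x: "x \<notin> {A..B}" for x
  proof -
    have 1: "\<phi>1 y = 0" if "y \<in> - {A..B}" for y unfolding \<phi>1_def
      by (rule vderiv_eq_0[of "- {A..B}"]) (use that AB in auto)
    moreover have "\<phi>2 x = 0" unfolding \<phi>2_def
      by (rule vderiv_eq_0[of "- {A..B}"]) (use x 1 in auto)
    ultimately show ?thesis using x AB by auto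
  qed
  have t: "\<phi>1 \<in> test_functions" "\<phi>2 \<in> test_functions" unfolding \<phi>2_def \<phi>1_def by (intro test_vderiv \<phi>)+
  \<comment> \<open>Both applications of the Hardy inequality need zero boundary values. For
    \<open>\<phi>1\<close> they follow by continuity, since it vanishes outside the
    interval.\<close>
  have bd: "\<phi> A = 0" "\<phi> B = 0" "\<phi>1 A = 0" "\<phi>1 B = 0"
  proof -
    show "\<phi> A = 0" "\<phi> B = 0" using AB by auto
    have c: "continuous_on UNIV \<phi>1" by (rule test_continuous[OF t(1)])
    have "closed {x. \<phi>1 x = 0}" using c by (intro closed_Collect_eq continuous_intros)
    then have "closure (- {A..B}) \<subseteq> {x. \<phi>1 x = 0}" using out by (intro closure_minimal) auto
    moreover have "A \<in> closure (- {A..B})" "B \<in> closure (- {A..B})"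
      using AB by (auto simp: closure_complement interior_atLeastAtMost_real)
    ultimately show "\<phi>1 A = 0" "\<phi>1 B = 0" by auto
  qed
  have d: "(\<phi> has_vector_derivative \<phi>1 x) (at x)" "(\<phi>1 has_vector_derivative \<phi>2 x) (at x)" for x
    unfolding \<phi>2_def using \<phi> t test_has_vderiv by (auto simp: \<phi>1_def)
  define p where "p x = i x * (i x * \<phi> x)" for x
  define p' where "p' x = i x * (i x * \<phi>1 x + - (i x * i x) * \<phi> x) + - (i x * i x) * (i x * \<phi> x)" for x
  \<comment> \<open>The result of the inner factor: since x p' = phi'/x - 2 p, the function x p' +
    (3/2 - m) p equals phi'/x - (1/2 + m) p.\<close>
  define q where "q x = i x * \<phi>1 x - (1/2 + m) * p x" for x
  define q' where "q' x = i x * \<phi>2 x + - (i x * i x) * \<phi>1 x - (1/2 + m) * p' x" for x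
  define l where "l x = \<phi>2 x - (m\<^sup>2 - 1/4) * p x" for x
  have di: "(i has_vector_derivative - (i x * i x)) (at x)" if "x > 0" for x
    using has_vector_derivative_inverse_real[of x] that unfolding i_def by (simp add: power2_eq_square)
  have dp: "(p has_vector_derivative p' x) (at x)" if "x > 0" for x
    unfolding p_def p'_def by (intro has_vector_derivative_mult di d that)
  have dq: "(q has_vector_derivative q' x) (at x)" if "x > 0" for x
    unfolding q_def q'_def
    by (intro has_vector_derivative_diff has_vector_derivative_mult has_vector_derivative_mult_right di d dp that)
  have ci: "continuous_on {A..B} i" unfolding i_def using AB by (intro continuous_intros) auto
  have cts: "continuous_on {A..B} p" "continuous_on {A..B} p'" "continuous_on {A..B} q'" "continuous_on {A..B} l"
    unfolding l_def q'_def p'_def p_def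
    by (intro continuous_intros ci test_continuous[OF \<phi>] test_continuous[OF t(1)] test_continuous[OF t(2)])+
  have xi: "complex_of_real x * i x = 1" if "x > 0" for x using that by (simp add: i_def)
  have xp: "complex_of_real x * p' x + (3/2 - m) * p x = q x" if "x > 0" for x
  proof -
    have "complex_of_real x * p' x = (complex_of_real x * i x) * (i x * \<phi>1 x - 2 * p x)"
      by (simp add: p'_def p_def algebra_simps)
    then show ?thesis by (simp add: xi[OF that] q_def algebra_simps)
  qed
  have xq: "complex_of_real x * q' x + (3/2 + m) * q x = l x" if "x > 0" for x
  proof -
    have "complex_of_real x * p' x = q x - (3/2 - m) * p x" using xp[OF that] by (simp add: algebra_simps)
    moreover have "complex_of_real x * q' x = (complex_of_real x * i x) * (\<phi>2 x - i x * \<phi>1 x) - (1/2 + m) * (complex_of_real x * p' x)"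
      by (simp add: q'_def algebra_simps)
    moreover have "i x * \<phi>1 x = q x + (1/2 + m) * p x" by (simp add: q_def)
    ultimately show ?thesis
      by (simp add: xi[OF that] l_def power2_eq_square) (simp add: field_simps)
  qed
  let ?I = "\<lambda>u. integral {A..B} (\<lambda>x. (cmod (u x))\<^sup>2)"
  \<comment> \<open>The shift 3/2 - m yields the Hardy constant 1 - Re m, and the outer factor, with
    3/2 + m, yields 1 + Re m.\<close>
  have "(Re (3/2 - m) - 1/2)\<^sup>2 * ?I p \<le> ?I (\<lambda>x. complex_of_real x * p' x + (3/2 - m) * p x)"
    using AB cts by (intro hardy_euler_operator dp) (auto simp: p_def bd)
  also have "\<dots> = ?I q" by (rule integral_cong) (use AB xp in auto)
  finally have 1: "(1 - Re m)\<^sup>2 * ?I p \<le> ?I q" by simp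
  have "(Re (3/2 + m) - 1/2)\<^sup>2 * ?I q \<le> ?I (\<lambda>x. complex_of_real x * q' x + (3/2 + m) * q x)"
    using AB cts by (intro hardy_euler_operator dq) (auto simp: q_def p_def bd)
  also have "\<dots> = ?I l" by (rule integral_cong) (use AB xq in auto)
  finally have 2: "(1 + Re m)\<^sup>2 * ?I q \<le> ?I l" by simp
  have "(1 - (Re m)\<^sup>2)\<^sup>2 * ?I p = (1 + Re m)\<^sup>2 * ((1 - Re m)\<^sup>2 * ?I p)"
    by (simp add: power2_eq_square algebra_simps)
  also have "\<dots> \<le> (1 + Re m)\<^sup>2 * ?I q" using 1 by (intro mult_left_mono) auto
  finally have 3: "(1 - (Re m)\<^sup>2)\<^sup>2 * ?I p \<le> ?I l" using 2 by linarith
  have pz: "p x = 0 \<and> l x = 0" if "x \<notin> {A..B}" for x using out[OF that] by (simp add: l_def p_def)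
  have sp: "square_integrable p" "(\<integral>x. (cmod (p x))\<^sup>2 \<partial>Rplus) = ?I p"
    using square_integrable_support[OF cts(1) _ AB(1)] pz by auto
  have sl: "square_integrable l" "(\<integral>x. (cmod (l x))\<^sup>2 \<partial>Rplus) = ?I l"
    using square_integrable_support[OF cts(4) _ AB(1)] pz by auto
  have po: "over_sq \<phi> = p" by (auto simp: over_sq_def p_def i_def power2_eq_square)
  have "represents (\<lambda>x. - l x) (- abs_l2 l)" by (intro represents_uminus represents_abs sl)
  moreover have "represents (\<lambda>x. - \<phi>2 x + (m\<^sup>2 - 1/4) * p x) (- abs_l2 \<phi>2 + (m\<^sup>2 - 1/4) *\<^sub>C abs_l2 p)"
    by (intro represents_add represents_uminus represents_scaleC represents_abs sp test_square_integrable t)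
  moreover have "(\<lambda>x. - l x) = (\<lambda>x. - \<phi>2 x + (m\<^sup>2 - 1/4) * p x)" by (auto simp: l_def)
  ultimately have eq: "- abs_l2 \<phi>2 + (m\<^sup>2 - 1/4) *\<^sub>C abs_l2 p = - abs_l2 l"
    using represents_unique by metis
  have "((1 - (Re m)\<^sup>2) * norm (abs_l2 p))\<^sup>2 \<le> (norm (- abs_l2 \<phi>2 + (m\<^sup>2 - 1/4) *\<^sub>C abs_l2 p))\<^sup>2"
    using 3 sp sl unfolding eq norm_minus_cancel power_mult_distrib
    by (simp add: norm_represents_sq[OF represents_abs])
  then show ?thesis unfolding po \<phi>2_def \<phi>1_def by (rule power2_le_imp_le) simp
qed

section \<open>The minimal operators\<close>

definition bessel_core :: "(l2 \<times> l2 \<times> l2) set" where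
  "bessel_core = (\<lambda>\<phi>. (abs_l2 \<phi>, abs_l2 (vderiv (vderiv \<phi>)), abs_l2 (over_sq \<phi>))) ` test_functions"

definition bessel_map :: "complex \<Rightarrow> l2 \<times> l2 \<times> l2 \<Rightarrow> l2 \<times> l2" where
  "bessel_map \<alpha> = (\<lambda>(f, h, q). (f, - h + (\<alpha> - 1/4) *\<^sub>C q))"

section \<open>Linearity of the core\<close>

lemma vderiv_add:
  "\<phi> \<in> test_functions \<Longrightarrow> \<psi> \<in> test_functions \<Longrightarrow> vderiv (\<lambda>x. \<phi> x + \<psi> x) = (\<lambda>x. vderiv \<phi> x + vderiv \<psi> x)"
  by (intro ext vector_derivative_at has_vector_derivative_add test_has_vderiv)

lemma vderiv_cmult:
  "\<phi> \<in> test_functions \<Longrightarrow> vderiv (\<lambda>x. c * \<phi> x) = (\<lambda>x. c * vderiv \<phi> x)"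
  by (intro ext vector_derivative_at has_vector_derivative_mult_right test_has_vderiv)

lemma over_sq_add: "over_sq (\<lambda>x. \<phi> x + \<psi> x) = (\<lambda>x. over_sq \<phi> x + over_sq \<psi> x)"
  by (rule ext) (simp add: over_sq_def add_divide_distrib)

lemma over_sq_cmult: "over_sq (\<lambda>x. c * \<phi> x) = (\<lambda>x. c * over_sq \<phi> x)"
  by (rule ext) (simp add: over_sq_def)

lemma bessel_core_add:
  assumes "(f, h, q) \<in> bessel_core" "(f', h', q') \<in> bessel_core"
  shows "(f + f', h + h', q + q') \<in> bessel_core"
proof -
  obtain \<phi> where \<phi>: "\<phi> \<in> test_functions" "f = abs_l2 \<phi>" "h = abs_l2 (vderiv (vderiv \<phi>))" "q = abs_l2 (over_sq \<phi>)"
    using assms(1) by (auto simp: bessel_core_def)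
  obtain \<psi> where \<psi>: "\<psi> \<in> test_functions" "f' = abs_l2 \<psi>" "h' = abs_l2 (vderiv (vderiv \<psi>))" "q' = abs_l2 (over_sq \<psi>)"
    using assms(2) by (auto simp: bessel_core_def)
  have "(f + f', h + h', q + q') = (\<lambda>\<phi>. (abs_l2 \<phi>, abs_l2 (vderiv (vderiv \<phi>)), abs_l2 (over_sq \<phi>))) (\<lambda>x. \<phi> x + \<psi> x)"
    using \<phi> \<psi> by (simp add: vderiv_add test_vderiv over_sq_add abs_l2_add test_square_integrable over_sq_square_integrable)
  then show ?thesis unfolding bessel_core_def using test_add[OF \<phi>(1) \<psi>(1)] by blast
qed

lemma bessel_core_scaleC:
  assumes "(f, h, q) \<in> bessel_core"
  shows "(c *\<^sub>C f, c *\<^sub>C h, c *\<^sub>C q) \<in> bessel_core"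
proof -
  obtain \<phi> where \<phi>: "\<phi> \<in> test_functions" "f = abs_l2 \<phi>" "h = abs_l2 (vderiv (vderiv \<phi>))" "q = abs_l2 (over_sq \<phi>)"
    using assms(1) by (auto simp: bessel_core_def)
  have "(c *\<^sub>C f, c *\<^sub>C h, c *\<^sub>C q) = (\<lambda>\<phi>. (abs_l2 \<phi>, abs_l2 (vderiv (vderiv \<phi>)), abs_l2 (over_sq \<phi>))) (\<lambda>x. c * \<phi> x)"
    using \<phi> by (simp add: vderiv_cmult test_vderiv over_sq_cmult abs_l2_scaleC test_square_integrable over_sq_square_integrable)
  then show ?thesis unfolding bessel_core_def using test_cmult[OF \<phi>(1)] by blast
qed

lemma subspace_bessel_core: "subspace bessel_core"
  unfolding subspace_def
proof (intro conjI ballI allI)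
  have "over_sq (\<lambda>x. 0) = (\<lambda>x. 0)" by (auto simp: over_sq_def)
  moreover have "vderiv (\<lambda>x. 0) = (\<lambda>x. 0)" by auto
  ultimately have "(0 :: l2 \<times> l2 \<times> l2) = (abs_l2 (\<lambda>x. 0), abs_l2 (vderiv (vderiv (\<lambda>x. 0))), abs_l2 (over_sq (\<lambda>x. 0)))"
    by (simp only: abs_l2_zero) (simp add: zero_prod_def)
  then show "0 \<in> bessel_core" unfolding bessel_core_def using zero_test by blast
  fix x y :: "l2 \<times> l2 \<times> l2" assume x: "x \<in> bessel_core"
  obtain f h q where fhq: "x = (f, h, q)" by (cases x)
  show "r *\<^sub>R x \<in> bessel_core" for r
    using bessel_core_scaleC[of f h q "complex_of_real r"] x fhq by (simp add: scaleR_scaleC)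
  assume y: "y \<in> bessel_core"
  then show "x + y \<in> bessel_core"
    using bessel_core_add[of f h q "fst y" "fst (snd y)" "snd (snd y)"] x fhq
    by (cases y) auto
qed

lemma closure_bessel_core_scaleC:
  assumes "(f, h, q) \<in> closure bessel_core"
  shows "(c *\<^sub>C f, c *\<^sub>C h, c *\<^sub>C q) \<in> closure bessel_core"
proof -
  define T where "T = (\<lambda>x :: l2 \<times> l2 \<times> l2. (c *\<^sub>C fst x, c *\<^sub>C fst (snd x), c *\<^sub>C snd (snd x)))"
  have "T ` closure bessel_core \<subseteq> closure bessel_core"
  proof (rule image_closure_subset)
    show "continuous_on (closure bessel_core) T" unfolding T_def
      by (intro continuous_intros bounded_linear.continuous_on[OF bounded_linear_scaleC])
    show "T ` bessel_core \<subseteq> closure bessel_core"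
      using bessel_core_scaleC closure_subset by (fastforce simp: T_def)
  qed simp
  then show ?thesis using assms by (force simp: T_def)
qed

section \<open>Weak identities on the closure of the core\<close>

lemma bessel_distr_of:
  assumes "\<psi> \<in> test_functions"
  shows "bessel \<alpha> (distr_of f) \<psi> = - distr_of f (vderiv (vderiv \<psi>)) + (\<alpha> - 1/4) * distr_of f (over_sq \<psi>)"
  using distr_of_mult[of f "\<alpha> - 1/4" "over_sq \<psi>"]
  by (simp add: bessel_def distr_deriv_def distr_mult_def over_sq_def mult.assoc)

text \<open>Both operations are symmetric for the bilinear pairing. As no conjugation occurs, a
  complex \<alpha> is never replaced by its conjugate.\<close>

lemma test_integrals_swap:
  assumes "\<phi> \<in> test_functions" "\<psi> \<in> test_functions"
  shows "distr_of (abs_l2 \<phi>) (vderiv (vderiv \<psi>)) = distr_of (abs_l2 (vderiv (vderiv \<phi>))) \<psi>"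
    "distr_of (abs_l2 \<phi>) (over_sq \<psi>) = distr_of (abs_l2 (over_sq \<phi>)) \<psi>"
proof -
  note d = distr_of_represents[OF represents_abs]
  have "(\<integral>x. \<phi> x * vderiv (vderiv \<psi>) x \<partial>Rplus) = - (\<integral>x. vderiv \<phi> x * vderiv \<psi> x \<partial>Rplus)"
    by (intro test_by_parts test_has_vderiv test_continuous test_vderiv assms)
  also have "(\<integral>x. vderiv \<phi> x * vderiv \<psi> x \<partial>Rplus) = - (\<integral>x. vderiv (vderiv \<phi>) x * \<psi> x \<partial>Rplus)"
    by (intro test_by_parts test_has_vderiv test_continuous test_vderiv assms)
  finally show "distr_of (abs_l2 \<phi>) (vderiv (vderiv \<psi>)) = distr_of (abs_l2 (vderiv (vderiv \<phi>))) \<psi>"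
    using assms by (simp add: d test_square_integrable test_vderiv)
  show "distr_of (abs_l2 \<phi>) (over_sq \<psi>) = distr_of (abs_l2 (over_sq \<phi>)) \<psi>"
    using assms by (simp add: d test_square_integrable over_sq_square_integrable) (simp add: over_sq_def mult_ac)
qed

lemma closed_distr_of_eq:
  assumes "square_integrable \<phi>" "square_integrable \<psi>" "continuous_on UNIV F" "continuous_on UNIV G"
  shows "closed {x. distr_of (F x) \<phi> = distr_of (G x) \<psi>}"
  using assms(3,4)
  by (intro closed_Collect_eq bounded_linear.continuous_on[OF bounded_linear_distr_of[OF assms(1)]]
    bounded_linear.continuous_on[OF bounded_linear_distr_of[OF assms(2)]])

text \<open>For fixed \<open>\<psi>\<close> each identity is a closed condition on the triple and
  holds on the core. Consequently the first component of a triple determines the other two.\<close>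

lemma closure_bessel_core_weak:
  assumes "(f, h, q) \<in> closure bessel_core" and \<psi>: "\<psi> \<in> test_functions"
  shows "distr_of f (vderiv (vderiv \<psi>)) = distr_of h \<psi>" "distr_of f (over_sq \<psi>) = distr_of q \<psi>"
proof -
  have "closure bessel_core \<subseteq> {x. distr_of (fst x) (vderiv (vderiv \<psi>)) = distr_of (fst (snd x)) \<psi>}"
    by (rule closure_minimal)
       (auto simp: bessel_core_def test_integrals_swap \<psi> intro!: closed_distr_of_eq continuous_intros
         test_square_integrable test_vderiv)
  then show "distr_of f (vderiv (vderiv \<psi>)) = distr_of h \<psi>" using assms(1) by auto
  have "closure bessel_core \<subseteq> {x. distr_of (fst x) (over_sq \<psi>) = distr_of (snd (snd x)) \<psi>}"
    by (rule closure_minimal)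
       (auto simp: bessel_core_def test_integrals_swap \<psi> intro!: closed_distr_of_eq continuous_intros
         test_square_integrable over_sq_square_integrable)
  then show "distr_of f (over_sq \<psi>) = distr_of q \<psi>" using assms(1) by auto
qed

text \<open>Serves for candidates such as \<open>Uint h\<close> that are a priori only locally
  integrable; their square integrability comes out as a consequence.\<close>

lemma represents_locally:
  assumes "locally_integrable u"
    and "\<And>\<psi>. \<psi> \<in> test_functions \<Longrightarrow> distr_of f \<psi> = (\<integral>x. u x * \<psi> x \<partial>Rplus)"
  shows "represents u f"
proof -
  have r: "locally_integrable (rep_l2 f)"
    by (rule locally_integrable_square_integrable[OF l2_rep_square_integrable])
  have "AE x in Rplus. rep_l2 f x - u x = 0"
  proof (rule locally_integrable_eq_0)
    show "locally_integrable (\<lambda>x. rep_l2 f x - u x)"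
      by (rule locally_integrable_diff[OF r assms(1)])
    fix \<psi> assume \<psi>: "\<psi> \<in> test_functions"
    show "(\<integral>x. (rep_l2 f x - u x) * \<psi> x \<partial>Rplus) = 0"
      using assms(2)[OF \<psi>] test_integrable[OF r \<psi>] test_integrable[OF assms(1) \<psi>]
      by (simp add: left_diff_distrib distr_of_def)
  qed
  then show ?thesis by (simp add: represents_def)
qed

text \<open>Holds on the core by double integration and survives limits in the first two components;
  it supplies the C1 representative with vanishing value and derivative at 0.\<close>

lemma closure_bessel_core_Uint:
  assumes "(f, h, q) \<in> closure bessel_core"
  shows "represents (Uint h) f"
proof (rule represents_locally[OF locally_integrable_Uint])
  fix \<psi> assume \<psi>: "\<psi> \<in> test_functions"
  have "closure bessel_core \<subseteq> {x. distr_of (fst x) \<psi> = (\<integral>t. Uint (fst (snd x)) t * \<psi> t \<partial>Rplus)}"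
  proof (rule closure_minimal)
    show "closed {x :: l2 \<times> l2 \<times> l2. distr_of (fst x) \<psi> = (\<integral>t. Uint (fst (snd x)) t * \<psi> t \<partial>Rplus)}"
      by (intro closed_Collect_eq bounded_linear.continuous_on[OF bounded_linear_distr_of]
        bounded_linear.continuous_on[OF bounded_linear_Uint_integral] continuous_intros test_square_integrable \<psi>)
    show "bessel_core \<subseteq> {x. distr_of (fst x) \<psi> = (\<integral>t. Uint (fst (snd x)) t * \<psi> t \<partial>Rplus)}"
      by (auto simp: bessel_core_def Uint_vderiv2 distr_of_represents[OF represents_abs] test_square_integrable \<psi>)
  qed
  then show "distr_of f \<psi> = (\<integral>x. Uint h x * \<psi> x \<partial>Rplus)" using assms by auto
qed

lemma l2_eqI:
  assumes "\<And>\<phi>. \<phi> \<in> test_functions \<Longrightarrow> distr_of f \<phi> = distr_of g \<phi>"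
  shows "f = g"
proof -
  have "f - g = 0"
  proof (rule l2_eq_0I)
    fix \<phi> assume \<phi>: "\<phi> \<in> test_functions"
    show "distr_of (f - g) \<phi> = 0"
      using linear_diff[OF bounded_linear.linear[OF bounded_linear_distr_of[OF test_square_integrable[OF \<phi>]]], of f g]
        assms[OF \<phi>] by simp
  qed
  then show ?thesis by simp
qed

lemma closure_bessel_core_unique:
  assumes "(f, h, q) \<in> closure bessel_core" "(f, h', q') \<in> closure bessel_core"
  shows "h = h'" "q = q'"
  by (rule l2_eqI; metis closure_bessel_core_weak assms)+

lemma L_max_single_valued: "(f, g) \<in> L_max \<alpha> \<Longrightarrow> (f, g') \<in> L_max \<alpha> \<Longrightarrow> g = g'"
  unfolding L_max_def distr_eq_def by (rule l2_eqI) simp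

text \<open>Integration by parts puts the classical image of a test function into
  \<open>L_max\<close>, and single-valuedness excludes any other image.\<close>

lemma bessel_map_core:
  "{(f, g) \<in> L_max \<alpha>. \<exists>\<phi>\<in>test_functions. represents \<phi> f} = bessel_map \<alpha> ` bessel_core"
proof -
  define G where "G \<phi> = - abs_l2 (vderiv (vderiv \<phi>)) + (\<alpha> - 1/4) *\<^sub>C abs_l2 (over_sq \<phi>)" for \<phi>
  have max: "(abs_l2 \<phi>, G \<phi>) \<in> L_max \<alpha>" if \<phi>: "\<phi> \<in> test_functions" for \<phi>
    unfolding L_max_def distr_eq_def
  proof (clarsimp)
    fix \<psi> assume \<psi>: "\<psi> \<in> test_functions"
    note lin = bounded_linear.linear[OF bounded_linear_distr_of[OF test_square_integrable[OF \<psi>]]]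
    show "bessel \<alpha> (distr_of (abs_l2 \<phi>)) \<psi> = distr_of (G \<phi>) \<psi>"
      unfolding G_def bessel_distr_of[OF \<psi>] test_integrals_swap[OF \<phi> \<psi>] linear_add[OF lin] linear_neg[OF lin]
        distr_of_scaleC[OF test_square_integrable[OF \<psi>]] ..
  qed
  show ?thesis
  proof (intro equalityI subsetI)
    fix y assume "y \<in> {(f, g) \<in> L_max \<alpha>. \<exists>\<phi>\<in>test_functions. represents \<phi> f}"
    then obtain f g \<phi> where *: "y = (f, g)" "(f, g) \<in> L_max \<alpha>" "\<phi> \<in> test_functions" "represents \<phi> f" by blast
    then have f: "f = abs_l2 \<phi>" by (simp add: represents_iff_abs)
    then have "g = G \<phi>" using L_max_single_valued[OF _ max[OF *(3)]] *(2) by blast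
    then show "y \<in> bessel_map \<alpha> ` bessel_core"
      using f * by (auto simp: bessel_core_def bessel_map_def G_def image_iff)
  next
    fix y assume "y \<in> bessel_map \<alpha> ` bessel_core"
    then obtain \<phi> where \<phi>: "\<phi> \<in> test_functions" "y = (abs_l2 \<phi>, G \<phi>)"
      by (auto simp: bessel_core_def bessel_map_def G_def)
    then show "y \<in> {(f, g) \<in> L_max \<alpha>. \<exists>\<phi>\<in>test_functions. represents \<phi> f}"
      using max[OF \<phi>(1)] represents_abs[OF test_square_integrable[OF \<phi>(1)]] by auto
  qed
qed

lemma continuous_on_bessel_map: "continuous_on S (bessel_map \<alpha>)"
  unfolding bessel_map_def case_prod_unfold
  by (intro continuous_intros bounded_linear.continuous_on[OF bounded_linear_scaleC])

text \<open>The lower bound makes \<open>x\<^sup>-\<^sup>2 \<phi>\<^sub>n\<close> a Cauchy sequence as soon as \<open>L\<^sub>\<alpha> \<phi>\<^sub>n\<close> is one.\<close>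

lemma L_min_eq:
  assumes "\<bar>Re (csqrt \<alpha>)\<bar> < 1"
  shows "L_min \<alpha> = bessel_map \<alpha> ` closure bessel_core"
proof (rule antisym)
  show "bessel_map \<alpha> ` closure bessel_core \<subseteq> L_min \<alpha>"
    unfolding L_min_def bessel_map_core
    by (rule image_closure_subset[OF continuous_on_bessel_map closed_closure closure_subset])
  define c where "c = 1 - (Re (csqrt \<alpha>))\<^sup>2"
  have c: "c > 0" using assms by (simp add: c_def abs_square_less_1)
  have csq: "(csqrt \<alpha>)\<^sup>2 = \<alpha>" by simp
  have bound: "c * norm q \<le> norm (- h + (\<alpha> - 1/4) *\<^sub>C q)" if fhq: "(f, h, q) \<in> bessel_core" for f h q
  proof -
    obtain \<phi> where \<phi>: "\<phi> \<in> test_functions" "h = abs_l2 (vderiv (vderiv \<phi>))" "q = abs_l2 (over_sq \<phi>)"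
      using fhq by (auto simp: bessel_core_def)
    show ?thesis using bessel_lower_bound[OF \<phi>(1) assms] unfolding c_def csq \<phi>(2,3) .
  qed
  show "L_min \<alpha> \<subseteq> bessel_map \<alpha> ` closure bessel_core"
  proof
    fix y assume "y \<in> L_min \<alpha>"
    then obtain Y where Y: "\<And>n. Y n \<in> bessel_map \<alpha> ` bessel_core" "Y \<longlonglongrightarrow> y"
      by (auto simp: L_min_def bessel_map_core closure_sequential)
    have "\<exists>x\<in>bessel_core. Y n = bessel_map \<alpha> x" for n using Y(1)[of n] by blast
    then obtain X where X: "\<And>n. X n \<in> bessel_core" "\<And>n. Y n = bessel_map \<alpha> (X n)" by metis
    define f h q where "f n = fst (X n)" and "h n = fst (snd (X n))" and "q n = snd (snd (X n))" for n
    define g where "g n = - h n + (\<alpha> - 1/4) *\<^sub>C q n" for n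
    have Xn: "X n = (f n, h n, q n)" "Y n = (f n, g n)" for n
      by (simp_all add: X(2) bessel_map_def f_def h_def q_def g_def case_prod_unfold)
    have lim: "f \<longlonglongrightarrow> fst y" "g \<longlonglongrightarrow> snd y"
      using tendsto_fst[OF Y(2)] tendsto_snd[OF Y(2)] by (simp_all add: Xn)
    have q_le: "c * norm (q m - q n) \<le> norm (g m - g n)" for m n
    proof -
      have "(f m - f n, h m - h n, q m - q n) \<in> bessel_core"
        using subspace_diff[OF subspace_bessel_core X(1)[of m] X(1)[of n]] by (simp add: Xn)
      from bound[OF this] show ?thesis by (simp add: g_def scaleC_diff_right algebra_simps)
    qed
    have "Cauchy g" using lim(2) by (rule LIMSEQ_imp_Cauchy)
    have "Cauchy q"
    proof (rule CauchyI)
      fix e :: real assume "e > 0"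
      then have "c * e > 0" using c by simp
      then obtain M where "\<And>m n. m \<ge> M \<Longrightarrow> n \<ge> M \<Longrightarrow> norm (g m - g n) < c * e"
        using CauchyD[OF \<open>Cauchy g\<close>] by blast
      then have "norm (q m - q n) < e" if "m \<ge> M" "n \<ge> M" for m n
        using q_le[of m n] that c by (meson mult_less_cancel_left_pos order_le_less_trans)
      then show "\<exists>M. \<forall>m\<ge>M. \<forall>n\<ge>M. norm (q m - q n) < e" by blast
    qed
    then obtain q0 where q0: "q \<longlonglongrightarrow> q0" using Cauchy_convergent_iff convergent_def by blast
    \<comment> \<open>The second derivatives are the difference of the potential term and the
      operator values, and both now converge.\<close>
    have "(\<lambda>n. (\<alpha> - 1/4) *\<^sub>C q n - g n) \<longlonglongrightarrow> (\<alpha> - 1/4) *\<^sub>C q0 - snd y"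
      by (intro tendsto_diff bounded_linear.tendsto[OF bounded_linear_scaleC] q0 lim)
    then have "h \<longlonglongrightarrow> (\<alpha> - 1/4) *\<^sub>C q0 - snd y" by (simp add: g_def)
    then have "(\<lambda>n. (f n, h n, q n)) \<longlonglongrightarrow> (fst y, (\<alpha> - 1/4) *\<^sub>C q0 - snd y, q0)"
      by (intro tendsto_Pair lim q0)
    then have "X \<longlonglongrightarrow> (fst y, (\<alpha> - 1/4) *\<^sub>C q0 - snd y, q0)"
      by (simp add: Xn(1)[symmetric])
    then have "(fst y, (\<alpha> - 1/4) *\<^sub>C q0 - snd y, q0) \<in> closure bessel_core"
      unfolding closure_sequential using X(1) by blast
    moreover have "y = bessel_map \<alpha> (fst y, (\<alpha> - 1/4) *\<^sub>C q0 - snd y, q0)"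
      by (simp add: bessel_map_def)
    ultimately show "y \<in> bessel_map \<alpha> ` closure bessel_core" by blast
  qed
qed

section \<open>The common domain\<close>

lemma DERIV_nonneg_mono_Ioi:
  fixes f f' :: "real \<Rightarrow> real"
  assumes "\<And>t. t > 0 \<Longrightarrow> (f has_real_derivative f' t) (at t)" "\<And>t. t > 0 \<Longrightarrow> f' t \<ge> 0"
    and "0 < x" "x \<le> y"
  shows "f x \<le> f y"
proof (rule DERIV_nonneg_imp_nondecreasing[OF assms(4)])
  fix t assume "x \<le> t" "t \<le> y"
  then have "t > 0" using assms(3) by simp
  then show "\<exists>q. (f has_real_derivative q) (at t) \<and> 0 \<le> q" using assms(1,2) by blast
qed

text \<open>\<open>P\<close> is nonincreasing, since otherwise \<open>E\<close> would grow quadratically by convexity of \<open>P\<close>. If \<open>E\<close> were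
  positive somewhere, integrating \<open>E \<le> P / 2 + P'' / 4\<close> would make \<open>E / 2 + P' / 4\<close> grow linearly.\<close>

lemma bounded_convex_energy_zero:
  fixes E P P1 P2 :: "real \<Rightarrow> real"
  assumes E: "\<And>x. x > 0 \<Longrightarrow> (E has_real_derivative P x) (at x)"
    and P: "\<And>x. x > 0 \<Longrightarrow> (P has_real_derivative P1 x) (at x)"
    and P1: "\<And>x. x > 0 \<Longrightarrow> (P1 has_real_derivative P2 x) (at x)"
    and pos: "\<And>x. x > 0 \<Longrightarrow> P x \<ge> 0" "\<And>x. x > 0 \<Longrightarrow> P2 x \<ge> 0"
    and le: "\<And>x. x > 0 \<Longrightarrow> E x \<le> P x / 2 + P2 x / 4"
    and bdd: "\<And>x. x > 0 \<Longrightarrow> E x \<le> C"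
    and lim: "(E \<longlongrightarrow> 0) (at_right 0)"
    and x: "x > 0"
  shows "P x = 0"
proof -
  have Emono: "E x \<le> E y" if "0 < x" "x \<le> y" for x y
    using DERIV_nonneg_mono_Ioi[of E P, OF E pos(1) that] .
  have P1mono: "P1 x \<le> P1 y" if "0 < x" "x \<le> y" for x y
    using DERIV_nonneg_mono_Ioi[of P1 P2, OF P1 pos(2) that] .
  have P1neg: "P1 y \<le> 0" if y: "y > 0" for y
  proof (rule ccontr)
    assume "\<not> P1 y \<le> 0"
    then have d: "P1 y > 0" by simp
    have Pge: "P y + P1 y * (z - y) \<le> P z" if z: "z \<ge> y" for z
    proof -
      have "P y - P1 y * (y - y) \<le> P z - P1 y * (z - y)"
      proof (rule DERIV_nonneg_imp_nondecreasing[OF z])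
        fix t assume t: "y \<le> t" "t \<le> z"
        have "((\<lambda>s. P s - P1 y * (s - y)) has_real_derivative P1 t - P1 y) (at t)"
          using P[of t] t y by (auto intro!: derivative_eq_intros)
        then show "\<exists>q. ((\<lambda>s. P s - P1 y * (s - y)) has_real_derivative q) (at t) \<and> 0 \<le> q"
          using P1mono[OF y t(1)] by auto
      qed
      then show ?thesis by simp
    qed
    have Ege: "E y + P1 y * (z - y)\<^sup>2 / 2 \<le> E z" if z: "z \<ge> y" for z
    proof -
      have "E y - P1 y * (y - y)\<^sup>2 / 2 \<le> E z - P1 y * (z - y)\<^sup>2 / 2"
      proof (rule DERIV_nonneg_imp_nondecreasing[OF z])
        fix t assume t: "y \<le> t" "t \<le> z"
        have "((\<lambda>s. E s - P1 y * (s - y)\<^sup>2 / 2) has_real_derivative P t - P1 y * (t - y)) (at t)"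
          using E[of t] t y by (auto intro!: derivative_eq_intros)
        then show "\<exists>q. ((\<lambda>s. E s - P1 y * (s - y)\<^sup>2 / 2) has_real_derivative q) (at t) \<and> 0 \<le> q"
          using Pge[OF t(1)] pos(1)[OF y] by force
      qed
      then show ?thesis by simp
    qed
    \<comment> \<open>Large enough for the quadratic lower bound at \<open>y + r\<close> to exceed
      \<open>C\<close>; the final summand 1 ensures \<open>r \<ge> 1\<close>, so that r is at most
      its square.\<close>
    define r where "r = 2 * (\<bar>C\<bar> + \<bar>E y\<bar> + 1) / P1 y + 1"
    have r1: "r \<ge> 1" using d by (simp add: r_def)
    then have "r \<le> r\<^sup>2" by (simp add: power2_eq_square)
    then have "P1 y * r \<le> P1 y * r\<^sup>2" using d by simp
    moreover have "P1 y * r = 2 * (\<bar>C\<bar> + \<bar>E y\<bar> + 1) + P1 y" using d by (simp add: r_def field_simps)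
    ultimately have "\<bar>C\<bar> + \<bar>E y\<bar> + 1 < P1 y * r\<^sup>2 / 2" using d by simp
    then show False using Ege[of "y + r"] bdd[of "y + r"] y r1 by simp
  qed
  have Eneg: "E y \<le> 0" if y: "y > 0" for y
  proof (rule ccontr)
    assume "\<not> E y \<le> 0"
    then have d: "E y > 0" by simp
    have ge: "E y / 2 + P1 y / 4 + E y * (z - y) \<le> E z / 2 + P1 z / 4" if z: "z \<ge> y" for z
    proof -
      have "E y / 2 + P1 y / 4 - E y * (y - y) \<le> E z / 2 + P1 z / 4 - E y * (z - y)"
      proof (rule DERIV_nonneg_imp_nondecreasing[OF z])
        fix t assume t: "y \<le> t" "t \<le> z"
        have "((\<lambda>s. E s / 2 + P1 s / 4 - E y * (s - y)) has_real_derivative P t / 2 + P2 t / 4 - E y) (at t)"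
          using E[of t] P1[of t] t y by (auto intro!: derivative_eq_intros)
        then show "\<exists>q. ((\<lambda>s. E s / 2 + P1 s / 4 - E y * (s - y)) has_real_derivative q) (at t) \<and> 0 \<le> q"
          using Emono[OF y t(1)] le[of t] t y by force
      qed
      then show ?thesis by simp
    qed
    \<comment> \<open>At distance \<open>r\<close> the linear growth exceeds |C| + |P1 y|, whereas
      \<open>E / 2 + P1 / 4\<close> is at most \<open>C / 2\<close> there because \<open>P1\<close>
      is nonpositive.\<close>
    define r where "r = (\<bar>C\<bar> + \<bar>P1 y\<bar> + 1) / E y"
    have r1: "r > 0" using d by (auto simp: r_def intro!: divide_pos_pos)
    have "E y * r = \<bar>C\<bar> + \<bar>P1 y\<bar> + 1" using d by (simp add: r_def)
    then show False using ge[of "y + r"] bdd[of "y + r"] P1neg[of "y + r"] y r1 d by (simp add: abs_if split: if_splits)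
  qed
  \<comment> \<open>\<open>E\<close> is nondecreasing, so its limit 0 at the origin bounds it from
    below.\<close>
  have Epos: "E y \<ge> 0" if y: "y > 0" for y
  proof (rule tendsto_upperbound[OF lim])
    show "\<forall>\<^sub>F s in at_right 0. E s \<le> E y"
      unfolding eventually_at_right_field using y Emono by (intro exI[of _ y]) auto
  qed simp
  have E0: "E y = 0" if "y > 0" for y using Eneg[OF that] Epos[OF that] by simp
  have "(E has_real_derivative 0) (at x)"
  proof (rule has_field_derivative_transform_within_open[of "\<lambda>_. 0" 0 x "{0<..}" E])
  qed (use x E0 in auto)
  then show ?thesis using E[OF x] DERIV_unique by blast
qed

text \<open>The set where \<open>f\<close> is nonzero is open, and a nonempty open set is not
  negligible.\<close>

lemma AE_continuous_imp_eq_0: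
  fixes f :: "real \<Rightarrow> complex"
  assumes c: "continuous_on {0<..} f" and ae: "AE x in Rplus. f x = 0" and x: "x > 0"
  shows "f x = 0"
proof (rule ccontr)
  assume nz: "f x \<noteq> 0"
  define S where "S = {0<..} \<inter> f -` (- {0})"
  have S: "open S" unfolding S_def by (intro continuous_open_preimage c) auto
  have "AE x in lebesgue. \<not> x \<in> S"
    using ae unfolding S_def by (subst (asm) AE_restrict_space_iff) auto
  then have "{x \<in> space lebesgue. \<not> \<not> x \<in> S} \<in> null_sets lebesgue"
    using S by (subst AE_iff_null[symmetric]) auto
  then have "negligible S" by (simp add: negligible_iff_null_sets)
  then show False using open_not_negligible[OF S] x nz by (auto simp: S_def)
qed

text \<open>The C1 representative and \<open>Uint h\<close> have the same weak second derivative, so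
  they differ by an affine function, almost everywhere and then everywhere by continuity. The value
  at 0 removes its constant term and the one-sided derivative at 0 its slope.\<close>

lemma H2_0_represents_Uint:
  assumes "f \<in> H2_0"
  obtains h where "represents (Uint h) f"
proof -
  obtain h u u' where h: "distr_eq (distr_deriv (distr_deriv (distr_of f))) (distr_of h)"
    and u: "represents u f" and u': "\<And>x. x \<ge> 0 \<Longrightarrow> (u has_vector_derivative u' x) (at x within {0..})"
    and 0: "u 0 = 0" "u' 0 = 0"
    using assms by (auto simp: H2_0_def H2_def)
  define z where "z x = u x - Uint h x" for x
  have cu: "continuous_on {0..} u"
    using u' by (auto simp: continuous_on_eq_continuous_within intro: has_vector_derivative_continuous)
  have cz: "continuous_on {0..} z" unfolding z_def
    by (intro continuous_intros cu continuous_at_imp_continuous_on ballI Uint_continuous)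
  have cz': "continuous_on {0<..} z" by (rule continuous_on_subset[OF cz]) auto
  have "(\<integral>x. z x * vderiv (vderiv \<psi>) x \<partial>Rplus) = 0" if \<psi>: "\<psi> \<in> test_functions" for \<psi>
  proof -
    have t: "vderiv (vderiv \<psi>) \<in> test_functions" by (intro test_vderiv \<psi>)
    have "(\<integral>x. u x * vderiv (vderiv \<psi>) x \<partial>Rplus) = distr_of f (vderiv (vderiv \<psi>))"
      by (rule distr_of_represents[OF u test_square_integrable[OF t], symmetric])
    also have "\<dots> = distr_of h \<psi>"
      using h \<psi> by (simp add: distr_eq_def distr_deriv_def)
    also have "\<dots> = (\<integral>x. Uint h x * vderiv (vderiv \<psi>) x \<partial>Rplus)"
      by (rule Uint_weak_deriv[OF \<psi>, symmetric])
    finally show ?thesis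
      using test_integrable[OF locally_integrable_Uint t]
        test_integrable[OF locally_integrable_square_integrable[OF represents_square_integrable[OF u]] t]
      by (simp add: z_def left_diff_distrib)
  qed
  then obtain c d where cd: "AE x in Rplus. z x = c + d * complex_of_real x"
    using weak_deriv2_zero_affine[OF locally_integrable_continuous[OF cz']] by blast
  have z: "z x = c + d * complex_of_real x" if "x > 0" for x
  proof -
    have "z x - (c + d * complex_of_real x) = 0"
    proof (rule AE_continuous_imp_eq_0[OF _ _ that])
      show "continuous_on {0<..} (\<lambda>x. z x - (c + d * complex_of_real x))"
        by (intro continuous_intros cz')
      show "AE x in Rplus. z x - (c + d * complex_of_real x) = 0" using cd by auto
    qed
    then show ?thesis by simp
  qed
  have z0: "z 0 = 0" by (simp add: z_def 0 Uint_nonpos)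
  have "(z \<longlongrightarrow> z 0) (at 0 within {0..})"
    using cz unfolding continuous_on_def by auto
  then have "(z \<longlongrightarrow> z 0) (at_right 0)" by (rule tendsto_within_subset) auto
  moreover have "((\<lambda>x. c + d * complex_of_real x) \<longlongrightarrow> c + d * complex_of_real 0) (at_right 0)"
    by (intro tendsto_intros)
  then have "((\<lambda>x. c + d * complex_of_real x) \<longlongrightarrow> c) (at_right 0)" by simp
  then have "(z \<longlongrightarrow> c) (at_right 0)"
    by (rule Lim_transform_eventually) (auto simp: eventually_at_right_field z intro!: exI[of _ 1])
  ultimately have c: "c = 0" using z0 tendsto_unique trivial_limit_at_right_real by metis
  have "(z has_vector_derivative u' 0 - Vint h 0) (at 0 within {0..})"
    unfolding z_def by (intro has_vector_derivative_diff u' has_vector_derivative_at_within[OF Uint_deriv]) simp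
  then have "(z has_vector_derivative 0) (at 0 within {0..})" by (simp add: 0 Vint_nonpos)
  moreover have "((\<lambda>x. d * complex_of_real x) has_vector_derivative d) (at 0 within {0..})"
    using has_vector_derivative_mult_right[OF has_vector_derivative_of_real[OF DERIV_ident], of d "at 0 within {0..}"]
    by simp
  then have "(z has_vector_derivative d) (at 0 within {0..})"
    by (rule has_vector_derivative_transform[rotated 2]) (use z z0 c in \<open>force simp: le_less\<close>)+
  moreover have "at (0::real) within {0..} \<noteq> bot"
    using at_le[of "{0<..}" "{0..}" "0::real"] trivial_limit_at_right_real[of 0]
    by (auto simp: bot_unique subset_iff)
  ultimately have d: "d = 0" using vector_derivative_unique_within by blast
  have "AE x in Rplus. u x = Uint h x"
    using cd by eventually_elim (simp add: c d z_def)
  then have "represents (Uint h) f" using represents_AE_iff[OF u] by blast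
  then show thesis by (rule that)
qed

lemma csqrt_quarter: "\<bar>Re (csqrt (1/4))\<bar> < 1"
proof -
  have "csqrt (complex_of_real (1/4)) = complex_of_real (sqrt (1/4))" by (rule csqrt_of_real) simp
  then have "csqrt (1/4) = complex_of_real (sqrt (1/4))" by simp
  then show ?thesis by (simp add: real_sqrt_divide)
qed

text \<open>With \<open>v'' = w\<close> and \<open>w'' = -v\<close>, the quantity \<open>E = Re (w cnj v' - w' cnj v)\<close> has derivative
  \<open>P = |v|\<^sup>2 + |w|\<^sup>2\<close>, which is integrable, and \<open>P'' = 2 (|v'|\<^sup>2 + |w'|\<^sup>2)\<close>.\<close>

lemma Uint_weak_system_zero:
  assumes v: "represents (Uint w) v"
    and weak: "\<And>\<psi>. \<psi> \<in> test_functions \<Longrightarrow> distr_of w (vderiv (vderiv \<psi>)) = - distr_of v \<psi>"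
  shows "v = 0"
proof -
  have lw: "locally_integrable (rep_l2 w)"
    by (rule locally_integrable_square_integrable[OF l2_rep_square_integrable])
  have "\<exists>c d. AE x in Rplus. rep_l2 w x + Uint v x = c + d * complex_of_real x"
  proof (rule weak_deriv2_zero_affine)
    show "locally_integrable (\<lambda>x. rep_l2 w x + Uint v x)"
      by (intro locally_integrable_add lw locally_integrable_Uint)
    fix \<psi> assume \<psi>: "\<psi> \<in> test_functions"
    have t: "vderiv (vderiv \<psi>) \<in> test_functions" by (intro test_vderiv \<psi>)
    show "(\<integral>x. (rep_l2 w x + Uint v x) * vderiv (vderiv \<psi>) x \<partial>Rplus) = 0"
      using weak[OF \<psi>] Uint_weak_deriv[OF \<psi>, of v] test_integrable[OF lw t] test_integrable[OF locally_integrable_Uint t]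
      by (simp add: distrib_right distr_of_def)
  qed
  then obtain c d where cd: "AE x in Rplus. rep_l2 w x + Uint v x = c + d * complex_of_real x" by blast
  define a where "a = Uint w"
  define a1 where "a1 = Vint w"
  \<comment> \<open>The regular representative of \<open>w\<close>: since w'' = -v weakly, w plus
    the double antiderivative of v is affine. Its coefficients remain unknown, as \<open>w\<close>
    obeys no condition at 0.\<close>
  define b where "b x = c + d * complex_of_real x - Uint v x" for x
  define b1 where "b1 x = d - Vint v x" for x
  have w: "represents b w"
    unfolding represents_def using cd by eventually_elim (simp add: b_def eq_diff_eq)
  have da: "(a has_vector_derivative a1 x) (at x)" for x unfolding a_def a1_def by (rule Uint_deriv)
  have db: "(b has_vector_derivative b1 x) (at x)" for x
  proof -
    have "(complex_of_real has_vector_derivative complex_of_real 1) (at x)"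
      by (rule has_vector_derivative_of_real[OF DERIV_ident])
    then have "((\<lambda>x. c + d * complex_of_real x - Uint v x) has_vector_derivative 0 + d * complex_of_real 1 - Vint v x) (at x)"
      by (intro has_vector_derivative_diff has_vector_derivative_add has_vector_derivative_const
          has_vector_derivative_mult_right Uint_deriv)
    then show ?thesis by (simp add: b_def[abs_def] b1_def)
  qed
  have cb: "continuous_on S b" for S
    using db by (intro continuous_at_imp_continuous_on ballI has_vector_derivative_continuous) auto
  have ca: "continuous_on S a" for S
    using da by (intro continuous_at_imp_continuous_on ballI has_vector_derivative_continuous) auto
  have da1: "(a1 has_vector_derivative b x) (at x)" if "x > 0" for x
    unfolding a1_def by (rule Vint_deriv[OF w cb that])
  have db1: "(b1 has_vector_derivative - a x) (at x)" if "x > 0" for x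
    using has_vector_derivative_diff[OF has_vector_derivative_const Vint_deriv[OF v ca[unfolded a_def] that], of d]
    by (simp add: b1_def[abs_def] a_def)
  have ca1: "continuous_on S a1" for S unfolding a1_def
    by (intro continuous_at_imp_continuous_on ballI Vint_continuous)
  have cb1: "continuous_on S b1" for S unfolding b1_def
    by (intro continuous_intros continuous_at_imp_continuous_on ballI Vint_continuous)
  define E where "E x = inner (b x) (a1 x) - inner (b1 x) (a x)" for x
  define P where "P x = (cmod (a x))\<^sup>2 + (cmod (b x))\<^sup>2" for x
  define P1 where "P1 x = 2 * (inner (a x) (a1 x) + inner (b x) (b1 x))" for x
  define P2 where "P2 x = 2 * (inner (a1 x) (a1 x) + inner (b1 x) (b1 x))" for x
  have inner_deriv: "((\<lambda>x. inner (f x) (g x)) has_real_derivative inner (f x) g' + inner f' (g x)) (at x)"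
    if "(f has_vector_derivative f') (at x)" "(g has_vector_derivative g') (at x)"
    for f g :: "real \<Rightarrow> complex" and f' g' x
    using bounded_bilinear.has_vector_derivative[OF bounded_bilinear_inner that]
    by (simp add: has_real_derivative_iff_has_vector_derivative)
  have dE: "(E has_real_derivative P x) (at x)" if "x > 0" for x
  proof -
    have "(E has_real_derivative (inner (b x) (b x) + inner (b1 x) (a1 x)) - (inner (b1 x) (a1 x) + inner (- a x) (a x))) (at x)"
      unfolding E_def by (intro DERIV_diff inner_deriv da db da1 db1 that)
    then show ?thesis by (simp add: P_def power2_norm_eq_inner add.commute)
  qed
  have Pin: "P = (\<lambda>x. inner (a x) (a x) + inner (b x) (b x))"
    by (simp add: P_def[abs_def] power2_norm_eq_inner)
  have dP: "(P has_real_derivative P1 x) (at x)" for x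
  proof -
    have "(P has_real_derivative (inner (a x) (a1 x) + inner (a1 x) (a x)) + (inner (b x) (b1 x) + inner (b1 x) (b x))) (at x)"
      unfolding Pin by (intro DERIV_add inner_deriv da db)
    then show ?thesis by (simp add: P1_def inner_commute)
  qed
  \<comment> \<open>The terms with \<open>inner (a x) (b x)\<close> cancel because v'' = w and w'' =
    -v carry opposite signs; this is what makes \<open>P\<close> convex.\<close>
  have dP1: "(P1 has_real_derivative P2 x) (at x)" if "x > 0" for x
  proof -
    have "(P1 has_real_derivative 2 * ((inner (a x) (b x) + inner (a1 x) (a1 x)) + (inner (b x) (- a x) + inner (b1 x) (b1 x)))) (at x)"
      unfolding P1_def by (intro DERIV_cmult DERIV_add inner_deriv da db da1 db1 that)
    then show ?thesis by (simp add: P2_def inner_commute)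
  qed
  have two: "2 * inner y z \<le> inner y y + inner z z" "- (2 * inner y z) \<le> inner y y + inner z z" for y z :: complex
    using inner_ge_zero[of "y - z"] inner_ge_zero[of "y + z"]
    by (simp_all add: inner_diff_left inner_diff_right inner_add_left inner_add_right inner_commute del: inner_ge_zero)
  \<comment> \<open>Each of the two products in \<open>E\<close> is split by 2 y z \<le> y^2 + z^2,
    and the four squares add up to P/2 + P''/4.\<close>
  have le: "E x \<le> P x / 2 + P2 x / 4" for x
    using two(1)[of "b x" "a1 x"] two(2)[of "b1 x" "a x"] by (simp add: E_def Pin P2_def field_simps)
  have cE: "continuous_on S E" for S unfolding E_def by (intro continuous_intros ca ca1 cb cb1)
  \<comment> \<open>Each term contains v or v', which vanish at 0, whatever the values of
    \<open>b\<close> and \<open>b1\<close> there.\<close>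
  have E0: "E 0 = 0" by (simp add: E_def a_def a1_def Uint_nonpos Vint_nonpos)
  have iP: "integrable Rplus P"
    unfolding P_def using represents_square_integrable[OF v] represents_square_integrable[OF w]
    by (simp add: a_def square_integrable_def)
  have Ppos: "P x \<ge> 0" for x by (simp add: P_def)
  \<comment> \<open>\<open>P\<close> is nonnegative and integrable because \<open>a\<close> and
    \<open>b\<close> represent L2 elements; its total integral bounds \<open>E\<close>, which starts
    from 0.\<close>
  have bdd: "E x \<le> integral {0<..} P" if x: "x > 0" for x
  proof -
    have "(P has_integral E x - E 0) {0..x}"
    proof (rule fundamental_theorem_of_calculus_interior)
      show "(E has_vector_derivative P y) (at y)" if "y \<in> {0<..<x}" for y
        using dE[of y] that by (simp add: has_real_derivative_iff_has_vector_derivative)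
    qed (use x cE in auto)
    then have "(P has_integral E x) {0<..x}"
      unfolding E0 by (subst has_integral_spike_set_eq[where T = "{0..x}"])
        (auto intro: negligible_subset[of "{0}"])
    moreover have "(P has_integral integral {0<..} P) {0<..}"
      using integrable_on_lebesgue_on[OF iP] by (intro integrable_integral) auto
    ultimately show ?thesis
      by (rule has_integral_subset_le[rotated]) (use Ppos in auto)
  qed
  have lim: "(E \<longlongrightarrow> 0) (at_right 0)"
  proof -
    have "(E \<longlongrightarrow> E 0) (at 0 within {0..})"
      using cE[of "{0..}"] unfolding continuous_on_def by auto
    then have "(E \<longlongrightarrow> E 0) (at_right 0)" by (rule tendsto_within_subset) auto
    then show ?thesis by (simp add: E0)
  qed
  have "P x = 0" if "x > 0" for x
    by (rule bounded_convex_energy_zero[OF dE dP dP1 Ppos _ le bdd lim that]) (auto simp: P2_def)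
  then have "a x = 0" if "x > 0" for x
    using that by (auto simp: P_def add_nonneg_eq_0_iff)
  then have "AE x in Rplus. a x = 0" by (intro AE_I2) auto
  then have "represents (\<lambda>x. 0) v" using represents_AE_iff[OF v, of "\<lambda>x. 0"] by (simp add: a_def)
  then show ?thesis using represents_iff_abs abs_l2_zero by metis
qed

lemma vderiv_cnj:
  "\<phi> \<in> test_functions \<Longrightarrow> vderiv (\<lambda>x. cnj (\<phi> x)) = (\<lambda>x. cnj (vderiv \<phi> x))"
  by (intro ext vector_derivative_at has_vector_derivative_cnj test_has_vderiv)

text \<open>Only the orthogonal projection onto the closed graph at \<open>\<alpha> = 1/4\<close>, where the potential vanishes, is needed.\<close>

lemma H2_0_subset_core: "H2_0 \<subseteq> fst ` closure bessel_core"
proof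
  fix f assume "f \<in> H2_0"
  then obtain h where h: "represents (Uint h) f" by (rule H2_0_represents_Uint)
  let ?L = "L_min (1/4)"
  have L: "?L = bessel_map (1/4) ` closure bessel_core" by (rule L_min_eq[OF csqrt_quarter])
  have map: "bessel_map (1/4) x = (fst x, - fst (snd x))" for x
    by (simp add: bessel_map_def case_prod_unfold scaleC_zero_left)
  have "linear (\<lambda>x :: l2 \<times> l2 \<times> l2. (fst x, - fst (snd x)))"
    by (intro linearI) auto
  then have "subspace ?L"
    unfolding L map by (intro linear_subspace_image subspace_closure subspace_bessel_core)
  moreover have "closed ?L" by (simp add: L_min_def)
  \<comment> \<open>The projected pair consists of \<open>f\<close> and -f'', which is what the
    differential expression gives at \<alpha> = 1/4.\<close>
  ultimately obtain y where y: "y \<in> ?L" "\<And>s. s \<in> ?L \<Longrightarrow> inner ((f, - h) - y) s = 0"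
    using closed_subspace_projection[of ?L "(f, - h)"] by blast
  then obtain p h0 q0 where p: "(p, h0, q0) \<in> closure bessel_core" "y = (p, - h0)"
    unfolding L map by auto
  define v where "v = f - p"
  define w where "w = h - h0"
  have v: "represents (Uint w) v"
  proof -
    have "represents (\<lambda>x. Uint h x - Uint h0 x) v" unfolding v_def
      by (intro represents_diff h closure_bessel_core_Uint[OF p(1)])
    moreover have "Uint h x - Uint h0 x = Uint w x" for x
      using linear_diff[OF bounded_linear.linear[OF bounded_linear_Uint[of x]]] by (simp add: w_def)
    ultimately show ?thesis by simp
  qed
  \<comment> \<open>Testing the residual against the graph of -phi'' yields w'' = -v in the weak
    sense; the two minus signs cancel in the second inner product.\<close>
  have orth: "inner v (abs_l2 \<phi>) + inner w (abs_l2 (vderiv (vderiv \<phi>))) = 0" if "\<phi> \<in> test_functions" for \<phi>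
  proof -
    have "(abs_l2 \<phi>, abs_l2 (vderiv (vderiv \<phi>)), abs_l2 (over_sq \<phi>)) \<in> closure bessel_core"
      using closure_subset[of bessel_core] that by (auto simp: bessel_core_def)
    then have "(abs_l2 \<phi>, - abs_l2 (vderiv (vderiv \<phi>))) \<in> ?L"
      unfolding L map by force
    from y(2)[OF this] show ?thesis by (simp add: p v_def w_def inner_diff_left)
  qed
  have "v = 0"
  proof (rule Uint_weak_system_zero[OF v])
    fix \<psi> assume \<psi>: "\<psi> \<in> test_functions"
    have t: "vderiv (vderiv \<psi>) \<in> test_functions" by (intro test_vderiv \<psi>)
    \<comment> \<open>Real orthogonality against the conjugate of \<open>\<psi>\<close> and against
      i times it recovers the real and imaginary parts of the bilinear pairing.\<close>
    define \<phi> where "\<phi> = (\<lambda>x. cnj (\<psi> x))"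
    have \<phi>: "\<phi> \<in> test_functions" unfolding \<phi>_def by (rule test_cnj[OF \<psi>])
    have d2: "(\<lambda>x. cnj (vderiv (vderiv \<psi>) x)) = vderiv (vderiv \<phi>)"
      unfolding \<phi>_def by (simp add: vderiv_cnj \<psi> test_vderiv)
    have d2i: "(\<lambda>x. \<i> * vderiv (vderiv \<phi>) x) = vderiv (vderiv (\<lambda>x. \<i> * \<phi> x))"
      by (simp add: vderiv_cmult \<phi> test_vderiv)
    have "inner w (abs_l2 (\<lambda>x. cnj (vderiv (vderiv \<psi>) x))) = - inner v (abs_l2 (\<lambda>x. cnj (\<psi> x)))"
      using orth[OF \<phi>] unfolding d2 by (simp add: \<phi>_def)
    moreover have "inner w (abs_l2 (\<lambda>x. \<i> * cnj (vderiv (vderiv \<psi>) x))) = - inner v (abs_l2 (\<lambda>x. \<i> * cnj (\<psi> x)))"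
    proof -
      have "(\<lambda>x. \<i> * cnj (vderiv (vderiv \<psi>) x)) = vderiv (vderiv (\<lambda>x. \<i> * \<phi> x))"
        unfolding d2i[symmetric] using fun_cong[OF d2] by simp
      then show ?thesis using orth[OF test_cmult[OF \<phi>, of \<i>]] by (simp add: \<phi>_def)
    qed
    ultimately show "distr_of w (vderiv (vderiv \<psi>)) = - distr_of v \<psi>"
      unfolding distr_of_eq_inner[OF test_square_integrable[OF t]] distr_of_eq_inner[OF test_square_integrable[OF \<psi>]]
      by simp
  qed
  then have "f = p" by (simp add: v_def)
  then show "f \<in> fst ` closure bessel_core" using p(1) by force
qed

text \<open>\<open>Uint h\<close> and \<open>Vint h\<close> are the required representative and its
  derivative; both vanish at 0 by construction.\<close>

lemma core_subset_H2_0: "fst ` closure bessel_core \<subseteq> H2_0"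
proof
  fix f assume "f \<in> fst ` closure bessel_core"
  then obtain h q where fhq: "(f, h, q) \<in> closure bessel_core" by force
  have "distr_eq (distr_deriv (distr_deriv (distr_of f))) (distr_of h)"
    using closure_bessel_core_weak(1)[OF fhq] by (simp add: distr_eq_def distr_deriv_def)
  moreover have "continuous_on {0..} (Vint h)"
    by (intro continuous_at_imp_continuous_on ballI Vint_continuous)
  moreover have "(Uint h has_vector_derivative Vint h x) (at x within {0..})" for x
    by (rule has_vector_derivative_at_within[OF Uint_deriv])
  ultimately show "f \<in> H2_0"
    using closure_bessel_core_Uint[OF fhq] Uint_nonpos[of 0 h] Vint_nonpos[of 0 h]
    unfolding H2_0_def H2_def by blast
qed

lemma Domain_L_min:
  assumes "\<bar>Re (csqrt \<alpha>)\<bar> < 1"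
  shows "Domain (L_min \<alpha>) = fst ` closure bessel_core"
  unfolding L_min_eq[OF assms] Domain_fst by (simp add: image_image bessel_map_def case_prod_unfold)

section \<open>Holomorphy\<close>

lemma H2_0_eq: "H2_0 = fst ` closure bessel_core"
  using H2_0_subset_core core_subset_H2_0 by (rule antisym)

text \<open>The pair \<open>(f'', f / x\<^sup>2)\<close>; unspecified unless \<open>f\<close> lies in \<open>H\<^sup>2\<^sub>0\<close>.\<close>

definition H2_0_data :: "l2 \<Rightarrow> l2 \<times> l2" where
  "H2_0_data f = (THE p. (f, p) \<in> closure bessel_core)"

lemma H2_0_data_eq:
  assumes "(f, p) \<in> closure bessel_core"
  shows "H2_0_data f = p"
  unfolding H2_0_data_def
proof (rule the_equality)
  fix p' assume "(f, p') \<in> closure bessel_core"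
  then show "p' = p"
    using assms closure_bessel_core_unique by (cases p; cases p') blast
qed (rule assms)

lemma H2_0_data: "f \<in> H2_0 \<Longrightarrow> (f, H2_0_data f) \<in> closure bessel_core"
  using H2_0_data_eq by (auto simp: H2_0_eq)

lemma H2_0I: "(f, p) \<in> closure bessel_core \<Longrightarrow> f \<in> H2_0"
  by (force simp: H2_0_eq)

section \<open>The Banach space structure on the common domain\<close>

lemma H2_0_zero: "0 \<in> H2_0" "H2_0_data 0 = 0"
proof -
  have "(0, 0) \<in> closure bessel_core"
    using subspace_0[OF subspace_closure[OF subspace_bessel_core]] by (simp add: zero_prod_def)
  then show "0 \<in> H2_0" "H2_0_data 0 = 0" by (auto intro: H2_0I H2_0_data_eq)
qed

lemma H2_0_add:
  assumes "f \<in> H2_0" "g \<in> H2_0"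
  shows "f + g \<in> H2_0" "H2_0_data (f + g) = H2_0_data f + H2_0_data g"
proof -
  have "(f + g, H2_0_data f + H2_0_data g) \<in> closure bessel_core"
    using subspace_add[OF subspace_closure[OF subspace_bessel_core] H2_0_data[OF assms(1)] H2_0_data[OF assms(2)]]
    by simp
  then show "f + g \<in> H2_0" "H2_0_data (f + g) = H2_0_data f + H2_0_data g"
    by (auto intro: H2_0I H2_0_data_eq)
qed

lemma H2_0_scaleC:
  assumes "f \<in> H2_0"
  shows "c *\<^sub>C f \<in> H2_0" "H2_0_data (c *\<^sub>C f) = (c *\<^sub>C fst (H2_0_data f), c *\<^sub>C snd (H2_0_data f))"
proof -
  have "(c *\<^sub>C f, c *\<^sub>C fst (H2_0_data f), c *\<^sub>C snd (H2_0_data f)) \<in> closure bessel_core"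
    by (rule closure_bessel_core_scaleC) (use H2_0_data[OF assms] in simp)
  then show "c *\<^sub>C f \<in> H2_0" "H2_0_data (c *\<^sub>C f) = (c *\<^sub>C fst (H2_0_data f), c *\<^sub>C snd (H2_0_data f))"
    by (auto intro: H2_0I H2_0_data_eq)
qed

lemma H2_0_diff:
  assumes "f \<in> H2_0" "g \<in> H2_0"
  shows "f - g \<in> H2_0" "H2_0_data (f - g) = H2_0_data f - H2_0_data g"
proof -
  have "(f - g, H2_0_data f - H2_0_data g) \<in> closure bessel_core"
    using subspace_diff[OF subspace_closure[OF subspace_bessel_core] H2_0_data[OF assms(1)] H2_0_data[OF assms(2)]]
    by simp
  then show "f - g \<in> H2_0" "H2_0_data (f - g) = H2_0_data f - H2_0_data g"
    by (auto intro: H2_0I H2_0_data_eq)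
qed

text \<open>Including f/x^2 along with f and f'' makes \<open>H2_0\<close> isometric to the closed
  space of triples, and bounds every \<open>L_min \<alpha>\<close> without the norm depending on
  \<alpha>.\<close>

definition H2_0_norm :: "l2 \<Rightarrow> real" where
  "H2_0_norm f = norm (f, H2_0_data f)"

definition H2_0_space :: "l2 cbs" where
  "H2_0_space = \<lparr>cbs_carrier = H2_0, cbs_zero = 0, cbs_add = (+), cbs_scale = scaleC, cbs_norm = H2_0_norm\<rparr>"

lemma H2_0_space_simps [simp]:
  "cbs_carrier H2_0_space = H2_0" "cbs_zero H2_0_space = 0" "cbs_add H2_0_space = (+)"
  "cbs_scale H2_0_space = scaleC" "cbs_norm H2_0_space = H2_0_norm" "cbs_diff H2_0_space x y = x - y"
  by (simp_all add: H2_0_space_def cbs_diff_def scaleC_minus_one)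

lemma norm_scaleC_Pair:
  "norm (c *\<^sub>C f, c *\<^sub>C h, c *\<^sub>C q) = cmod c * norm (f, h, q)" for f h q :: "'a::complex_banach"
  by (simp add: norm_Pair norm_scaleC power_mult_distrib distrib_left[symmetric] real_sqrt_mult)

text \<open>Completeness is inherited from the closure of the core, onto which \<open>f\<close> with
  its data is mapped isometrically.\<close>

lemma complex_banach_space_H2_0: "complex_banach_space H2_0_space"
  unfolding complex_banach_space_def
proof (intro conjI)
  show "cbs_vector_space H2_0_space"
    unfolding cbs_vector_space_def
    by (auto simp: H2_0_zero H2_0_add H2_0_scaleC scaleC_add_left scaleC_add_right scaleC_scaleC scaleC_one
        add.assoc add.commute)
  show "cbs_normed H2_0_space"
    unfolding cbs_normed_def
  proof (simp, intro conjI ballI allI)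
    fix f assume f: "f \<in> H2_0"
    show "0 \<le> H2_0_norm f" by (simp add: H2_0_norm_def)
    show "(H2_0_norm f = 0) = (f = 0)" using H2_0_zero(2) by (auto simp: H2_0_norm_def zero_prod_def)
    show "H2_0_norm (c *\<^sub>C f) = cmod c * H2_0_norm f" for c
      using norm_scaleC_Pair[of c f "fst (H2_0_data f)" "snd (H2_0_data f)"]
      by (simp add: H2_0_norm_def H2_0_scaleC(2)[OF f])
    fix g assume g: "g \<in> H2_0"
    show "H2_0_norm (f + g) \<le> H2_0_norm f + H2_0_norm g"
      using norm_triangle_ineq[of "(f, H2_0_data f)" "(g, H2_0_data g)"]
      by (simp add: H2_0_norm_def H2_0_add(2)[OF f g])
  qed
  show "cbs_complete H2_0_space"
    unfolding cbs_complete_def H2_0_space_simps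
  proof (intro allI impI)
    fix X :: "nat \<Rightarrow> l2"
    assume X: "\<forall>n. X n \<in> H2_0"
      and cau: "\<forall>e>0. \<exists>N. \<forall>m\<ge>N. \<forall>n\<ge>N. H2_0_norm (X m - X n) < e"
    define T where "T n = (X n, H2_0_data (X n))" for n
    have T: "T n \<in> closure bessel_core" for n unfolding T_def by (rule H2_0_data) (use X in blast)
    have N: "H2_0_norm (X m - g) = norm (T m - (g, H2_0_data g))" if "g \<in> H2_0" for m g
      using X that by (simp add: H2_0_norm_def T_def H2_0_diff(2))
    have "Cauchy T" using cau X by (intro CauchyI) (simp add: N T_def[symmetric])
    then obtain t where t: "T \<longlonglongrightarrow> t" using Cauchy_convergent_iff convergent_def by blast
    have "t \<in> closure bessel_core" using closed_sequentially[OF closed_closure] T t by blast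
    then have f: "fst t \<in> H2_0" "(fst t, H2_0_data (fst t)) = t"
      using H2_0I[of "fst t" "snd t"] H2_0_data_eq[of "fst t" "snd t"] by auto
    have "(\<lambda>n. norm (T n - t)) \<longlonglongrightarrow> 0" using t by (intro tendsto_norm_zero) (simp add: LIM_zero)
    then show "\<exists>x\<in>H2_0. (\<lambda>n. H2_0_norm (X n - x)) \<longlonglongrightarrow> 0"
      by (intro bexI[OF _ f(1)]) (simp add: N[OF f(1)] f(2))
  qed
qed

lemma L_min_iff:
  assumes "\<bar>Re (csqrt \<alpha>)\<bar> < 1"
  shows "(f, g) \<in> L_min \<alpha> \<longleftrightarrow> f \<in> H2_0 \<and> g = - fst (H2_0_data f) + (\<alpha> - 1/4) *\<^sub>C snd (H2_0_data f)"
proof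
  assume "(f, g) \<in> L_min \<alpha>"
  then obtain h q where "(f, h, q) \<in> closure bessel_core" "g = - h + (\<alpha> - 1/4) *\<^sub>C q"
    unfolding L_min_eq[OF assms] by (auto simp: bessel_map_def)
  then show "f \<in> H2_0 \<and> g = - fst (H2_0_data f) + (\<alpha> - 1/4) *\<^sub>C snd (H2_0_data f)"
    using H2_0I H2_0_data_eq by fastforce
next
  assume *: "f \<in> H2_0 \<and> g = - fst (H2_0_data f) + (\<alpha> - 1/4) *\<^sub>C snd (H2_0_data f)"
  then have "(f, H2_0_data f) \<in> closure bessel_core" by (simp add: H2_0_data)
  moreover have "(f, g) = bessel_map \<alpha> (f, H2_0_data f)" using * by (simp add: bessel_map_def case_prod_unfold)
  ultimately show "(f, g) \<in> L_min \<alpha>" unfolding L_min_eq[OF assms] by blast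
qed

lemma closed_operator_L_min:
  assumes "\<bar>Re (csqrt \<alpha>)\<bar> < 1"
  shows "closed_operator (L_min \<alpha>)"
  unfolding closed_operator_def L_min_iff[OF assms]
proof (intro conjI allI impI; (elim conjE)?)
  show "closed (L_min \<alpha>)" by (simp add: L_min_def)
  show "single_valued (L_min \<alpha>)" by (auto simp: single_valued_def L_min_iff[OF assms])
qed (auto simp: H2_0_zero H2_0_add H2_0_scaleC scaleC_zero_right scaleC_add_right scaleC_diff_right
    scaleC_minus_right scaleC_scaleC mult.commute)

lemma op_apply_L_min:
  assumes "\<bar>Re (csqrt \<alpha>)\<bar> < 1" "f \<in> H2_0"
  shows "op_apply (L_min \<alpha>) f = - fst (H2_0_data f) + (\<alpha> - 1/4) *\<^sub>C snd (H2_0_data f)"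
  unfolding op_apply_def L_min_iff[OF assms(1)] using assms(2) by simp

lemma H2_0_norm_bounds:
  "norm f \<le> H2_0_norm f" "norm (fst (H2_0_data f)) \<le> H2_0_norm f" "norm (snd (H2_0_data f)) \<le> H2_0_norm f"
proof -
  show "norm f \<le> H2_0_norm f" using norm_fst_le[of f "H2_0_data f"] by (simp add: H2_0_norm_def)
  have 1: "norm (H2_0_data f) \<le> H2_0_norm f" using norm_snd_le[of "H2_0_data f" f] by (simp add: H2_0_norm_def)
  show "norm (fst (H2_0_data f)) \<le> H2_0_norm f" "norm (snd (H2_0_data f)) \<le> H2_0_norm f"
    using order_trans[OF norm_fst_le[of "fst (H2_0_data f)" "snd (H2_0_data f)"]]
      order_trans[OF norm_snd_le[of "snd (H2_0_data f)" "fst (H2_0_data f)"]] 1 by simp_all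
qed

lemma bounded_operator_zero: "bounded_operator H2_0_space (\<lambda>x. 0 :: l2)"
  unfolding bounded_operator_def by (auto simp: scaleC_zero_right H2_0_norm_def intro!: exI[of _ 0])

lemma bounded_operator_id: "bounded_operator H2_0_space (\<lambda>x. x)"
  unfolding bounded_operator_def by (auto simp: H2_0_norm_bounds intro!: exI[of _ 1])

lemma bounded_operator_snd: "bounded_operator H2_0_space (\<lambda>f. snd (H2_0_data f))"
  unfolding bounded_operator_def
  by (auto simp: H2_0_norm_bounds H2_0_add H2_0_scaleC intro!: exI[of _ 1])

lemma bounded_operator_L_min:
  assumes "\<bar>Re (csqrt \<alpha>)\<bar> < 1"
  shows "bounded_operator H2_0_space (op_apply (L_min \<alpha>))"
  unfolding bounded_operator_def H2_0_space_simps
proof (intro conjI ballI allI exI[of _ "1 + cmod (\<alpha> - 1/4)"])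
  fix f assume f: "f \<in> H2_0"
  show "op_apply (L_min \<alpha>) (c *\<^sub>C f) = c *\<^sub>C op_apply (L_min \<alpha>) f" for c
    using f by (simp add: op_apply_L_min[OF assms] H2_0_scaleC scaleC_add_right scaleC_diff_right scaleC_minus_right scaleC_scaleC mult.commute)
  show "op_apply (L_min \<alpha>) (f + g) = op_apply (L_min \<alpha>) f + op_apply (L_min \<alpha>) g" if "g \<in> H2_0" for g
    using f that by (simp add: op_apply_L_min[OF assms] H2_0_add scaleC_add_right)
  have "norm (op_apply (L_min \<alpha>) f) \<le> norm (fst (H2_0_data f)) + cmod (\<alpha> - 1/4) * norm (snd (H2_0_data f))"
    unfolding op_apply_L_min[OF assms f] by (rule order_trans[OF norm_triangle_ineq]) (simp add: norm_scaleC)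
  also have "\<dots> \<le> H2_0_norm f + cmod (\<alpha> - 1/4) * H2_0_norm f"
    by (intro add_mono mult_left_mono H2_0_norm_bounds) auto
  finally show "norm (op_apply (L_min \<alpha>) f) \<le> (1 + cmod (\<alpha> - 1/4)) * H2_0_norm f"
    by (simp add: algebra_simps)
qed

text \<open>The square of the real part of a root is (|\<alpha>| + Re \<alpha>)/2, so the region is
  the interior of the parabola |\<alpha>| + Re \<alpha> = 2; this form is continuous across the
  branch cut of \<open>csqrt\<close>.\<close>

lemma open_bessel_parameters: "open {\<alpha>. \<bar>Re (csqrt \<alpha>)\<bar> < 1}"
proof -
  have "\<bar>Re (csqrt \<alpha>)\<bar> = sqrt ((cmod \<alpha> + Re \<alpha>) / 2)" for \<alpha>
    using complex_Re_le_cmod[of "- \<alpha>"] by simp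
  then have "{\<alpha>. \<bar>Re (csqrt \<alpha>)\<bar> < 1} = {\<alpha>. cmod \<alpha> + Re \<alpha> < 2}" by (simp del: csqrt.simps)
  then show ?thesis by (simp add: open_Collect_less continuous_intros)
qed

lemma holomorphic_id: "open \<Theta> \<Longrightarrow> holomorphic_bounded_family H2_0_space \<Theta> (\<lambda>z x. x)"
  unfolding holomorphic_bounded_family_def
  by (auto simp: bounded_operator_id scaleC_zero_right H2_0_norm_def intro!: exI[of _ "\<lambda>x. 0"] bounded_operator_zero)

text \<open>The family is affine in \<alpha> on a fixed domain: its derivative is multiplication by
  x^-2 and the remainder is exactly zero. Openness of the region makes the explicit formula
  available at the nearby points \<open>w\<close>.\<close>

lemma holomorphic_L_min:
  "holomorphic_bounded_family H2_0_space {\<alpha>. \<bar>Re (csqrt \<alpha>)\<bar> < 1} (\<lambda>\<alpha>. op_apply (L_min \<alpha>))"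
  unfolding holomorphic_bounded_family_def
proof (intro conjI ballI open_bessel_parameters)
  fix z assume "z \<in> {\<alpha>. \<bar>Re (csqrt \<alpha>)\<bar> < 1}"
  then have z: "\<bar>Re (csqrt z)\<bar> < 1" by simp
  show "bounded_operator H2_0_space (op_apply (L_min z))" by (rule bounded_operator_L_min[OF z])
  show "\<exists>D. bounded_operator H2_0_space D \<and>
        (\<forall>e>0. \<forall>\<^sub>F w in at z. \<forall>x\<in>cbs_carrier H2_0_space.
           norm (op_apply (L_min w) x - op_apply (L_min z) x - (w - z) *\<^sub>C D x) \<le> e * cmod (w - z) * cbs_norm H2_0_space x)"
  proof (intro exI[of _ "\<lambda>f. snd (H2_0_data f)"] conjI allI impI bounded_operator_snd)
    fix e :: real assume e: "e > 0"
    have "\<forall>\<^sub>F w in at z. w \<in> {\<alpha>. \<bar>Re (csqrt \<alpha>)\<bar> < 1}"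
      using open_bessel_parameters z by (intro eventually_at_in_open') auto
    then show "\<forall>\<^sub>F w in at z. \<forall>x\<in>cbs_carrier H2_0_space.
           norm (op_apply (L_min w) x - op_apply (L_min z) x - (w - z) *\<^sub>C snd (H2_0_data x)) \<le> e * cmod (w - z) * cbs_norm H2_0_space x"
    proof eventually_elim
      case (elim w)
      then have w: "\<bar>Re (csqrt w)\<bar> < 1" by simp
      have "op_apply (L_min w) x - op_apply (L_min z) x - (w - z) *\<^sub>C snd (H2_0_data x) = 0" if "x \<in> H2_0" for x
        unfolding op_apply_L_min[OF w that] op_apply_L_min[OF z that] by (simp add: scaleC_diff_left)
      then show ?case using e by (simp add: H2_0_norm_def)
    qed
  qed
qed

theorem theorem4p1:
  shows "(\<forall>\<alpha>. \<bar>Re (csqrt \<alpha>)\<bar> < 1 \<longrightarrow> Domain (L_min \<alpha>) = H2_0) \<and>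
         holomorphic_closed_family {\<alpha>. \<bar>Re (csqrt \<alpha>)\<bar> < 1} L_min"
proof (intro conjI allI impI)
  show dom: "Domain (L_min \<alpha>) = H2_0" if "\<bar>Re (csqrt \<alpha>)\<bar> < 1" for \<alpha>
    by (simp add: Domain_L_min[OF that] H2_0_eq)
  let ?\<Theta> = "{\<alpha>. \<bar>Re (csqrt \<alpha>)\<bar> < 1}"
  show "holomorphic_closed_family ?\<Theta> L_min"
    unfolding holomorphic_closed_family_def
  proof (intro conjI ballI)
    fix z0 assume "z0 \<in> ?\<Theta>"
    then show "\<exists>\<Theta>\<^sub>0 (K :: l2 cbs) A. open \<Theta>\<^sub>0 \<and> z0 \<in> \<Theta>\<^sub>0 \<and> \<Theta>\<^sub>0 \<subseteq> ?\<Theta> \<and> complex_banach_space K \<and>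
        holomorphic_bounded_family K \<Theta>\<^sub>0 A \<and> (\<forall>z\<in>\<Theta>\<^sub>0. A z ` cbs_carrier K = Domain (L_min z)) \<and>
        holomorphic_bounded_family K \<Theta>\<^sub>0 (\<lambda>z x. op_apply (L_min z) (A z x))"
      \<comment> \<open>One chart covers the whole region: the auxiliary space is the common domain,
        and the parametrizing map is its inclusion, constant in the parameter.\<close>
      by (intro exI[of _ ?\<Theta>] exI[of _ H2_0_space] exI[of _ "\<lambda>z x. x"] conjI subset_refl open_bessel_parameters
          complex_banach_space_H2_0 holomorphic_id holomorphic_L_min) (auto simp: dom)
  qed (simp_all add: closed_operator_L_min open_bessel_parameters del: csqrt.simps)
qed

end
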